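(* Let $\Gamma$ be a connected, locally finite graph of infinite rank. Then $\mathrm{PMap}(\Gamma)$ contains a subgroup isomorphic to the Grigorchuk group. Consequently $\mathrm{PMap}(\Gamma)$ and $\mathrm{Map}(\Gamma)$ do not satisfy the Tits alternative.
   Context: The rank of $\Gamma$ is the rank of $\pi_1(\Gamma)$. $\mathrm{Map}(\Gamma)$ is the group of proper homotopy classes of proper homotopy equivalences $\Gamma\to\Gamma$; it acts by homeomorphisms on the end space $E(\Gamma)$ and on the subspace $E_\ell(\Gamma)$ of ends accumulated by loops, and $\mathrm{PMap}(\Gamma)$ is the kernel of this action. The Grigorchuk group is the group of automorphisms of the rooted binary tree generated by the standard generators $a,b,c,d$ (a finitely generated infinite torsion group of intermediate growth). A group satisfies the Tits alternative if every subgroup either is virtually solvable or contains a nonabelian free subgroup. *)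

theory Defs
  imports "HOL-Analysis.Analysis" "HOL-Algebra.Algebra"
begin

section \<open>Graphs and their geometric realizations\<close>

text \<open>A graph (loops and multiple edges allowed) is given by a vertex type 'v, an edge type 'e
  and an endpoint map ends :: 'e => 'v * 'v (the edge e runs from fst (ends e) to snd (ends e)).
  Points of the realization: Inl v for vertices, Inr (e,t) with 0 < t < 1 for interior points
  of edges.\<close>

definition graph_locally_finite :: "('e \<Rightarrow> 'v \<times> 'v) \<Rightarrow> bool" where
  "graph_locally_finite ends \<longleftrightarrow>
     (\<forall>v. finite {e. fst (ends e) = v \<or> snd (ends e) = v})"

definition graph_adj :: "('e \<Rightarrow> 'v \<times> 'v) \<Rightarrow> ('v \<times> 'v) set" where
  "graph_adj ends = {(u, w). \<exists>e. ends e = (u, w) \<or> ends e = (w, u)}"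

definition graph_connected :: "('e \<Rightarrow> 'v \<times> 'v) \<Rightarrow> bool" where
  "graph_connected ends \<longleftrightarrow> (\<forall>u w. (u, w) \<in> (graph_adj ends)\<^sup>*)"

definition graph_points :: "('e \<Rightarrow> 'v \<times> 'v) \<Rightarrow> ('v + 'e \<times> real) set" where
  "graph_points ends = range Inl \<union> {Inr (e, t) | e t. 0 < t \<and> t < 1}"

text \<open>characteristic map of the edge e, defined on [0,1]\<close>
definition edge_char :: "('e \<Rightarrow> 'v \<times> 'v) \<Rightarrow> 'e \<Rightarrow> real \<Rightarrow> 'v + 'e \<times> real" where
  "edge_char ends e t =
     (if t \<le> 0 then Inl (fst (ends e)) else if 1 \<le> t then Inl (snd (ends e)) else Inr (e, t))"

text \<open>CW (weak) topology of the 1-complex: a set is open iff its preimage under every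
  characteristic map is open in [0,1].\<close>
definition graph_top :: "('e \<Rightarrow> 'v \<times> 'v) \<Rightarrow> ('v + 'e \<times> real) topology" where
  "graph_top ends = topology (\<lambda>U. U \<subseteq> graph_points ends \<and>
      (\<forall>e. openin (top_of_set {0..1}) {t \<in> {0..1}. edge_char ends e t \<in> U}))"

section \<open>Fundamental group and rank\<close>

definition loops_at :: "'a topology \<Rightarrow> 'a \<Rightarrow> (real \<Rightarrow> 'a) set" where
  "loops_at Tp x0 = {g. pathin Tp g \<and> g 0 = x0 \<and> g 1 = x0}"

definition loop_class :: "'a topology \<Rightarrow> 'a \<Rightarrow> (real \<Rightarrow> 'a) \<Rightarrow> (real \<Rightarrow> 'a) set" where
  "loop_class Tp x0 g = {h \<in> loops_at Tp x0.
     homotopic_with (\<lambda>k. k 0 = x0 \<and> k 1 = x0) (top_of_set {0..1}) Tp g h}"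

definition loop_join :: "(real \<Rightarrow> 'a) \<Rightarrow> (real \<Rightarrow> 'a) \<Rightarrow> real \<Rightarrow> 'a" where
  "loop_join g h = (\<lambda>t. if t \<le> 1/2 then g (2 * t) else h (2 * t - 1))"

definition fundamental_group :: "'a topology \<Rightarrow> 'a \<Rightarrow> ((real \<Rightarrow> 'a) set) monoid" where
  "fundamental_group Tp x0 =
    \<lparr> carrier = loop_class Tp x0 ` loops_at Tp x0,
      mult = (\<lambda>A B. loop_class Tp x0 (loop_join (SOME g. g \<in> A) (SOME h. h \<in> B))),
      one = loop_class Tp x0 (\<lambda>t. x0) \<rparr>"

definition finitely_generated_group :: "('a, 'b) monoid_scheme \<Rightarrow> bool" where
  "finitely_generated_group G \<longleftrightarrow>
     (\<exists>S. finite S \<and> S \<subseteq> carrier G \<and> generate G S = carrier G)"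

text \<open>rank of pi_1 is infinite, i.e. pi_1 has no finite generating set\<close>
definition graph_infinite_rank :: "('e \<Rightarrow> 'v \<times> 'v) \<Rightarrow> bool" where
  "graph_infinite_rank ends \<longleftrightarrow>
     (\<forall>x0 \<in> topspace (graph_top ends).
        \<not> finitely_generated_group (fundamental_group (graph_top ends) x0))"

section \<open>Mapping class group Map and pure mapping class group PMap\<close>

definition proper_cont :: "'a topology \<Rightarrow> ('a \<Rightarrow> 'a) \<Rightarrow> bool" where
  "proper_cont Tp f \<longleftrightarrow> continuous_map Tp Tp f \<and> proper_map Tp Tp f"

definition proper_homotopic :: "'a topology \<Rightarrow> ('a \<Rightarrow> 'a) \<Rightarrow> ('a \<Rightarrow> 'a) \<Rightarrow> bool" where
  "proper_homotopic Tp f g \<longleftrightarrow>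
     (\<exists>H. continuous_map (prod_topology (top_of_set {0..1::real}) Tp) Tp H \<and>
          proper_map (prod_topology (top_of_set {0..1::real}) Tp) Tp H \<and>
          (\<forall>x \<in> topspace Tp. H (0, x) = f x \<and> H (1, x) = g x))"

definition proper_homotopy_equivalence :: "'a topology \<Rightarrow> ('a \<Rightarrow> 'a) \<Rightarrow> bool" where
  "proper_homotopy_equivalence Tp f \<longleftrightarrow> proper_cont Tp f \<and>
     (\<exists>g. proper_cont Tp g \<and> proper_homotopic Tp (g \<circ> f) id \<and> proper_homotopic Tp (f \<circ> g) id)"

definition ph_class :: "'a topology \<Rightarrow> ('a \<Rightarrow> 'a) \<Rightarrow> ('a \<Rightarrow> 'a) set" where
  "ph_class Tp f = {g. proper_homotopy_equivalence Tp g \<and> proper_homotopic Tp f g}"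

definition MapGroup :: "'a topology \<Rightarrow> (('a \<Rightarrow> 'a) set) monoid" where
  "MapGroup Tp =
    \<lparr> carrier = ph_class Tp ` {f. proper_homotopy_equivalence Tp f},
      mult = (\<lambda>A B. ph_class Tp ((SOME f. f \<in> A) \<circ> (SOME g. g \<in> B))),
      one = ph_class Tp id \<rparr>"

text \<open>Ends: compatible choices of a complementary component for every compact set.\<close>
definition ends_of :: "'a topology \<Rightarrow> ('a set \<Rightarrow> 'a set) set" where
  "ends_of Tp = {\<epsilon>. (\<forall>K. compactin Tp K \<longrightarrow>
        \<epsilon> K \<in> connected_components_of (subtopology Tp (topspace Tp - K))) \<and>
     (\<forall>K L. compactin Tp K \<and> compactin Tp L \<and> K \<subseteq> L \<longrightarrow> \<epsilon> L \<subseteq> \<epsilon> K)}"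

text \<open>A proper map f sends the end \<epsilon> to the end \<epsilon>' iff for every compact K, some neighbourhood
  \<epsilon> L of \<epsilon> is mapped into \<epsilon>' K.\<close>
definition maps_end_to :: "'a topology \<Rightarrow> ('a \<Rightarrow> 'a) \<Rightarrow> ('a set \<Rightarrow> 'a set) \<Rightarrow> ('a set \<Rightarrow> 'a set) \<Rightarrow> bool" where
  "maps_end_to Tp f \<epsilon> \<epsilon>' \<longleftrightarrow>
     (\<forall>K. compactin Tp K \<longrightarrow> (\<exists>L. compactin Tp L \<and> f ` (\<epsilon> L) \<subseteq> \<epsilon>' K))"

text \<open>PMap: kernel of the action of Map on the end space.\<close>
definition PMapGroup :: "'a topology \<Rightarrow> (('a \<Rightarrow> 'a) set) monoid" where
  "PMapGroup Tp = (MapGroup Tp)\<lparr> carrier :=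
     {A \<in> carrier (MapGroup Tp). \<forall>f \<in> A. \<forall>\<epsilon> \<in> ends_of Tp. maps_end_to Tp f \<epsilon> \<epsilon>} \<rparr>"

section \<open>The Grigorchuk group\<close>

fun grig_a :: "bool list \<Rightarrow> bool list" where
  "grig_a [] = []"
| "grig_a (x # w) = (\<not> x) # w"

fun grig_b :: "bool list \<Rightarrow> bool list"
and grig_c :: "bool list \<Rightarrow> bool list"
and grig_d :: "bool list \<Rightarrow> bool list" where
  "grig_b [] = []"
| "grig_b (x # w) = (if x then True # grig_c w else False # grig_a w)"
| "grig_c [] = []"
| "grig_c (x # w) = (if x then True # grig_d w else False # grig_a w)"
| "grig_d [] = []"
| "grig_d (x # w) = (if x then True # grig_b w else False # w)"

definition Grigorchuk_group :: "(bool list \<Rightarrow> bool list) monoid" where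
  "Grigorchuk_group = (BijGroup (UNIV :: bool list set))\<lparr> carrier :=
     generate (BijGroup (UNIV :: bool list set)) {grig_a, grig_b, grig_c, grig_d} \<rparr>"

section \<open>Tits alternative\<close>

fun eval_word :: "('a, 'b) monoid_scheme \<Rightarrow> ('a \<times> bool) list \<Rightarrow> 'a" where
  "eval_word G [] = \<one>\<^bsub>G\<^esub>"
| "eval_word G ((x, b) # ws) = (if b then x else inv\<^bsub>G\<^esub> x) \<otimes>\<^bsub>G\<^esub> eval_word G ws"

fun reduced_word :: "('a \<times> bool) list \<Rightarrow> bool" where
  "reduced_word ((x, b) # (y, c) # ws) = (\<not> (x = y \<and> b \<noteq> c) \<and> reduced_word ((y, c) # ws))"
| "reduced_word _ = True"

text \<open>B is a free basis of the subgroup it generates\<close>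
definition free_basis :: "('a, 'b) monoid_scheme \<Rightarrow> 'a set \<Rightarrow> bool" where
  "free_basis G B \<longleftrightarrow> B \<subseteq> carrier G \<and>
     (\<forall>ws. ws \<noteq> [] \<and> fst ` set ws \<subseteq> B \<and> reduced_word ws \<longrightarrow> eval_word G ws \<noteq> \<one>\<^bsub>G\<^esub>)"

definition has_nonabelian_free_subgroup :: "('a, 'b) monoid_scheme \<Rightarrow> 'a set \<Rightarrow> bool" where
  "has_nonabelian_free_subgroup G S \<longleftrightarrow>
     (\<exists>B. B \<subseteq> S \<and> free_basis G B \<and> (\<exists>x \<in> B. \<exists>y \<in> B. x \<noteq> y))"

definition virtually_solvable_subgroup :: "('a, 'b) monoid_scheme \<Rightarrow> 'a set \<Rightarrow> bool" where
  "virtually_solvable_subgroup G S \<longleftrightarrow>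
     (\<exists>K. subgroup K G \<and> K \<subseteq> S \<and> finite (rcosets\<^bsub>G\<lparr>carrier := S\<rparr>\<^esub> K) \<and>
          solvable (G\<lparr>carrier := K\<rparr>))"

definition tits_alternative :: "('a, 'b) monoid_scheme \<Rightarrow> bool" where
  "tits_alternative G \<longleftrightarrow>
     (\<forall>S. subgroup S G \<longrightarrow> virtually_solvable_subgroup G S \<or> has_nonabelian_free_subgroup G S)"

end

theory Submission
  imports Defs "HOL-Complex_Analysis.Winding_Numbers"
begin

text \<open>If only finitely many edges lay outside a spanning tree of \<open>\<Gamma>\<close>, its fundamental group would be
  finitely generated. So infinitely many do, and by the pigeonhole principle one can attach to every
  binary word \<open>w\<close> its own such edge, in such a way that the start points of the edges attached to words
  of one length lie below a common vertex of the tree, whose depth grows with the length, and likewise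
  for the end points. Sliding these edges up the tree to the common vertices gives a properly
  homotopy equivalent graph in which the edges attached to words of equal length are parallel. The
  Grigorchuk group permutes them strictly, through its action on words; conjugating by the homotopy
  equivalence yields maps of \<open>\<Gamma>\<close> fixing all vertices, hence all ends. The action is faithful up to
  homotopy because winding numbers distinguish parallel edges. Finally, the Grigorchuk group is an
  infinite finitely generated torsion group: it has no free subgroups, and a finitely generated
  solvable torsion group is finite.\<close>

section \<open>The Grigorchuk group\<close>

text \<open>The graph itself need not have a single pair of parallel edges, so the group cannot
  simply permute edges of \<Gamma>. Only a properly homotopy equivalent graph admits the strict
  action; conjugation preserves products up to homotopy, which is all that mapping classes see. The
  obstacle is properness, since infinitely many edges move at once: a tree edge may be crossed by
  finitely many slides only. Hence an edge labelled by a word of length n is slid no higher than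
  depth n + 1. As there are finitely many words of each length, the slid graph stays locally finite
  and all maps and homotopies stay proper; the summand 1 keeps the levels positive, so that the root
  is never the lower end of a tree edge in use. Finite words suffice as labels because the
  Grigorchuk group preserves length and is faithful on them. Finite generation in the case of
  finitely many edges outside the tree comes from a cover by contractible charts: changing the chart
  along a loop costs at most one generator.\<close>

datatype grig_letter = LA | LB | LC | LD

fun letter_act :: "grig_letter \<Rightarrow> bool list \<Rightarrow> bool list" where
  "letter_act LA = grig_a"
| "letter_act LB = grig_b"
| "letter_act LC = grig_c"
| "letter_act LD = grig_d"

text \<open>The four generators are involutions, so words without inverse letters already represent
  the whole group, and \<open>rev\<close> inverts.\<close>

fun word_act :: "grig_letter list \<Rightarrow> bool list \<Rightarrow> bool list" where
  "word_act [] = id"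
| "word_act (s # w) = letter_act s \<circ> word_act w"

lemma word_act_append: "word_act (v @ w) = word_act v \<circ> word_act w"
  by (induction v) (auto simp: comp_assoc)

lemma grig_a_involution: "grig_a (grig_a w) = w"
  by (cases w) auto

lemma grig_bcd_involution:
  "grig_b (grig_b w) = w" "grig_c (grig_c w) = w" "grig_d (grig_d w) = w"
  by (induction w) (auto simp: grig_a_involution)

text \<open>Together with the identity, \<open>b\<close>, \<open>c\<close>, \<open>d\<close> form a
  Klein four-group. The recursion permutes the three letters cyclically, so the equations only go
  through by a joint induction.\<close>

lemma grig_bcd_mult:
  "grig_b (grig_c w) = grig_d w" "grig_c (grig_d w) = grig_b w" "grig_d (grig_b w) = grig_c w"
  "grig_c (grig_b w) = grig_d w" "grig_d (grig_c w) = grig_b w" "grig_b (grig_d w) = grig_c w"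
  by (induction w) (auto simp: grig_a_involution)

lemma letter_act_involution: "letter_act s (letter_act s w) = w"
  by (cases s) (auto simp: grig_a_involution grig_bcd_involution)

lemma length_grig_a: "length (grig_a w) = length w"
  by (cases w) auto

lemma length_grig_bcd:
  "length (grig_b w) = length w" "length (grig_c w) = length w" "length (grig_d w) = length w"
  by (induction w) (auto simp: length_grig_a)

lemma length_word_act: "length (word_act w v) = length v"
proof (induction w)
  case (Cons s w)
  then show ?case by (cases s) (auto simp: length_grig_a length_grig_bcd)
qed auto

lemma word_act_rev: "word_act (rev w) (word_act w v) = v" "word_act w (word_act (rev w) v) = v"
  by (induction w arbitrary: v) (auto simp: word_act_append letter_act_involution)

lemma bij_word_act: "bij (word_act w)"
  by (rule o_bij[of "word_act (rev w)"]) (auto simp: word_act_rev)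

text \<open>The wreath recursion: the word through which a letter acts on the rest of its argument
  once the first bit \<open>x\<close> is read.\<close>

fun letter_section :: "grig_letter \<Rightarrow> bool \<Rightarrow> grig_letter list" where
  "letter_section LA x = []"
| "letter_section LB x = (if x then [LC] else [LA])"
| "letter_section LC x = (if x then [LD] else [LA])"
| "letter_section LD x = (if x then [LB] else [])"

abbreviation flips :: "grig_letter list \<Rightarrow> bool" where
  "flips w \<equiv> odd (count_list w LA)"

text \<open>The rightmost letter acts first, so the letter \<open>s\<close> in \<open>s # w\<close> meets the first bit after \<open>w\<close>.\<close>

fun word_section :: "grig_letter list \<Rightarrow> bool \<Rightarrow> grig_letter list" where
  "word_section [] x = []"
| "word_section (s # w) x = letter_section s (x \<noteq> flips w) @ word_section w x"

lemma letter_act_Cons: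
  "letter_act s (x # v) = (x \<noteq> (s = LA)) # word_act (letter_section s x) v"
  by (cases s) auto

lemma word_act_Cons: "word_act w (x # v) = (x \<noteq> flips w) # word_act (word_section w x) v"
proof (induction w)
  case (Cons s w)
  then show ?case by (auto simp: letter_act_Cons word_act_append)
qed auto

section \<open>Torsion of the Grigorchuk group\<close>

definition periodic :: "('a \<Rightarrow> 'a) \<Rightarrow> bool" where
  "periodic f \<longleftrightarrow> (\<exists>n>0. f ^^ n = id)"

lemma periodic_common:
  assumes "periodic f" "periodic g"
  obtains n where "n > 0" "f ^^ n = id" "g ^^ n = id"
proof -
  obtain m k where "m > 0" "f ^^ m = id" "k > 0" "g ^^ k = id"
    using assms unfolding periodic_def by blast
  moreover have "f ^^ (m * k) = (f ^^ m) ^^ k" "g ^^ (m * k) = (g ^^ k) ^^ m"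
    by (simp_all add: funpow_mult mult.commute)
  ultimately show thesis using that[of "m * k"] by (simp add: id_funpow)
qed

lemma periodic_power:
  assumes "periodic (f ^^ k)" "k > 0"
  shows "periodic f"
  using assms unfolding periodic_def by (metis funpow_mult nat_0_less_mult_iff)

text \<open>The two composites are conjugate by \<open>g\<close>; surjectivity cancels
  \<open>g\<close> on the right. It allows words to be rotated cyclically.\<close>

lemma periodic_commute:
  assumes "periodic (f \<circ> g)" "surj g"
  shows "periodic (g \<circ> f)"
proof -
  obtain n where n: "n > 0" "(f \<circ> g) ^^ n = id"
    using assms unfolding periodic_def by blast
  have "(g \<circ> f) ^^ k \<circ> g = g \<circ> (f \<circ> g) ^^ k" for k
    by (induction k) (auto simp: fun_eq_iff)
  then have "(g \<circ> f) ^^ n \<circ> g = g" using n by simp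
  then have "(g \<circ> f) ^^ n = id" using assms(2) by (auto simp: fun_eq_iff) (metis surjD)
  then show ?thesis using n unfolding periodic_def by blast
qed

text \<open>Such a map acts independently on the two subtrees, so a common period of the two
  sections is a period.\<close>

lemma periodic_if_sections:
  assumes "f [] = []" and "\<And>x v. f (x # v) = x # g x v" and "\<And>x. periodic (g x)"
  shows "periodic (f :: bool list \<Rightarrow> bool list)"
proof -
  obtain n where n: "n > 0" "g True ^^ n = id" "g False ^^ n = id"
    using periodic_common[OF assms(3) assms(3)] by metis
  have "(f ^^ k) (x # v) = x # (g x ^^ k) v" for k x v
    by (induction k) (auto simp: assms)
  moreover have "(f ^^ k) [] = []" for k
    by (induction k) (auto simp: assms)
  ultimately have "(f ^^ n) v = v" for v
    using n by (cases v; cases "hd v") (auto)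
  then show ?thesis using n unfolding periodic_def by (auto simp: fun_eq_iff)
qed

lemma word_act_Nil [simp]: "word_act w [] = []"
  by (metis length_word_act length_0_conv)

definition non_a :: "grig_letter list \<Rightarrow> nat" where
  "non_a w = length (filter (\<lambda>s. s \<noteq> LA) w)"

lemma length_eq_non_a: "length w = count_list w LA + non_a w"
  by (induction w) (auto simp: non_a_def)

text \<open>Every letter meets the bit \<open>True\<close> in exactly one of the two sections. Hence
  \<open>b\<close> and \<open>c\<close> leave one letter in each, \<open>d\<close> leaves a letter
  in only one of them, and \<open>a\<close> leaves none.\<close>

lemma length_word_section:
  "length (word_section w x) + length (word_section w (\<not> x)) + count_list w LD = 2 * non_a w"
proof (induction w)
  case (Cons s w)
  then show ?case by (cases s; cases x; cases "flips w") (auto simp: non_a_def)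
qed (auto simp: non_a_def)

lemma length_word_section_le: "length (word_section w x) \<le> non_a w"
proof (induction w)
  case (Cons s w)
  then show ?case by (cases s) (auto simp: non_a_def)
qed auto

text \<open>A letter \<open>c\<close> meets the bit \<open>True\<close> in one of the two sections
  and becomes \<open>d\<close> there; likewise \<open>b\<close> becomes \<open>c\<close> in the next
  lemma.\<close>

lemma LD_in_word_section:
  "LC \<in> set w \<Longrightarrow> LD \<in> set (word_section w x) \<or> LD \<in> set (word_section w (\<not> x))"
  by (induction w) (auto split: if_splits)

lemma LC_in_word_section:
  "LB \<in> set w \<Longrightarrow> LC \<in> set (word_section w x) \<or> LC \<in> set (word_section w (\<not> x))"
  by (induction w) (auto split: if_splits)

text \<open>If no two non-\<open>a\<close> letters were adjacent, consecutive ones would be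
  separated by an \<open>a\<close>, so they could exceed the letters \<open>a\<close> by at most
  one.\<close>

lemma adjacent_non_a:
  "non_a w > count_list w LA + 1 \<Longrightarrow> \<exists>p x y q. w = p @ x # y # q \<and> x \<noteq> LA \<and> y \<noteq> LA"
proof (induction w rule: induct_list012)
  case (3 x y w)
  show ?case
  proof (cases "x \<noteq> LA \<and> y \<noteq> LA")
    case True
    then show ?thesis by (intro exI[of _ "[]"]) auto
  next
    case False
    show ?thesis
    proof (cases "x = LA")
      case True
      then have "non_a (y # w) > count_list (y # w) LA + 1" using 3 by (auto simp: non_a_def)
      then obtain p x' y' q where "y # w = p @ x' # y' # q \<and> x' \<noteq> LA \<and> y' \<noteq> LA" using 3 by blast
      then have "x # y # w = (x # p) @ x' # y' # q \<and> x' \<noteq> LA \<and> y' \<noteq> LA" by simp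
      then show ?thesis by blast
    next
      case False
      then have "y = LA" using \<open>\<not> (x \<noteq> LA \<and> y \<noteq> LA)\<close> by auto
      then have "non_a w > count_list w LA + 1" using 3 False by (auto simp: non_a_def)
      then obtain p x' y' q where "w = p @ x' # y' # q \<and> x' \<noteq> LA \<and> y' \<noteq> LA" using 3 by blast
      then have "x # y # w = (x # y # p) @ x' # y' # q \<and> x' \<noteq> LA \<and> y' \<noteq> LA" by simp
      then show ?thesis by blast
    qed
  qed
next
  case (2 x)
  then show ?case by (cases "x = LA") (auto simp: non_a_def)
qed (auto simp: non_a_def)

text \<open>The Klein four-group law: a product of two of \<open>b\<close>, \<open>c\<close>,
  \<open>d\<close> is trivial or a single letter.\<close>

lemma merge_non_a:
  assumes "x \<noteq> LA" "y \<noteq> LA"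
  shows "\<exists>u. length u \<le> 1 \<and> word_act u = word_act [x, y]"
proof -
  have "\<exists>u \<in> {[], [LB], [LC], [LD]}. word_act u = word_act [x, y]"
    using assms by (cases x; cases y) (auto simp: fun_eq_iff grig_bcd_mult grig_bcd_involution)
  then obtain u where "u \<in> {[], [LB], [LC], [LD]}" "word_act u = word_act [x, y]" by blast
  moreover from this have "length u \<le> 1" by auto
  ultimately show ?thesis by blast
qed

text \<open>Length dominates: the factor 3 outweighs the penalty, which is at most 2. At equal
  length the rank drops along the passage from \<open>b\<close> to \<open>c\<close> to
  \<open>d\<close>.\<close>

fun word_rank :: "grig_letter list \<Rightarrow> nat" where
  "word_rank w = 3 * length w + (if LD \<in> set w then 0 else if LC \<in> set w then 1 else 2)"

text \<open>If \<open>w\<close> fixes the first bit, its sections are shorter as soon as \<open>w\<close> contains an \<open>a\<close>.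
  If \<open>w\<close> flips the first bit and alternates cyclically, the sections of its square are not longer;
  they are shorter if \<open>w\<close> contains \<open>d\<close>, contain \<open>d\<close> if \<open>w\<close> contains \<open>c\<close>,
  and contain \<open>c\<close> if \<open>w\<close> contains \<open>b\<close>.\<close>

theorem word_act_periodic: "periodic (word_act w)"
proof (induction w rule: measure_induct_rule[of word_rank])
  case (less w)
  have shorter: "periodic (word_act u)" if "length u < length w" for u
    using that by (intro less.IH) auto
  have merge: "periodic (word_act w')"
    if "length w' = length w" "w' = p @ x # y # q" "x \<noteq> LA" "y \<noteq> LA" for w' p x y q
  proof -
    obtain u where u: "length u \<le> 1" "word_act u = word_act [x, y]"
      using merge_non_a[OF \<open>x \<noteq> LA\<close> \<open>y \<noteq> LA\<close>] by blast
    have "word_act w' = word_act (p @ u @ q)"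
      using u by (simp add: word_act_append that comp_assoc)
    then show ?thesis using shorter[of "p @ u @ q"] u that by auto
  qed
  consider "LA \<notin> set w" | "LA \<in> set w" "\<not> flips w"
    | "flips w" "non_a w > count_list w LA" | "flips w" "non_a w \<le> count_list w LA"
    by fastforce
  then show ?case
  proof cases
    case 1
    consider "w = []" | s where "w = [s]" | x y q where "w = x # y # q"
      by (cases w rule: remdups_adj.cases) auto
    then show ?thesis
    proof cases
      case 1
      then have "word_act w ^^ 1 = id" by simp
      then show ?thesis unfolding periodic_def by (metis zero_less_one)
    next
      case 2
      then have "word_act w ^^ 2 = id" by (auto simp: fun_eq_iff numeral_2_eq_2 letter_act_involution)
      then show ?thesis unfolding periodic_def by (metis pos2)
    next
      case 3
      then show ?thesis using 1 by (intro merge[of w "[]" x y q]) auto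
    qed
  next
    case 2
    have "non_a w < length w"
      using 2 count_list_0_iff[of w LA] by (simp add: length_eq_non_a)
    then have "periodic (word_act (word_section w x))" for x
      using shorter[of "word_section w x"] length_word_section_le[of w x] by linarith
    then show ?thesis
      using 2 by (intro periodic_if_sections[of "word_act w" "\<lambda>x. word_act (word_section w x)"])
        (simp_all add: word_act_Cons)
  next
    case 3
    then have "LA \<in> set w" using count_list_0_iff[of w LA] by fastforce
    then obtain p q where pq: "w = p @ LA # q" by (meson split_list)
    \<comment> \<open>Taking out one \<open>a\<close> lowers the count of \<open>a\<close> by one,
      which gives the extra 1 that \<open>adjacent_non_a\<close> asks for.\<close>
    have "non_a (q @ p) > count_list (q @ p) LA + 1" using 3 by (simp add: pq non_a_def)
    then obtain r x y s where "q @ p = r @ x # y # s" "x \<noteq> LA" "y \<noteq> LA"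
      using adjacent_non_a by blast
    moreover from this have "(LA # q) @ p = (LA # r) @ x # y # s" by simp
    moreover have "length ((LA # q) @ p) = length w" by (simp add: pq)
    ultimately have "periodic (word_act ((LA # q) @ p))" using merge by blast
    then show ?thesis
      unfolding pq word_act_append using periodic_commute bij_is_surj[OF bij_word_act] by blast
  next
    case 4
    \<comment> \<open>The section of the square of \<open>w\<close> at \<open>x\<close>: the first
      application reads \<open>x\<close>, the second reads the flipped bit.\<close>
    define u where "u = (\<lambda>x. word_section w (\<not> x) @ word_section w x)"
    \<comment> \<open>In this case \<open>2 * non_a w \<le> length w\<close>, and each
      \<open>d\<close> saves one more letter.\<close>
    have len: "length (u x) + count_list w LD \<le> length w" for x
      using length_word_section[of w x] 4 length_eq_non_a[of w] by (simp add: u_def)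
    have "word_rank (u x) < word_rank w" for x
    proof (cases "LD \<in> set w")
      case True
      then have "length (u x) < length w" using len[of x] count_list_0_iff[of w LD] by linarith
      then show ?thesis by auto
    next
      case noD: False
      show ?thesis
      proof (cases "LC \<in> set w")
        case True
        then have "LD \<in> set (u x)" using LD_in_word_section[of w x] by (auto simp: u_def)
        then show ?thesis using len[of x] True noD by auto
      next
        case noC: False
        show ?thesis
        proof (cases "LB \<in> set w")
          case True
          then have "LC \<in> set (u x)" using LC_in_word_section[of w x] by (auto simp: u_def)
          then show ?thesis using len[of x] noC noD by auto
        next
          case False
          then have "set w \<subseteq> {LA}" using noC noD by (metis (full_types) grig_letter.exhaust insertI1 subsetI)
          then have "non_a w = 0" by (auto simp: non_a_def filter_empty_conv)
          then have "length (u x) = 0" using length_word_section[of w x] by (simp add: u_def)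
          moreover have "w \<noteq> []" using 4 by auto
          ultimately show ?thesis using noC noD by (cases w) auto
        qed
      qed
    qed
    then have "periodic (word_act (u x))" for x using less.IH by blast
    moreover have "(word_act w ^^ 2) (x # v) = x # word_act (u x) v" for x v
      using 4 by (auto simp: numeral_2_eq_2 word_act_Cons u_def word_act_append)
    ultimately have "periodic (word_act w ^^ 2)"
      by (intro periodic_if_sections[of "word_act w ^^ 2" "\<lambda>x. word_act (u x)"])
        (simp_all add: numeral_2_eq_2)
    then show ?thesis by (rule periodic_power) auto
  qed
qed

text \<open>Below the bit \<open>True\<close>, the words \<open>aba\<close>, \<open>d\<close>,
  \<open>b\<close>, \<open>c\<close> act as \<open>a\<close>, \<open>b\<close>, \<open>c\<close>,
  \<open>d\<close>.\<close>

lemma lift_word: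
  "\<exists>w'. \<forall>v. word_act w' (True # v) = True # word_act w v"
proof (induction w)
  case Nil
  then show ?case by (intro exI[of _ "[]"]) auto
next
  case (Cons s w)
  then obtain w' where w': "\<forall>v. word_act w' (True # v) = True # word_act w v" by blast
  obtain l where "\<forall>v. word_act l (True # v) = True # letter_act s v"
  proof (cases s)
    case LA
    then show thesis using that[of "[grig_letter.LA, LB, grig_letter.LA]"] by auto
  next
    case LB
    then show thesis using that[of "[LD]"] by auto
  next
    case LC
    then show thesis using that[of "[grig_letter.LB]"] by auto
  next
    case LD
    then show thesis using that[of "[grig_letter.LC]"] by auto
  qed
  then show ?case using w' by (intro exI[of _ "l @ w'"]) (auto simp: word_act_append)
qed

text \<open>A lifted word arranges the tail below \<open>True\<close>; a final \<open>a\<close>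
  corrects the first bit if necessary.\<close>

lemma word_act_transitive: "\<exists>w. word_act w (replicate (length v) True) = v"
proof (induction v)
  case (Cons x v)
  then obtain w where w: "word_act w (replicate (length v) True) = v" by blast
  obtain w' where w': "\<And>v. word_act w' (True # v) = True # word_act w v"
    using lift_word by blast
  show ?case
  proof (cases x)
    case True
    then show ?thesis using w w' by (intro exI[of _ w']) auto
  next
    case False
    then show ?thesis using w w' by (intro exI[of _ "LA # w'"]) auto
  qed
qed auto

text \<open>By transitivity on words of length n the group has at least 2^n elements, for every
  n.\<close>

lemma infinite_word_acts: "infinite (range word_act)"
proof
  assume fin: "finite (range word_act)"
  have "card {v :: bool list. length v = n} \<le> card (range word_act)" for n
  proof (rule surj_card_le[OF fin], rule subsetI)
    fix v :: "bool list" assume "v \<in> {v. length v = n}"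
    then obtain w where "word_act w (replicate n True) = v" using word_act_transitive[of v] by auto
    then show "v \<in> (\<lambda>f. f (replicate n True)) ` range word_act" by blast
  qed
  moreover have "card {v :: bool list. length v = n} = 2 ^ n" for n
    using card_lists_length_eq[of "UNIV :: bool set" n] by simp
  ultimately have "2 ^ n \<le> card (range word_act)" for n by metis
  then show False using less_exp[of "card (range word_act)"] by (metis leD)
qed

section \<open>Words in the generators and the group of bijections\<close>

lemma Bij_UNIV_iff: "f \<in> Bij UNIV \<longleftrightarrow> bij f"
  by (simp add: Bij_def)

lemma BijGroup_UNIV_simps:
  "carrier (BijGroup (UNIV :: 'a set)) = {f. bij f}"
  "\<one>\<^bsub>BijGroup (UNIV :: 'a set)\<^esub> = id"
  "bij f \<Longrightarrow> bij g \<Longrightarrow> f \<otimes>\<^bsub>BijGroup (UNIV :: 'a set)\<^esub> g = f \<circ> g"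
  by (auto simp: BijGroup_def Bij_UNIV_iff fun_eq_iff compose_def)

lemma inv_BijGroup_involution:
  assumes "\<And>x. f (f x) = x"
  shows "inv\<^bsub>BijGroup (UNIV :: 'a set)\<^esub> f = f"
proof -
  have "bij f" using assms by (intro o_bij[of f]) auto
  then show ?thesis
    using assms by (intro group.inv_equality[OF group_BijGroup])
      (auto simp: BijGroup_UNIV_simps fun_eq_iff)
qed

lemma bij_letter_act: "bij (letter_act s)"
  by (intro o_bij[of "letter_act s"]) (auto simp: letter_act_involution)

lemma generators_eq: "{grig_a, grig_b, grig_c, grig_d} = range letter_act"
proof -
  have "s \<in> {LA, LB, LC, LD}" for s by (cases s) auto
  then have "(UNIV :: grig_letter set) = {LA, LB, LC, LD}" by blast
  then have "range letter_act = letter_act ` {LA, LB, LC, LD}" by simp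
  then show ?thesis by simp
qed

lemma carrier_Grigorchuk: "carrier Grigorchuk_group = range word_act"
proof -
  let ?B = "BijGroup (UNIV :: bool list set)"
  have "f \<in> range word_act" if "f \<in> generate ?B (range letter_act)" for f
    using that
  proof induction
    case one
    then show ?case by (metis BijGroup_UNIV_simps(2) rangeI word_act.simps(1))
  next
    case (incl h)
    then obtain s where "h = word_act [s]" by auto
    then show ?case by blast
  next
    case (inv h)
    then obtain s where "h = letter_act s" by auto
    then have "inv\<^bsub>?B\<^esub> h = word_act [s]"
      by (simp add: inv_BijGroup_involution letter_act_involution)
    then show ?case by blast
  next
    case (eng f g)
    then obtain v w where "f = word_act v" "g = word_act w" by auto
    then have "f \<otimes>\<^bsub>?B\<^esub> g = word_act (v @ w)"
      by (simp add: BijGroup_UNIV_simps bij_word_act word_act_append)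
    then show ?case by blast
  qed
  moreover have "word_act w \<in> generate ?B (range letter_act)" for w
  proof (induction w)
    case Nil
    then show ?case using generate.one[of ?B "range letter_act"]
      unfolding BijGroup_UNIV_simps word_act.simps .
  next
    case (Cons s w)
    show ?case
      using generate.eng[OF generate.incl[OF rangeI[of letter_act s]] Cons]
      unfolding BijGroup_UNIV_simps(3)[OF bij_letter_act bij_word_act] word_act.simps .
  qed
  ultimately show ?thesis
    unfolding Grigorchuk_group_def generators_eq by auto
qed

lemma group_Grigorchuk: "group Grigorchuk_group"
  unfolding Grigorchuk_group_def
  by (intro group.subgroup_imp_group[OF group_BijGroup] group.generate_is_subgroup group_BijGroup)
    (use bij_letter_act in \<open>auto simp: generators_eq BijGroup_UNIV_simps\<close>)

lemma Grigorchuk_mult: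
  "f \<in> carrier Grigorchuk_group \<Longrightarrow> g \<in> carrier Grigorchuk_group \<Longrightarrow>
   f \<otimes>\<^bsub>Grigorchuk_group\<^esub> g = f \<circ> g"
  unfolding carrier_Grigorchuk
  by (auto simp: Grigorchuk_group_def BijGroup_UNIV_simps bij_word_act)

lemma Grigorchuk_one: "\<one>\<^bsub>Grigorchuk_group\<^esub> = id"
  by (simp add: Grigorchuk_group_def BijGroup_UNIV_simps)

lemma Grigorchuk_pow:
  "f \<in> carrier Grigorchuk_group \<Longrightarrow> f [^]\<^bsub>Grigorchuk_group\<^esub> (n::nat) = f ^^ n"
proof (induction n)
  case 0
  then show ?case by (simp add: Grigorchuk_one group.is_monoid[OF group_Grigorchuk] monoid.nat_pow_0)
next
  case (Suc n)
  then show ?case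
    using group.is_monoid[OF group_Grigorchuk, THEN monoid.nat_pow_closed, of f n]
    by (simp add: monoid.nat_pow_Suc[OF group.is_monoid[OF group_Grigorchuk]] Grigorchuk_mult
        funpow_Suc_right del: funpow.simps)
qed

lemma Grigorchuk_torsion:
  assumes "f \<in> carrier Grigorchuk_group"
  shows "\<exists>n>0::nat. f [^]\<^bsub>Grigorchuk_group\<^esub> n = \<one>\<^bsub>Grigorchuk_group\<^esub>"
  using assms word_act_periodic
  by (auto simp: Grigorchuk_pow Grigorchuk_one carrier_Grigorchuk periodic_def)

lemma Grigorchuk_finitely_generated:
  "\<exists>S. finite S \<and> S \<subseteq> carrier Grigorchuk_group \<and> generate Grigorchuk_group S = carrier Grigorchuk_group"
proof (intro exI conjI)
  let ?S = "{grig_a, grig_b, grig_c, grig_d}"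
  show sub: "?S \<subseteq> carrier Grigorchuk_group"
    by (auto simp: Grigorchuk_group_def intro: generate.incl)
  have "?S \<subseteq> carrier (BijGroup UNIV)"
    using bij_letter_act by (auto simp: generators_eq BijGroup_UNIV_simps)
  then have "subgroup (carrier Grigorchuk_group) (BijGroup UNIV)"
    unfolding Grigorchuk_group_def by (simp add: group.generate_is_subgroup[OF group_BijGroup])
  from group.generate_consistent[OF group_BijGroup sub this]
  show "generate Grigorchuk_group ?S = carrier Grigorchuk_group"
    by (simp add: Grigorchuk_group_def)
qed auto

section \<open>Finitely generated infinite torsion groups violate the Tits alternative\<close>

context group
begin

text \<open>Finite index as a finite cover by right cosets with representatives inside
  \<open>H\<close>. The cosets may repeat: generation and finiteness arguments only need the
  cover.\<close>

definition finite_index_in :: "'a set \<Rightarrow> 'a set \<Rightarrow> bool" where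
  "finite_index_in K H \<longleftrightarrow> (\<exists>P. finite P \<and> P \<subseteq> H \<and> H \<subseteq> (\<Union>p\<in>P. K #> p))"

lemma mem_r_cosetE:
  assumes "x \<in> K #> p"
  obtains k where "k \<in> K" "x = k \<otimes> p"
  using assms by (auto simp: r_coset_def)

text \<open>Schreier's argument: with representatives \<open>P\<close> and generators \<open>S\<close> write \<open>p s = k p'\<close>;
  the elements \<open>k\<close> together with \<open>P \<inter> K\<close> generate \<open>K\<close>.\<close>

lemma finite_index_subgroup_finitely_generated:
  assumes K: "subgroup K G" and "K \<subseteq> generate G S" and "finite S" "S \<subseteq> carrier G"
    and "finite_index_in K (generate G S)"
  shows "\<exists>T. finite T \<and> T \<subseteq> carrier G \<and> generate G T = K"
proof -
  obtain P where P: "finite P" "P \<subseteq> generate G S" "generate G S \<subseteq> (\<Union>p\<in>P. K #> p)"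
    using assms(5) unfolding finite_index_in_def by blast
  have Pc: "P \<subseteq> carrier G" using P generate_incl[OF \<open>S \<subseteq> carrier G\<close>] by blast
  define S' where "S' = S \<union> m_inv G ` S"
  have S': "finite S'" "S' \<subseteq> generate G S" "S' \<subseteq> carrier G"
    using assms by (auto simp: S'_def intro: generate.incl generate.inv)
  have "\<exists>k p'. k \<in> K \<and> p' \<in> P \<and> p \<otimes> s = k \<otimes> p'" if "p \<in> P" "s \<in> S'" for p s
  proof -
    have "p \<otimes> s \<in> generate G S" using that P S' by (auto intro: generate.eng)
    then obtain p' where "p' \<in> P" "p \<otimes> s \<in> K #> p'" using P by blast
    then show ?thesis by (metis mem_r_cosetE)
  qed
  then obtain f q where f: "\<And>p s. p \<in> P \<Longrightarrow> s \<in> S' \<Longrightarrow> f p s \<in> K \<and> q p s \<in> P \<and> p \<otimes> s = f p s \<otimes> q p s"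
    by metis
  \<comment> \<open>The representatives need not include the identity. Putting \<open>k0\<close>
    among the generators places the identity in the set \<open>M\<close> below.\<close>
  obtain k0 p0 where kp0: "k0 \<in> K" "p0 \<in> P" "\<one> = k0 \<otimes> p0"
    using P generate.one[of G S] by (auto elim!: mem_r_cosetE)
  define T where "T = (\<lambda>(p, s). f p s) ` (P \<times> S') \<union> (P \<inter> K) \<union> {k0}"
  have T: "finite T" "T \<subseteq> K" using P S' f kp0 by (auto simp: T_def)
  then have Tc: "T \<subseteq> carrier G" using K subgroup.subset by blast
  define K' where "K' = generate G T"
  have K': "subgroup K' G" unfolding K'_def using Tc by (rule generate_is_subgroup)
  have K'K: "K' \<subseteq> K" unfolding K'_def using T(2) K by (rule generate_subgroup_incl)
  \<comment> \<open>Once \<open>M\<close> is closed under right multiplication by generators and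
    their inverses and contains the identity, it contains the whole group.\<close>
  define M where "M = {k \<otimes> p | k p. k \<in> K' \<and> p \<in> P}"
  have step: "x \<otimes> s \<in> M" if x: "x \<in> M" and s: "s \<in> S'" for x s
  proof -
    obtain k p where kp: "k \<in> K'" "p \<in> P" "x = k \<otimes> p" using x by (auto simp: M_def)
    have c: "k \<in> carrier G" "p \<in> carrier G" "s \<in> carrier G" "q p s \<in> carrier G" "f p s \<in> carrier G"
      using kp s f[of p s] Pc S' subgroup.subset[OF K'] subgroup.subset[OF K] by auto
    have "x \<otimes> s = k \<otimes> (p \<otimes> s)" using kp c by (simp add: m_assoc)
    also have "\<dots> = (k \<otimes> f p s) \<otimes> q p s" using f[of p s] kp s c by (simp add: m_assoc)
    finally have "x \<otimes> s = (k \<otimes> f p s) \<otimes> q p s" .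
    moreover have "f p s \<in> K'" unfolding K'_def using kp s by (intro generate.incl) (auto simp: T_def)
    ultimately show ?thesis
      using f[of p s] kp s subgroup.m_closed[OF K'] unfolding M_def by blast
  qed
  have Mc: "M \<subseteq> carrier G" using Pc subgroup.subset[OF K'] by (auto simp: M_def)
  have "\<forall>x\<in>M. x \<otimes> y \<in> M" if "y \<in> generate G S" for y
    using that
  proof induction
    case one
    then show ?case using Mc by auto
  next
    case (incl h)
    then show ?case using step by (auto simp: S'_def)
  next
    case (inv h)
    then show ?case using step by (auto simp: S'_def)
  next
    case (eng g h)
    then show ?case
      using Mc generate_incl[OF \<open>S \<subseteq> carrier G\<close>] by (simp add: m_assoc[symmetric] subset_iff)
  qed
  moreover have "\<one> \<in> M"
    using kp0 unfolding M_def K'_def by (auto simp: T_def intro: generate.incl)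
  ultimately have GM: "y \<in> M" if "y \<in> generate G S" for y
    using that generate_incl[OF \<open>S \<subseteq> carrier G\<close>] by (metis l_one subsetD)
  have "K \<subseteq> K'"
  proof
    fix x assume x: "x \<in> K"
    then obtain k p where kp: "k \<in> K'" "p \<in> P" "x = k \<otimes> p"
      using GM[of x] \<open>K \<subseteq> generate G S\<close> by (auto simp: M_def)
    have c: "k \<in> carrier G" "p \<in> carrier G" "x \<in> carrier G"
      using kp Pc subgroup.subset[OF K'] subgroup.subset[OF K] x by auto
    \<comment> \<open>The representative of an element of \<open>K\<close> lies in \<open>K\<close>
      itself, which is why \<open>P \<inter> K\<close> was put into \<open>T\<close>.\<close>
    have "p = inv k \<otimes> x" using kp c by (simp add: m_assoc[symmetric])
    then have "p \<in> K" using x kp K'K K by (metis subgroup.m_closed subgroup.m_inv_closed subsetD)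
    then have "p \<in> K'" unfolding K'_def using kp by (intro generate.incl) (auto simp: T_def)
    then show "x \<in> K'" using kp subgroup.m_closed[OF K'] by blast
  qed
  then show ?thesis using T Tc K'K unfolding K'_def by blast
qed

section \<open>Finitely generated solvable torsion groups\<close>

lemma derived_commute:
  assumes "x \<in> carrier G" "y \<in> carrier G" "x \<in> H" "y \<in> H"
  shows "\<exists>c \<in> derived G H. x \<otimes> y = c \<otimes> (y \<otimes> x)"
proof
  show "x \<otimes> y \<otimes> inv x \<otimes> inv y \<in> derived G H"
    unfolding derived_def using assms by (intro generate.incl) auto
  have "inv y \<otimes> (y \<otimes> x) = x" using assms by (simp add: m_assoc[symmetric])
  then show "x \<otimes> y = x \<otimes> y \<otimes> inv x \<otimes> inv y \<otimes> (y \<otimes> x)"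
    using assms by (simp add: m_assoc)
qed

text \<open>The conjugate of \<open>d\<close> by \<open>x\<close> is the commutator of
  \<open>x\<close> and \<open>d\<close> times \<open>d\<close>.\<close>

lemma derived_normalizes:
  assumes "subgroup H G" "x \<in> H" "d \<in> derived G H"
  shows "x \<otimes> d \<otimes> inv x \<in> derived G H"
proof -
  have c: "x \<in> carrier G" "d \<in> carrier G" "d \<in> H"
    using assms derived_incl[OF order_refl assms(1)] subgroup.subset[OF assms(1)] by blast+
  obtain e where e: "e \<in> derived G H" "x \<otimes> d = e \<otimes> (d \<otimes> x)"
    using derived_commute[of x d H] c assms by blast
  have D: "subgroup (derived G H) G"
    using assms(1) by (intro derived_is_subgroup subgroup.subset)
  have "x \<otimes> d \<otimes> inv x = e \<otimes> d"
    using e c subgroup.subset[OF D] by (simp add: m_assoc subset_iff)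
  then show ?thesis using e assms D by (simp add: subgroup.m_closed)
qed

text \<open>With inverses being positive powers, closure under multiplication by the generators
  alone is enough.\<close>

lemma torsion_inv_eq_pow:
  assumes "x \<in> carrier G" "n > 0" "x [^] (n::nat) = \<one>"
  shows "inv x = x [^] (n - 1)"
proof -
  have "x [^] (n - 1) \<otimes> x = x [^] Suc (n - 1)" by simp
  then have "x [^] (n - 1) \<otimes> x = \<one>" using assms by simp
  then show ?thesis using assms by (intro inv_equality) auto
qed

text \<open>Modulo the derived subgroup the generators commute, so products of bounded powers of the
  generators represent all cosets.\<close>

lemma derived_finite_index:
  assumes "finite T" "T \<subseteq> carrier G"
    and torsion: "\<And>x. x \<in> carrier G \<Longrightarrow> \<exists>n>0::nat. x [^] n = \<one>"
  shows "finite_index_in (derived G (generate G T)) (generate G T)"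
proof -
  define H where "H = generate G T"
  define D where "D = derived G H"
  have H: "subgroup H G" unfolding H_def using assms by (intro generate_is_subgroup)
  have Hc: "H \<subseteq> carrier G" using H by (rule subgroup.subset)
  have D: "subgroup D G" unfolding D_def using Hc by (rule derived_is_subgroup)
  have Dc: "D \<subseteq> carrier G" using D by (rule subgroup.subset)
  have DH: "D \<subseteq> H" unfolding D_def by (rule derived_incl[OF order_refl H])
  \<comment> \<open>Modulo \<open>D\<close>, right multiplication by elements of \<open>U\<close>
    keeps the finite set \<open>P\<close> stable. The generators are fed in one at a time.\<close>
  define good where "good = (\<lambda>U P. finite P \<and> P \<subseteq> H \<and> \<one> \<in> P \<and>
    (\<forall>p\<in>P. \<forall>t\<in>U. \<exists>d\<in>D. \<exists>q\<in>P. p \<otimes> t = d \<otimes> q))"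
  have "\<exists>P. good U P" if "finite U" "U \<subseteq> T" for U
    using that
  proof (induction U rule: finite_induct)
    case empty
    show ?case using subgroup.one_closed[OF H] by (intro exI[of _ "{\<one>}"]) (auto simp: good_def)
  next
    case (insert u U)
    then obtain P where "good U P" by blast
    then have P: "finite P" "P \<subseteq> H" "\<one> \<in> P"
      "\<And>p t. p \<in> P \<Longrightarrow> t \<in> U \<Longrightarrow> \<exists>d\<in>D. \<exists>q\<in>P. p \<otimes> t = d \<otimes> q"
      unfolding good_def by simp_all
    have u: "u \<in> H" "u \<in> carrier G" using insert.prems assms by (auto simp: H_def intro: generate.incl)
    obtain n :: nat where n: "n > 0" "u [^] n = \<one>" using torsion u by blast
    \<comment> \<open>The old representatives followed by powers of the new generator below its
      order \<open>n\<close>.\<close>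
    define Q where "Q = (\<lambda>(p, k). p \<otimes> u [^] k) ` (P \<times> {..<n})"
    have uk: "u [^] k \<in> H" for k :: nat
      using u H by (induction k) (auto simp: subgroup.one_closed subgroup.m_closed)
    have "\<exists>d\<in>D. \<exists>q\<in>Q. x \<otimes> t = d \<otimes> q" if x: "x \<in> Q" and t: "t \<in> insert u U" for x t
    proof -
      obtain p k where pk: "p \<in> P" "k < n" "x = p \<otimes> u [^] k" using x by (auto simp: Q_def)
      have pH: "p \<in> H" using P pk by blast
      have c: "p \<in> carrier G" "u [^] k \<in> carrier G" using pH Hc u by auto
      show ?thesis
      proof (cases "t = u")
        case True
        have xt: "x \<otimes> t = p \<otimes> u [^] Suc k" using c u pk True by (simp add: m_assoc)
        have "u [^] Suc k = u [^] (Suc k mod n)"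
        proof (cases "Suc k < n")
          case False
          then have "Suc k = n" using pk by simp
          then show ?thesis using n by (metis mod_self nat_pow_0)
        qed simp
        then have "x \<otimes> t = \<one> \<otimes> (p \<otimes> u [^] (Suc k mod n))" using xt c u by simp
        moreover have "p \<otimes> u [^] (Suc k mod n) \<in> Q" using pk n unfolding Q_def by force
        ultimately show ?thesis using subgroup.one_closed[OF D] by blast
      next
        case False
        then have tU: "t \<in> U" using t by simp
        then have tH: "t \<in> H" "t \<in> carrier G" using insert.prems Hc by (auto simp: H_def intro: generate.incl)
        obtain d where d: "d \<in> D" "u [^] k \<otimes> t = d \<otimes> (t \<otimes> u [^] k)"
          using derived_commute[of "u [^] k" t H] c tH uk unfolding D_def by blast
        obtain e q where e: "e \<in> D" "q \<in> P" "p \<otimes> t = e \<otimes> q" using P(4)[OF pk(1) tU] by blast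
        \<comment> \<open>Moving \<open>t\<close> past the power of \<open>u\<close> produces
          \<open>d\<close>, which must be carried to the left of \<open>p\<close>; it arrives there
          as a conjugate, still in \<open>D\<close>.\<close>
        define d' where "d' = p \<otimes> d \<otimes> inv p"
        have d': "d' \<in> D" using derived_normalizes[OF H pH] d unfolding d'_def D_def by blast
        have cc: "d \<in> carrier G" "e \<in> carrier G" "d' \<in> carrier G" "q \<in> carrier G"
          using d e d' Dc P Hc by auto
        have "d' \<otimes> p = p \<otimes> d" unfolding d'_def using c cc by (simp add: m_assoc)
        have "x \<otimes> t = p \<otimes> (u [^] k \<otimes> t)" using pk c tH by (simp add: m_assoc)
        also have "\<dots> = (p \<otimes> d) \<otimes> (t \<otimes> u [^] k)" using c tH cc d by (simp add: m_assoc)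
        also have "\<dots> = d' \<otimes> (p \<otimes> t) \<otimes> u [^] k"
          using c tH cc \<open>d' \<otimes> p = p \<otimes> d\<close>[symmetric] by (simp add: m_assoc)
        also have "\<dots> = (d' \<otimes> e) \<otimes> (q \<otimes> u [^] k)" using c tH cc e by (simp add: m_assoc)
        finally have "x \<otimes> t = (d' \<otimes> e) \<otimes> (q \<otimes> u [^] k)" .
        moreover have "q \<otimes> u [^] k \<in> Q" using e pk unfolding Q_def by force
        ultimately show ?thesis using d' e subgroup.m_closed[OF D] by blast
      qed
    qed
    moreover have "finite Q" unfolding Q_def using P by auto
    moreover have "Q \<subseteq> H" unfolding Q_def using P uk subgroup.m_closed[OF H] by auto
    moreover have "\<one> \<in> Q" unfolding Q_def using P n by (force intro!: image_eqI[of _ _ "(\<one>, 0)"])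
    ultimately have "good (insert u U) Q" unfolding good_def by simp
    then show ?case by (rule exI)
  qed
  then obtain P where "good T P" using assms by blast
  then have P: "finite P" "P \<subseteq> H" "\<one> \<in> P"
    "\<And>p t. p \<in> P \<Longrightarrow> t \<in> T \<Longrightarrow> \<exists>d\<in>D. \<exists>q\<in>P. p \<otimes> t = d \<otimes> q"
    unfolding good_def by simp_all
  define M where "M = (\<Union>p\<in>P. D #> p)"
  have Pc: "P \<subseteq> carrier G" using P Hc by blast
  have Mc: "M \<subseteq> carrier G" unfolding M_def using Pc Dc r_coset_subset_G by blast
  have memM: "d \<otimes> p \<in> M" if "d \<in> D" "p \<in> P" for d p
    using that unfolding M_def r_coset_def by blast
  have step: "x \<otimes> t \<in> M" if x: "x \<in> M" and t: "t \<in> T" for x t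
  proof -
    obtain p where p: "p \<in> P" "x \<in> D #> p" using x unfolding M_def by blast
    then obtain d where d: "d \<in> D" "x = d \<otimes> p" by (metis mem_r_cosetE)
    obtain e q where e: "e \<in> D" "q \<in> P" "p \<otimes> t = e \<otimes> q" using P(4)[OF p(1) t] by blast
    have "x \<otimes> t = (d \<otimes> e) \<otimes> q"
      using d e p t Pc Dc assms by (simp add: m_assoc subset_iff)
    then show ?thesis using memM d e subgroup.m_closed[OF D] by metis
  qed
  have pow: "x \<otimes> t [^] (k::nat) \<in> M" if "x \<in> M" "t \<in> T" for x t k
  proof (induction k)
    case 0
    then show ?case using that Mc by auto
  next
    case (Suc k)
    then show ?case using step[OF Suc \<open>t \<in> T\<close>] that Mc assms by (simp add: m_assoc subset_iff)
  qed
  have "\<forall>x\<in>M. x \<otimes> y \<in> M" if "y \<in> generate G T" for y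
    using that
  proof induction
    case one
    then show ?case using Mc by auto
  next
    case (incl h)
    then show ?case using step by auto
  next
    case (inv h)
    then have "h \<in> carrier G" using assms by blast
    then obtain n :: nat where "n > 0" "h [^] n = \<one>" using torsion by blast
    then have "inv h = h [^] (n - 1)" using \<open>h \<in> carrier G\<close> by (intro torsion_inv_eq_pow)
    then show ?case using pow inv by simp
  next
    case (eng g h)
    then show ?case
      using Mc generate_incl[OF \<open>T \<subseteq> carrier G\<close>] by (simp add: m_assoc[symmetric] subset_iff)
  qed
  moreover have "\<one> \<in> M"
    using memM[OF subgroup.one_closed[OF D] P(3)] by simp
  ultimately have "y \<in> M" if "y \<in> generate G T" for y
    using that generate_incl[OF \<open>T \<subseteq> carrier G\<close>] by (metis l_one subsetD)
  then show ?thesis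
    unfolding finite_index_in_def using P by (auto simp: M_def D_def H_def)
qed

lemma finite_if_finite_index:
  assumes "finite K" "finite_index_in K H"
  shows "finite H"
proof -
  obtain P where P: "finite P" "H \<subseteq> (\<Union>p\<in>P. K #> p)"
    using assms unfolding finite_index_in_def by blast
  have "finite (K #> p)" for p using assms by (simp add: r_coset_def)
  then show ?thesis using P by (meson finite_UN finite_subset)
qed

text \<open>Induction on the derived length. The derived subgroup has finite index, so by Schreier's
  argument it is again finitely generated, hence finite by induction; the generating set changes at
  each step.\<close>

lemma torsion_solvable_finite:
  assumes torsion: "\<And>x. x \<in> carrier G \<Longrightarrow> \<exists>n>0::nat. x [^] n = \<one>"
  shows "finite T \<Longrightarrow> T \<subseteq> carrier G \<Longrightarrow> (derived G ^^ n) (generate G T) = {\<one>}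
    \<Longrightarrow> finite (generate G T)"
proof (induction n arbitrary: T)
  case 0
  then show ?case by simp
next
  case (Suc n)
  let ?H = "generate G T"
  have fi: "finite_index_in (derived G ?H) ?H"
    using derived_finite_index[OF Suc.prems(1,2) torsion] .
  have H: "subgroup ?H G" using Suc.prems by (intro generate_is_subgroup)
  have "subgroup (derived G ?H) G" "derived G ?H \<subseteq> ?H"
    using derived_is_subgroup[OF subgroup.subset[OF H]] derived_incl[OF order_refl H] by auto
  then obtain U where U: "finite U" "U \<subseteq> carrier G" "generate G U = derived G ?H"
    using finite_index_subgroup_finitely_generated[OF _ _ Suc.prems(1,2) fi] by blast
  have "(derived G ^^ n) (generate G U) = {\<one>}"
    using Suc.prems(3) unfolding U(3) by (simp add: funpow_swap1)
  then have "finite (derived G ?H)" using Suc.IH U by metis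
  then show ?case using fi by (rule finite_if_finite_index)
qed

text \<open>A solvable subgroup of finite index in \<open>S\<close> is finitely generated and
  torsion, hence finite, and \<open>S\<close> would be finite. An element of a free basis cannot
  have finite order, because its powers are reduced words.\<close>

lemma not_tits_alternative:
  assumes "subgroup S G" "infinite S" "finite T" "generate G T = S" "T \<subseteq> carrier G"
    and torsion: "\<And>x. x \<in> S \<Longrightarrow> \<exists>n>0::nat. x [^] n = \<one>"
  shows "\<not> tits_alternative G"
proof
  assume "tits_alternative G"
  then consider "virtually_solvable_subgroup G S" | "has_nonabelian_free_subgroup G S"
    using assms(1) unfolding tits_alternative_def by blast
  then show False
  proof cases
    case 1
    then obtain K where K: "subgroup K G" "K \<subseteq> S" "finite (rcosets\<^bsub>G\<lparr>carrier := S\<rparr>\<^esub> K)"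
      "solvable (G\<lparr>carrier := K\<rparr>)"
      unfolding virtually_solvable_subgroup_def by blast
    \<comment> \<open>The argument runs inside \<open>S\<close>, where torsion is available.\<close>
    interpret S: group "G\<lparr>carrier := S\<rparr>" using subgroup_imp_group[OF assms(1)] .
    have Sc: "S \<subseteq> carrier G" using assms(1) by (rule subgroup.subset)
    have TS: "T \<subseteq> S" using assms(4) by (auto intro: generate.incl)
    have genS: "generate (G\<lparr>carrier := S\<rparr>) U = generate G U" if "U \<subseteq> S" for U
      using that assms(1) by (rule generate_consistent)
    have KS: "subgroup K (G\<lparr>carrier := S\<rparr>)"
      using K assms(1) by (intro subgroup_incl)
    have "\<forall>C\<in>rcosets\<^bsub>G\<lparr>carrier := S\<rparr>\<^esub> K. \<exists>p\<in>S. C = K #>\<^bsub>G\<lparr>carrier := S\<rparr>\<^esub> p"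
      by (auto simp: RCOSETS_def)
    then obtain r where r: "\<And>C. C \<in> rcosets\<^bsub>G\<lparr>carrier := S\<rparr>\<^esub> K \<Longrightarrow> r C \<in> S \<and> C = K #>\<^bsub>G\<lparr>carrier := S\<rparr>\<^esub> r C"
      by metis
    have "S \<subseteq> (\<Union>p\<in>r ` (rcosets\<^bsub>G\<lparr>carrier := S\<rparr>\<^esub> K). K #>\<^bsub>G\<lparr>carrier := S\<rparr>\<^esub> p)"
    proof
      fix x assume x: "x \<in> S"
      then have "K #>\<^bsub>G\<lparr>carrier := S\<rparr>\<^esub> x \<in> rcosets\<^bsub>G\<lparr>carrier := S\<rparr>\<^esub> K"
        by (auto simp: RCOSETS_def)
      moreover have "x \<in> K #>\<^bsub>G\<lparr>carrier := S\<rparr>\<^esub> x"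
        using S.rcos_self[OF _ KS] x by simp
      ultimately show "x \<in> (\<Union>p\<in>r ` (rcosets\<^bsub>G\<lparr>carrier := S\<rparr>\<^esub> K). K #>\<^bsub>G\<lparr>carrier := S\<rparr>\<^esub> p)"
        using r by blast
    qed
    then have fi: "S.finite_index_in K (generate (G\<lparr>carrier := S\<rparr>) T)"
      unfolding S.finite_index_in_def genS[OF TS] assms(4) using K(3) r
      by (intro exI[of _ "r ` (rcosets\<^bsub>G\<lparr>carrier := S\<rparr>\<^esub> K)"]) auto
    have "\<exists>U. finite U \<and> U \<subseteq> carrier (G\<lparr>carrier := S\<rparr>) \<and> generate (G\<lparr>carrier := S\<rparr>) U = K"
      using K TS by (intro S.finite_index_subgroup_finitely_generated[OF KS _ assms(3) _ fi])
        (auto simp: genS assms(4))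
    then obtain U where U: "finite U" "U \<subseteq> S" "generate (G\<lparr>carrier := S\<rparr>) U = K" by auto
    interpret K: group "G\<lparr>carrier := K\<rparr>" using subgroup_imp_group[OF K(1)] .
    obtain n where n: "(derived (G\<lparr>carrier := K\<rparr>) ^^ n) K = {\<one>}"
      using K(4) K.solvable_iff_trivial_derived_seq by auto
    \<comment> \<open>Derived subgroups of subsets of \<open>K\<close> are the same whether computed
      in \<open>K\<close> or in \<open>S\<close>, so solvability of \<open>K\<close> can be used
      inside \<open>S\<close>.\<close>
    have "(derived (G\<lparr>carrier := K\<rparr>) ^^ m) K = (derived (G\<lparr>carrier := S\<rparr>) ^^ m) K
        \<and> (derived (G\<lparr>carrier := K\<rparr>) ^^ m) K \<subseteq> K" for m
    proof (induction m)
      case (Suc m)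
      let ?D = "(derived (G\<lparr>carrier := K\<rparr>) ^^ m) K"
      have "derived (G\<lparr>carrier := K\<rparr>) ?D = derived (G\<lparr>carrier := S\<rparr>) ?D"
        using Suc derived_consistent[OF _ K(1), of ?D] derived_consistent[OF _ assms(1), of ?D] K(2)
        by auto
      moreover have "derived (G\<lparr>carrier := K\<rparr>) ?D \<subseteq> K"
        using Suc derived_incl[OF _ K(1), of ?D] derived_consistent[OF _ K(1), of ?D] by metis
      ultimately show ?case using Suc by simp
    qed simp
    then have "(derived (G\<lparr>carrier := S\<rparr>) ^^ n) (generate (G\<lparr>carrier := S\<rparr>) U) = {\<one>\<^bsub>G\<lparr>carrier := S\<rparr>\<^esub>}"
      using n U by simp
    moreover have "\<exists>n>0::nat. x [^]\<^bsub>G\<lparr>carrier := S\<rparr>\<^esub> n = \<one>\<^bsub>G\<lparr>carrier := S\<rparr>\<^esub>"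
      if "x \<in> carrier (G\<lparr>carrier := S\<rparr>)" for x
      using torsion[of x] that by (simp add: nat_pow_consistent[symmetric])
    ultimately have "finite K"
      using S.torsion_solvable_finite[of U n] U by auto
    then have "finite S"
      using S.finite_if_finite_index[OF _ fi] by (simp add: genS[OF TS] assms(4))
    then show False using assms(2) by simp
  next
    case 2
    then obtain B x where B: "B \<subseteq> S" "free_basis G B" "x \<in> B"
      unfolding has_nonabelian_free_subgroup_def by blast
    then obtain n :: nat where n: "n > 0" "x [^] n = \<one>" using torsion by blast
    have c: "x \<in> carrier G" using B unfolding free_basis_def by blast
    have "eval_word G (replicate k (x, True)) = x [^] k" for k
    proof (induction k)
      case (Suc k)
      then show ?case using nat_pow_Suc2[OF c, of k] by simp
    qed simp
    moreover have "reduced_word (replicate k (x, True))" for k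
      by (induction k rule: induct_nat_012) auto
    moreover have "replicate n (x, True) \<noteq> []" "fst ` set (replicate n (x, True)) \<subseteq> B"
      using n B by auto
    ultimately show False
      using B n unfolding free_basis_def by metis
  qed
qed

end

section \<open>Proper homotopies\<close>

abbreviation unit_space :: "real topology" where
  "unit_space \<equiv> top_of_set {0..1}"

text \<open>For a Hausdorff k-space as codomain this agrees with a continuous proper map. Preimages
  of compact sets are easier to follow through composites and homotopies than closed maps; source
  and target differ because two graphs will be compared.\<close>

definition compactly_proper :: "'a topology \<Rightarrow> 'b topology \<Rightarrow> ('a \<Rightarrow> 'b) \<Rightarrow> bool" where
  "compactly_proper T Y f \<longleftrightarrow> continuous_map T Y f \<and>
     (\<forall>K. compactin Y K \<longrightarrow> compactin T {x \<in> topspace T. f x \<in> K})"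

definition compactly_homotopic ::
  "'a topology \<Rightarrow> 'b topology \<Rightarrow> ('a \<Rightarrow> 'b) \<Rightarrow> ('a \<Rightarrow> 'b) \<Rightarrow> bool" where
  "compactly_homotopic T Y f g \<longleftrightarrow>
     (\<exists>H. compactly_proper (prod_topology unit_space T) Y H \<and>
          (\<forall>x \<in> topspace T. H (0, x) = f x \<and> H (1, x) = g x))"

lemma compactly_proper_eq:
  assumes "k_space Y" "Hausdorff_space Y"
  shows "continuous_map T Y f \<and> proper_map T Y f \<longleftrightarrow> compactly_proper T Y f"
  unfolding compactly_proper_def
  using compact_imp_proper_map[OF assms(1) Hausdorff_imp_kc_space[OF assms(2)], of f T]
    compactin_proper_map_preimage continuous_map_funspace by blast

lemma compactly_properD:
  assumes "compactly_proper T Y f"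
  shows "continuous_map T Y f" "x \<in> topspace T \<Longrightarrow> f x \<in> topspace Y"
    "compactin Y K \<Longrightarrow> compactin T {x \<in> topspace T. f x \<in> K}"
  using assms unfolding compactly_proper_def by (auto simp: continuous_map_def)

lemma compactly_proper_id: "compactly_proper T T id"
  unfolding compactly_proper_def
proof (intro conjI allI impI)
  fix K assume K: "compactin T K"
  then have "{x \<in> topspace T. id x \<in> K} = K" using compactin_subset_topspace by fastforce
  with K show "compactin T {x \<in> topspace T. id x \<in> K}" by simp
qed simp

lemma compactly_proper_compose:
  assumes f: "compactly_proper T Y f" and g: "compactly_proper Y Z g"
  shows "compactly_proper T Z (g \<circ> f)"
  unfolding compactly_proper_def
proof (intro conjI allI impI)
  show "continuous_map T Z (g \<circ> f)"
    using assms by (meson compactly_properD(1) continuous_map_compose)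
  fix K assume "compactin Z K"
  then have "compactin T {x \<in> topspace T. f x \<in> {y \<in> topspace Y. g y \<in> K}}"
    using compactly_properD(3)[OF f compactly_properD(3)[OF g]] by blast
  moreover have "{x \<in> topspace T. f x \<in> {y \<in> topspace Y. g y \<in> K}} = {x \<in> topspace T. (g \<circ> f) x \<in> K}"
    using compactly_properD(2)[OF f] by auto
  ultimately show "compactin T {x \<in> topspace T. (g \<circ> f) x \<in> K}" by simp
qed

text \<open>The preimage of a compact \<open>K\<close> is closed, since \<open>K\<close> is closed
  in a Hausdorff space. It lies over the \<open>g\<close>-preimage of the projection of the compact
  \<open>H\<close>-preimage of \<open>K\<close>.\<close>

lemma compactly_proper_homotopy_pullback:
  assumes H: "compactly_proper (prod_topology unit_space T) Y H" and g: "compactly_proper W T g"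
    and "Hausdorff_space Y"
  shows "compactly_proper (prod_topology unit_space W) Y (\<lambda>(t, w). H (t, g w))"
  unfolding compactly_proper_def
proof (intro conjI allI impI)
  have "continuous_map (prod_topology unit_space W) (prod_topology unit_space T) (\<lambda>(t, w). (t, g w))"
    using compactly_properD(1)[OF g] by (simp add: continuous_map_prod_top)
  from continuous_map_compose[OF this compactly_properD(1)[OF H]]
  show c: "continuous_map (prod_topology unit_space W) Y (\<lambda>(t, w). H (t, g w))"
    by (simp add: o_def case_prod_unfold)
  fix K assume K: "compactin Y K"
  define C where "C = {z \<in> topspace (prod_topology unit_space T). H z \<in> K}"
  have C: "compactin (prod_topology unit_space T) C"
    unfolding C_def using compactly_properD(3)[OF H K] .
  have "compactin T (snd ` C)" using image_compactin[OF C continuous_map_snd] .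
  then have "compactin W {w \<in> topspace W. g w \<in> snd ` C}" using compactly_properD(3)[OF g] by blast
  moreover have "compactin unit_space {0..1::real}" by (simp add: compactin_subtopology)
  ultimately have comp: "compactin (prod_topology unit_space W) ({0..1} \<times> {w \<in> topspace W. g w \<in> snd ` C})"
    by (simp add: compactin_Times)
  show "compactin (prod_topology unit_space W)
      {z \<in> topspace (prod_topology unit_space W). (case z of (t, w) \<Rightarrow> H (t, g w)) \<in> K}"
  proof (rule closed_compactin[OF comp])
    show "closedin (prod_topology unit_space W)
      {z \<in> topspace (prod_topology unit_space W). (case z of (t, w) \<Rightarrow> H (t, g w)) \<in> K}"
      using closedin_continuous_map_preimage[OF c compactin_imp_closedin[OF assms(3) K]] .
    show "{z \<in> topspace (prod_topology unit_space W). (case z of (t, w) \<Rightarrow> H (t, g w)) \<in> K}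
       \<subseteq> {0..1} \<times> {w \<in> topspace W. g w \<in> snd ` C}"
      using compactly_properD(2)[OF g] by (force simp: C_def image_iff)
  qed
qed

lemma compactly_homotopic_refl:
  assumes "compactly_proper T Y f"
  shows "compactly_homotopic T Y f f"
proof -
  have "compactly_proper (prod_topology unit_space T) T snd"
    unfolding compactly_proper_def
  proof (intro conjI allI impI continuous_map_snd)
    fix K assume K: "compactin T K"
    then have "{z \<in> topspace (prod_topology unit_space T). snd z \<in> K} = {0..1} \<times> K"
      using compactin_subset_topspace by fastforce
    moreover have "compactin unit_space {0..1::real}" by (simp add: compactin_subtopology)
    ultimately show "compactin (prod_topology unit_space T)
        {z \<in> topspace (prod_topology unit_space T). snd z \<in> K}"
      using K by (simp add: compactin_Times)
  qed
  then have "compactly_proper (prod_topology unit_space T) Y (f \<circ> snd)"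
    using assms by (rule compactly_proper_compose)
  then show ?thesis unfolding compactly_homotopic_def by (intro exI[of _ "f \<circ> snd"]) auto
qed

lemma compactly_homotopic_pre:
  assumes "compactly_homotopic T Y f f'" "compactly_proper W T g" "Hausdorff_space Y"
  shows "compactly_homotopic W Y (f \<circ> g) (f' \<circ> g)"
proof -
  obtain H where H: "compactly_proper (prod_topology unit_space T) Y H"
    "\<And>x. x \<in> topspace T \<Longrightarrow> H (0, x) = f x \<and> H (1, x) = f' x"
    using assms unfolding compactly_homotopic_def by blast
  show ?thesis
    unfolding compactly_homotopic_def
    using compactly_proper_homotopy_pullback[OF H(1) assms(2,3)] H(2) compactly_properD(2)[OF assms(2)]
    by (intro exI[of _ "\<lambda>(t, w). H (t, g w)"]) auto
qed

lemma compactly_homotopic_post: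
  assumes "compactly_homotopic T Y g g'" "compactly_proper Y Z f"
  shows "compactly_homotopic T Z (f \<circ> g) (f \<circ> g')"
proof -
  obtain H where H: "compactly_proper (prod_topology unit_space T) Y H"
    "\<And>x. x \<in> topspace T \<Longrightarrow> H (0, x) = g x \<and> H (1, x) = g' x"
    using assms unfolding compactly_homotopic_def by blast
  show ?thesis
    unfolding compactly_homotopic_def
    using compactly_proper_compose[OF H(1) assms(2)] H(2) by (intro exI[of _ "f \<circ> H"]) auto
qed

lemma compactly_homotopic_sym:
  assumes "compactly_homotopic T Y f g"
  shows "compactly_homotopic T Y g f"
proof -
  obtain H where H: "compactly_proper (prod_topology unit_space T) Y H"
    "\<And>x. x \<in> topspace T \<Longrightarrow> H (0, x) = f x \<and> H (1, x) = g x"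
    using assms unfolding compactly_homotopic_def by blast
  let ?P = "prod_topology unit_space T"
  define r where "r = (\<lambda>z :: real \<times> 'a. (1 - fst z, snd z))"
  have c: "continuous_map unit_space unit_space (\<lambda>t. 1 - t)"
    by (auto simp: continuous_map_in_subtopology intro!: continuous_intros)
  have r: "continuous_map ?P ?P r"
    unfolding r_def continuous_map_paired
    using continuous_map_compose[OF continuous_map_fst c] by (simp add: o_def continuous_map_snd)
  have "compactly_proper ?P ?P r"
    unfolding compactly_proper_def
  proof (intro conjI allI impI r)
    fix K assume K: "compactin ?P K"
    then have "K \<subseteq> topspace ?P" by (rule compactin_subset_topspace)
    then have "{z \<in> topspace ?P. r z \<in> K} = r ` K"
      by (force simp: r_def image_iff)
    then show "compactin ?P {z \<in> topspace ?P. r z \<in> K}" using image_compactin[OF K r] by simp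
  qed
  from compactly_proper_compose[OF this H(1)] show ?thesis
    unfolding compactly_homotopic_def using H(2) by (intro exI[of _ "H \<circ> r"]) (auto simp: r_def)
qed

lemma compactly_homotopic_trans:
  assumes "compactly_homotopic T Y f g" "compactly_homotopic T Y g h"
  shows "compactly_homotopic T Y f h"
proof -
  let ?P = "prod_topology unit_space T"
  obtain k1 where k1: "compactly_proper ?P Y k1"
    "\<And>x. x \<in> topspace T \<Longrightarrow> k1 (0, x) = f x" "\<And>x. x \<in> topspace T \<Longrightarrow> k1 (1, x) = g x"
    using assms unfolding compactly_homotopic_def by blast
  obtain k2 where k2: "compactly_proper ?P Y k2"
    "\<And>x. x \<in> topspace T \<Longrightarrow> k2 (0, x) = g x" "\<And>x. x \<in> topspace T \<Longrightarrow> k2 (1, x) = h x"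
    using assms unfolding compactly_homotopic_def by blast
  define k where "k \<equiv> \<lambda>y. if fst y \<le> 1/2
                             then (k1 \<circ> (\<lambda>x. (2 *\<^sub>R fst x, snd x))) y
                             else (k2 \<circ> (\<lambda>x. (2 *\<^sub>R fst x -1, snd x))) y"
  have cont: "continuous_map ?P Y k"
    unfolding k_def
  proof (rule continuous_map_cases_le)
    show fst: "continuous_map ?P euclideanreal fst"
      using continuous_map_fst continuous_map_in_subtopology by blast
    show "continuous_map ?P euclideanreal (\<lambda>x. 1/2)"
      by simp
    show "continuous_map (subtopology ?P {y \<in> topspace ?P. fst y \<le> 1/2}) Y
             (k1 \<circ> (\<lambda>x. (2 *\<^sub>R fst x, snd x)))"
      apply (intro fst continuous_map_compose [OF _ compactly_properD(1)[OF k1(1)]] continuous_intros continuous_map_into_subtopology continuous_map_from_subtopology | simp)+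
      by (force simp: prod_topology_subtopology)
    show "continuous_map (subtopology ?P {y \<in> topspace ?P. 1/2 \<le> fst y}) Y
             (k2 \<circ> (\<lambda>x. (2 *\<^sub>R fst x -1, snd x)))"
      apply (intro fst continuous_map_compose [OF _ compactly_properD(1)[OF k2(1)]] continuous_intros continuous_map_into_subtopology continuous_map_from_subtopology | simp)+
      by (force simp: prod_topology_subtopology)
    show "(k1 \<circ> (\<lambda>x. (2 *\<^sub>R fst x, snd x))) y = (k2 \<circ> (\<lambda>x. (2 *\<^sub>R fst x -1, snd x))) y"
      if "y \<in> topspace ?P" and "fst y = 1/2" for y
    proof -
      have "2 * fst y = 1" "2 * fst y - 1 = 0" "snd y \<in> topspace T" using that by auto
      then show ?thesis using k1(3) k2(2) by simp
    qed
  qed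
  \<comment> \<open>These maps squeeze the two homotopies into the two halves of the parameter
    interval; the preimage of \<open>K\<close> under the concatenation is the union of the images of
    two compact sets.\<close>
  define h1 where "h1 = (\<lambda>z :: real \<times> 'a. (fst z / 2, snd z))"
  define h2 where "h2 = (\<lambda>z :: real \<times> 'a. (fst z / 2 + 1 / 2, snd z))"
  have c: "continuous_map unit_space unit_space (\<lambda>t. t / 2)"
    "continuous_map unit_space unit_space (\<lambda>t. t / 2 + 1 / 2)"
    by (auto simp: continuous_map_in_subtopology intro!: continuous_intros)
  have h: "continuous_map ?P ?P h1" "continuous_map ?P ?P h2"
    unfolding h1_def h2_def continuous_map_paired
    using continuous_map_compose[OF continuous_map_fst c(1)]
      continuous_map_compose[OF continuous_map_fst c(2)] by (simp_all add: o_def continuous_map_snd)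
  have "compactly_proper ?P Y k"
    unfolding compactly_proper_def
  proof (intro conjI allI impI cont)
    fix K assume K: "compactin Y K"
    define C1 where "C1 = {z \<in> topspace ?P. k1 z \<in> K}"
    define C2 where "C2 = {z \<in> topspace ?P. k2 z \<in> K}"
    have "compactin ?P (h1 ` C1 \<union> h2 ` C2)"
      unfolding C1_def C2_def using compactly_properD(3)[OF k1(1) K] compactly_properD(3)[OF k2(1) K]
      by (intro compactin_Un image_compactin[OF _ h(1)] image_compactin[OF _ h(2)])
    moreover have "{z \<in> topspace ?P. k z \<in> K} = h1 ` C1 \<union> h2 ` C2"
    proof
      show "{z \<in> topspace ?P. k z \<in> K} \<subseteq> h1 ` C1 \<union> h2 ` C2"
      proof
        fix z assume "z \<in> {z \<in> topspace ?P. k z \<in> K}"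
        then have z: "z \<in> topspace ?P" "k z \<in> K" by auto
        show "z \<in> h1 ` C1 \<union> h2 ` C2"
        proof (cases "fst z \<le> 1/2")
          case True
          then have "(2 * fst z, snd z) \<in> C1" using z by (auto simp: C1_def k_def)
          moreover have "z = h1 (2 * fst z, snd z)" by (simp add: h1_def)
          ultimately show ?thesis by blast
        next
          case False
          then have "(2 * fst z - 1, snd z) \<in> C2" using z by (auto simp: C2_def k_def)
          moreover have "z = h2 (2 * fst z - 1, snd z)" by (simp add: h2_def field_simps)
          ultimately show ?thesis by blast
        qed
      qed
      have "k (h1 z) = k1 z" if "z \<in> topspace ?P" for z
        using that by (auto simp: k_def h1_def)
      moreover have "k (h2 z) = k2 z" if "z \<in> topspace ?P" for z
      proof (cases "fst z = 0")
        \<comment> \<open>Here \<open>h2\<close> lands on parameter 1/2, where \<open>k\<close>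
          still follows \<open>k1\<close>; both homotopies equal \<open>g\<close> there.\<close>
        case True
        then show ?thesis using that k1(3)[of "snd z"] k2(2)[of "snd z"]
          by (cases z) (auto simp: k_def h2_def)
      next
        case False
        then show ?thesis using that by (cases z) (auto simp: k_def h2_def add_divide_distrib)
      qed
      ultimately show "h1 ` C1 \<union> h2 ` C2 \<subseteq> {z \<in> topspace ?P. k z \<in> K}"
        by (auto simp: C1_def C2_def) (auto simp: h1_def h2_def)
    qed
    ultimately show "compactin ?P {z \<in> topspace ?P. k z \<in> K}" by simp
  qed
  then show ?thesis
    unfolding compactly_homotopic_def using k1 k2 by (intro exI[of _ k]) (auto simp: k_def)
qed

lemma compactly_homotopic_compose:
  assumes "compactly_homotopic T Y g g'" "compactly_homotopic Y Z f f'"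
    "compactly_proper T Y g'" "compactly_proper Y Z f" "Hausdorff_space Z"
  shows "compactly_homotopic T Z (f \<circ> g) (f' \<circ> g')"
  using compactly_homotopic_trans[OF compactly_homotopic_post[OF assms(1,4)]
      compactly_homotopic_pre[OF assms(2,3,5)]] .

section \<open>Mapping class groups\<close>

locale mapping_space =
  fixes T :: "'a topology"
  assumes k_space: "k_space T" and Hausdorff: "Hausdorff_space T"
begin

lemma proper_cont_iff: "proper_cont T f \<longleftrightarrow> compactly_proper T T f"
  unfolding proper_cont_def using compactly_proper_eq[OF k_space Hausdorff] .

lemma proper_homotopic_iff: "proper_homotopic T f g \<longleftrightarrow> compactly_homotopic T T f g"
  unfolding proper_homotopic_def compactly_homotopic_def
    compactly_proper_eq[OF k_space Hausdorff, symmetric] by auto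

lemma proper_homotopy_equivalence_iff:
  "proper_homotopy_equivalence T f \<longleftrightarrow> compactly_proper T T f \<and>
     (\<exists>g. compactly_proper T T g \<and> compactly_homotopic T T (g \<circ> f) id \<and> compactly_homotopic T T (f \<circ> g) id)"
  unfolding proper_homotopy_equivalence_def proper_cont_iff proper_homotopic_iff ..

lemma equivalence_proper: "proper_homotopy_equivalence T f \<Longrightarrow> compactly_proper T T f"
  by (simp add: proper_homotopy_equivalence_iff)

lemma equivalence_compose:
  assumes "proper_homotopy_equivalence T f" "proper_homotopy_equivalence T g"
  shows "proper_homotopy_equivalence T (f \<circ> g)"
proof -
  obtain f' where f': "compactly_proper T T f'" "compactly_homotopic T T (f' \<circ> f) id"
    "compactly_homotopic T T (f \<circ> f') id" using assms(1) by (auto simp: proper_homotopy_equivalence_iff)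
  obtain g' where g': "compactly_proper T T g'" "compactly_homotopic T T (g' \<circ> g) id"
    "compactly_homotopic T T (g \<circ> g') id" using assms(2) by (auto simp: proper_homotopy_equivalence_iff)
  have f: "compactly_proper T T f" and g: "compactly_proper T T g"
    using assms by (auto simp: equivalence_proper)
  have *: "compactly_homotopic T T (a' \<circ> (b' \<circ> b) \<circ> a) id"
    if "compactly_homotopic T T (b' \<circ> b) id" "compactly_homotopic T T (a' \<circ> a) id"
      "compactly_proper T T a" "compactly_proper T T a'" for a a' b b' :: "'a \<Rightarrow> 'a"
    using compactly_homotopic_trans[OF compactly_homotopic_pre[OF compactly_homotopic_post[OF that(1,4)] that(3) Hausdorff]]
      that(2) by simp
  show ?thesis
    unfolding proper_homotopy_equivalence_iff
    using compactly_proper_compose[OF g f] compactly_proper_compose[OF f'(1) g'(1)]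
      *[OF f'(2) g'(2) g g'(1)] *[OF g'(3) f'(3) f'(1) f]
    by (intro conjI exI[of _ "g' \<circ> f'"]) (simp_all add: comp_assoc)
qed

lemma equivalence_id: "proper_homotopy_equivalence T id"
  unfolding proper_homotopy_equivalence_iff
  using compactly_proper_id compactly_homotopic_refl[OF compactly_proper_id] by fastforce

lemma mem_ph_class:
  "g \<in> ph_class T f \<longleftrightarrow> proper_homotopy_equivalence T g \<and> compactly_homotopic T T f g"
  by (simp add: ph_class_def proper_homotopic_iff)

lemma self_in_ph_class: "proper_homotopy_equivalence T f \<Longrightarrow> f \<in> ph_class T f"
  by (simp add: mem_ph_class equivalence_proper compactly_homotopic_refl)

lemma ph_class_eq_iff:
  assumes "proper_homotopy_equivalence T g"
  shows "ph_class T f = ph_class T g \<longleftrightarrow> compactly_homotopic T T f g"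
proof
  assume "ph_class T f = ph_class T g"
  then show "compactly_homotopic T T f g" using self_in_ph_class[OF assms] by (metis mem_ph_class)
next
  assume "compactly_homotopic T T f g"
  then have "compactly_homotopic T T f h \<longleftrightarrow> compactly_homotopic T T g h" for h
    by (meson compactly_homotopic_sym compactly_homotopic_trans)
  then show "ph_class T f = ph_class T g" by (simp add: mem_ph_class set_eq_iff)
qed

lemma carrier_MapGroup: "carrier (MapGroup T) = ph_class T ` {f. proper_homotopy_equivalence T f}"
  by (simp add: MapGroup_def)

lemma one_MapGroup: "\<one>\<^bsub>MapGroup T\<^esub> = ph_class T id"
  by (simp add: MapGroup_def)

text \<open>The product is defined through arbitrarily chosen representatives; it is well defined
  because composition respects proper homotopy.\<close>

lemma mult_MapGroup:
  assumes f: "proper_homotopy_equivalence T f" and g: "proper_homotopy_equivalence T g"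
  shows "ph_class T f \<otimes>\<^bsub>MapGroup T\<^esub> ph_class T g = ph_class T (f \<circ> g)"
proof -
  define a where "a = (SOME a. a \<in> ph_class T f)"
  define b where "b = (SOME b. b \<in> ph_class T g)"
  have "a \<in> ph_class T f" "b \<in> ph_class T g"
    unfolding a_def b_def
    using someI[of "\<lambda>a. a \<in> ph_class T f" f] someI[of "\<lambda>b. b \<in> ph_class T g" g]
      self_in_ph_class[OF f] self_in_ph_class[OF g] by simp_all
  then have "compactly_homotopic T T f a" "proper_homotopy_equivalence T a"
    "compactly_homotopic T T g b" "proper_homotopy_equivalence T b" by (auto simp: mem_ph_class)
  then have "compactly_homotopic T T (f \<circ> g) (a \<circ> b)" "proper_homotopy_equivalence T (a \<circ> b)"
    using f g by (auto intro: compactly_homotopic_compose equivalence_proper Hausdorff equivalence_compose)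
  then have "ph_class T (f \<circ> g) = ph_class T (a \<circ> b)" by (simp add: ph_class_eq_iff)
  then show ?thesis by (simp add: MapGroup_def a_def b_def)
qed

lemma group_MapGroup: "group (MapGroup T)"
proof (rule groupI)
  fix x assume "x \<in> carrier (MapGroup T)"
  then obtain f where f: "x = ph_class T f" "proper_homotopy_equivalence T f"
    by (auto simp: carrier_MapGroup)
  then obtain g where g: "compactly_proper T T g" "compactly_homotopic T T (g \<circ> f) id"
    "compactly_homotopic T T (f \<circ> g) id" by (auto simp: proper_homotopy_equivalence_iff)
  then have "proper_homotopy_equivalence T g"
    using equivalence_proper[OF f(2)] by (auto simp: proper_homotopy_equivalence_iff)
  then show "\<exists>y\<in>carrier (MapGroup T). y \<otimes>\<^bsub>MapGroup T\<^esub> x = \<one>\<^bsub>MapGroup T\<^esub>"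
    using f g by (intro bexI[of _ "ph_class T g"])
      (auto simp: carrier_MapGroup mult_MapGroup one_MapGroup ph_class_eq_iff equivalence_id)
qed (auto simp: carrier_MapGroup one_MapGroup mult_MapGroup equivalence_compose equivalence_id comp_assoc)

section \<open>Action on the ends and the pure subgroup\<close>

lemma end_connected:
  assumes "\<epsilon> \<in> ends_of T" "compactin T K"
  shows "connectedin T (\<epsilon> K)" "\<epsilon> K \<subseteq> topspace T - K" "\<epsilon> K \<noteq> {}"
proof -
  have C: "\<epsilon> K \<in> connected_components_of (subtopology T (topspace T - K))"
    using assms by (auto simp: ends_of_def)
  show "connectedin T (\<epsilon> K)" "\<epsilon> K \<subseteq> topspace T - K"
    using connectedin_connected_components_of[OF C] by (auto simp: connectedin_subtopology)
  show "\<epsilon> K \<noteq> {}" using nonempty_connected_components_of[OF C] .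
qed

text \<open>The form in which ends are used below: to lie in the neighbourhood of the end, a
  connected set that avoids \<open>K\<close> only has to touch it.\<close>

lemma end_absorbs:
  assumes "\<epsilon> \<in> ends_of T" "compactin T K" "connectedin T S" "S \<inter> K = {}" "S \<inter> \<epsilon> K \<noteq> {}"
  shows "S \<subseteq> \<epsilon> K"
proof (rule connected_components_of_maximal)
  show "\<epsilon> K \<in> connected_components_of (subtopology T (topspace T - K))"
    using assms by (auto simp: ends_of_def)
  show "connectedin (subtopology T (topspace T - K)) S"
    using assms connectedin_subset_topspace by (auto simp: connectedin_subtopology)
  show "\<not> disjnt (\<epsilon> K) S" using assms by (auto simp: disjnt_def)
qed

lemma end_antimono:
  assumes "\<epsilon> \<in> ends_of T" "compactin T K" "compactin T L" "K \<subseteq> L"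
  shows "\<epsilon> L \<subseteq> \<epsilon> K"
  using assms by (auto simp: ends_of_def)

text \<open>The points whose tracks meet \<open>K\<close> have compact closure \<open>P\<close>, in
  fact form \<open>P\<close> itself. Outside \<open>P\<close> a track is connected, avoids
  \<open>K\<close> and starts in the neighbourhood of the end, so it also ends there.\<close>

lemma maps_end_to_homotopic:
  assumes "compactly_homotopic T T f g" "\<epsilon> \<in> ends_of T" "maps_end_to T f \<epsilon> \<epsilon>"
  shows "maps_end_to T g \<epsilon> \<epsilon>"
  unfolding maps_end_to_def
proof (intro allI impI)
  fix K assume K: "compactin T K"
  obtain H where H: "compactly_proper (prod_topology unit_space T) T H"
    "\<And>x. x \<in> topspace T \<Longrightarrow> H (0, x) = f x \<and> H (1, x) = g x"
    using assms(1) unfolding compactly_homotopic_def by blast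
  define P where "P = snd ` {z \<in> topspace (prod_topology unit_space T). H z \<in> K}"
  have P: "compactin T P"
    unfolding P_def using image_compactin[OF compactly_properD(3)[OF H(1) K] continuous_map_snd] .
  obtain L where L: "compactin T L" "f ` \<epsilon> L \<subseteq> \<epsilon> K"
    using assms(3) K unfolding maps_end_to_def by blast
  have PL: "compactin T (P \<union> L)" using P L by (simp add: compactin_Un)
  have "g x \<in> \<epsilon> K" if x: "x \<in> \<epsilon> (P \<union> L)" for x
  proof -
    have xX: "x \<in> topspace T" "x \<notin> P" using end_connected(2)[OF assms(2) PL] x by auto
    have "x \<in> \<epsilon> L" using end_antimono[OF assms(2) L(1) PL] x by blast
    then have fx: "f x \<in> \<epsilon> K" using L by blast
    have "continuous_map unit_space (prod_topology unit_space T) (\<lambda>t. (t, x))"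
      using xX by (simp add: continuous_map_paired)
    from continuous_map_compose[OF this compactly_properD(1)[OF H(1)]]
    have "continuous_map unit_space T (\<lambda>t. H (t, x))" by (simp add: o_def)
    moreover have "connectedin unit_space {0..1}" by (simp add: connectedin_subtopology)
    ultimately have "connectedin T ((\<lambda>t. H (t, x)) ` {0..1})" by (rule connectedin_continuous_map_image)
    moreover have "(\<lambda>t. H (t, x)) ` {0..1} \<inter> K = {}" using xX by (force simp: P_def image_iff)
    moreover have "f x \<in> (\<lambda>t. H (t, x)) ` {0..1}" using H(2)[OF xX(1)] by (intro image_eqI[of _ _ 0]) auto
    ultimately have "(\<lambda>t. H (t, x)) ` {0..1} \<subseteq> \<epsilon> K" using end_absorbs[OF assms(2) K] fx by blast
    moreover have "g x \<in> (\<lambda>t. H (t, x)) ` {0..1}" using H(2)[OF xX(1)] by (intro image_eqI[of _ _ 1]) auto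
    ultimately show ?thesis by blast
  qed
  then show "\<exists>L. compactin T L \<and> g ` \<epsilon> L \<subseteq> \<epsilon> K" using PL by blast
qed

lemma maps_end_to_id: "maps_end_to T id \<epsilon> \<epsilon>"
  unfolding maps_end_to_def by auto

lemma maps_end_to_compose:
  assumes "maps_end_to T f \<epsilon> \<epsilon>'" "maps_end_to T g \<epsilon>' \<epsilon>''"
  shows "maps_end_to T (g \<circ> f) \<epsilon> \<epsilon>''"
  using assms unfolding maps_end_to_def by (metis image_comp image_mono subset_trans)

text \<open>The image under \<open>g\<close> of the neighbourhood cut off by the preimage of
  \<open>K\<close> is connected and avoids \<open>K\<close>. A point close to the end, pushed by
  \<open>f\<close> and then \<open>g\<close>, shows that it touches the right component. This gives
  inverses in the pure group.\<close>

lemma maps_end_to_left_inverse: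
  assumes g: "compactly_proper T T g" and \<epsilon>: "\<epsilon> \<in> ends_of T"
    and "maps_end_to T f \<epsilon> \<epsilon>" "maps_end_to T (g \<circ> f) \<epsilon> \<epsilon>"
  shows "maps_end_to T g \<epsilon> \<epsilon>"
  unfolding maps_end_to_def
proof (intro allI impI)
  fix K assume K: "compactin T K"
  define K' where "K' = {x \<in> topspace T. g x \<in> K}"
  have K': "compactin T K'" unfolding K'_def using compactly_properD(3)[OF g K] .
  obtain L1 where L1: "compactin T L1" "(g \<circ> f) ` \<epsilon> L1 \<subseteq> \<epsilon> K"
    using assms(4) K unfolding maps_end_to_def by blast
  obtain L2 where L2: "compactin T L2" "f ` \<epsilon> L2 \<subseteq> \<epsilon> K'"
    using assms(3) K' unfolding maps_end_to_def by blast
  have L: "compactin T (L1 \<union> L2)" using L1 L2 by (simp add: compactin_Un)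
  then obtain x where x: "x \<in> \<epsilon> (L1 \<union> L2)" using end_connected(3)[OF \<epsilon>] by blast
  then have "x \<in> \<epsilon> L1" "x \<in> \<epsilon> L2"
    using end_antimono[OF \<epsilon> L1(1) L] end_antimono[OF \<epsilon> L2(1) L] by blast+
  then have "f x \<in> \<epsilon> K'" "g (f x) \<in> \<epsilon> K" using L1 L2 by auto
  then have "g ` \<epsilon> K' \<inter> \<epsilon> K \<noteq> {}" by blast
  moreover have "connectedin T (g ` \<epsilon> K')"
    using connectedin_continuous_map_image[OF compactly_properD(1)[OF g] end_connected(1)[OF \<epsilon> K']] .
  moreover have "g ` \<epsilon> K' \<inter> K = {}" using end_connected(2)[OF \<epsilon> K'] by (auto simp: K'_def)
  ultimately have "g ` \<epsilon> K' \<subseteq> \<epsilon> K" using end_absorbs[OF \<epsilon> K] by blast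
  then show "\<exists>L. compactin T L \<and> g ` \<epsilon> L \<subseteq> \<epsilon> K" using K' by blast
qed

text \<open>The definition quantifies over all representatives; by homotopy invariance one
  representative decides.\<close>

lemma ph_class_in_PMapGroup:
  assumes "proper_homotopy_equivalence T f"
  shows "ph_class T f \<in> carrier (PMapGroup T) \<longleftrightarrow> (\<forall>\<epsilon>\<in>ends_of T. maps_end_to T f \<epsilon> \<epsilon>)"
  unfolding PMapGroup_def using assms self_in_ph_class[OF assms] maps_end_to_homotopic
  by (auto simp: carrier_MapGroup mem_ph_class)

lemma PMapGroup_eq: "PMapGroup T = MapGroup T\<lparr>carrier := carrier (PMapGroup T)\<rparr>"
  by (simp add: PMapGroup_def)

lemma PMapGroup_mem:
  assumes "x \<in> carrier (PMapGroup T)"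
  obtains f where "x = ph_class T f" "proper_homotopy_equivalence T f"
    "\<And>\<epsilon>. \<epsilon> \<in> ends_of T \<Longrightarrow> maps_end_to T f \<epsilon> \<epsilon>"
proof -
  from assms have "x \<in> carrier (MapGroup T)" by (simp add: PMapGroup_def)
  then obtain f where "x = ph_class T f" "proper_homotopy_equivalence T f"
    by (auto simp: carrier_MapGroup)
  then show thesis using that assms ph_class_in_PMapGroup by metis
qed

lemma subgroup_PMapGroup: "subgroup (carrier (PMapGroup T)) (MapGroup T)"
proof (rule group.subgroupI[OF group_MapGroup])
  show "carrier (PMapGroup T) \<subseteq> carrier (MapGroup T)" by (auto simp: PMapGroup_def)
  show "carrier (PMapGroup T) \<noteq> {}"
    using ph_class_in_PMapGroup[OF equivalence_id] maps_end_to_id by blast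
next
  fix x assume "x \<in> carrier (PMapGroup T)"
  then obtain f where f: "x = ph_class T f" "proper_homotopy_equivalence T f"
    "\<And>\<epsilon>. \<epsilon> \<in> ends_of T \<Longrightarrow> maps_end_to T f \<epsilon> \<epsilon>" by (rule PMapGroup_mem) blast
  then obtain g where g: "compactly_proper T T g" "compactly_homotopic T T (g \<circ> f) id"
    "compactly_homotopic T T (f \<circ> g) id" by (auto simp: proper_homotopy_equivalence_iff)
  have ge: "proper_homotopy_equivalence T g"
    using equivalence_proper[OF f(2)] g by (auto simp: proper_homotopy_equivalence_iff)
  have "maps_end_to T g \<epsilon> \<epsilon>" if \<epsilon>: "\<epsilon> \<in> ends_of T" for \<epsilon>
    using maps_end_to_left_inverse[OF g(1) \<epsilon> f(3)[OF \<epsilon>]]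
      maps_end_to_homotopic[OF compactly_homotopic_sym[OF g(2)] \<epsilon> maps_end_to_id] by blast
  then have "ph_class T g \<in> carrier (PMapGroup T)" using ph_class_in_PMapGroup[OF ge] by blast
  moreover have "inv\<^bsub>MapGroup T\<^esub> x = ph_class T g"
    using f g ge by (intro group.inv_equality[OF group_MapGroup])
      (auto simp: carrier_MapGroup mult_MapGroup one_MapGroup ph_class_eq_iff equivalence_id)
  ultimately show "inv\<^bsub>MapGroup T\<^esub> x \<in> carrier (PMapGroup T)" by simp
next
  fix x y assume "x \<in> carrier (PMapGroup T)" "y \<in> carrier (PMapGroup T)"
  then obtain f g where f: "x = ph_class T f" "proper_homotopy_equivalence T f"
    "\<And>\<epsilon>. \<epsilon> \<in> ends_of T \<Longrightarrow> maps_end_to T f \<epsilon> \<epsilon>"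
    and g: "y = ph_class T g" "proper_homotopy_equivalence T g"
    "\<And>\<epsilon>. \<epsilon> \<in> ends_of T \<Longrightarrow> maps_end_to T g \<epsilon> \<epsilon>" by (metis PMapGroup_mem)
  moreover from this have "\<forall>\<epsilon>\<in>ends_of T. maps_end_to T (f \<circ> g) \<epsilon> \<epsilon>"
    using maps_end_to_compose by blast
  ultimately show "x \<otimes>\<^bsub>MapGroup T\<^esub> y \<in> carrier (PMapGroup T)"
    by (auto simp: mult_MapGroup ph_class_in_PMapGroup equivalence_compose)
qed

lemma group_PMapGroup: "group (PMapGroup T)"
  by (subst PMapGroup_eq) (rule group.subgroup_imp_group[OF group_MapGroup subgroup_PMapGroup])

end

lemma embedded_Grigorchuk:
  assumes M: "group M" and hom: "\<phi> \<in> hom Grigorchuk_group M" and inj: "inj_on \<phi> (carrier Grigorchuk_group)"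
  shows "subgroup (\<phi> ` carrier Grigorchuk_group) M"
    "Grigorchuk_group \<cong> M\<lparr>carrier := \<phi> ` carrier Grigorchuk_group\<rparr>"
    "\<not> tits_alternative M"
proof -
  let ?\<Gamma> = Grigorchuk_group
  interpret \<phi>: group_hom ?\<Gamma> M \<phi>
    using group_Grigorchuk M hom by (simp add: group_hom_def group_hom_axioms_def)
  show sub: "subgroup (\<phi> ` carrier ?\<Gamma>) M" by (rule \<phi>.img_is_subgroup)
  have "\<phi> \<in> iso ?\<Gamma> (M\<lparr>carrier := \<phi> ` carrier ?\<Gamma>\<rparr>)"
    using hom inj by (auto simp: iso_def hom_def bij_betw_def)
  then show "?\<Gamma> \<cong> M\<lparr>carrier := \<phi> ` carrier ?\<Gamma>\<rparr>" by (auto simp: is_iso_def)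
  obtain T where T: "finite T" "T \<subseteq> carrier ?\<Gamma>" "generate ?\<Gamma> T = carrier ?\<Gamma>"
    using Grigorchuk_finitely_generated by blast
  show "\<not> tits_alternative M"
  proof (rule \<phi>.H.not_tits_alternative[OF sub])
    show "infinite (\<phi> ` carrier ?\<Gamma>)"
      using inj infinite_word_acts by (simp add: finite_image_iff carrier_Grigorchuk)
    show "finite (\<phi> ` T)" "\<phi> ` T \<subseteq> carrier M" using T by auto
    show "generate M (\<phi> ` T) = \<phi> ` carrier ?\<Gamma>" using \<phi>.generate_img[OF T(2)] T(3) by simp
    fix x assume "x \<in> \<phi> ` carrier ?\<Gamma>"
    then obtain f where f: "f \<in> carrier ?\<Gamma>" "x = \<phi> f" by blast
    then obtain n :: nat where "n > 0" "f [^]\<^bsub>?\<Gamma>\<^esub> n = \<one>\<^bsub>?\<Gamma>\<^esub>" using Grigorchuk_torsion by blast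
    then show "\<exists>n>0::nat. x [^]\<^bsub>M\<^esub> n = \<one>\<^bsub>M\<^esub>"
      using f \<phi>.hom_nat_pow[of f n] by (intro exI[of _ n]) simp
  qed
qed

section \<open>The topology of a graph\<close>

abbreviation closed_edge :: "('e \<Rightarrow> 'v \<times> 'v) \<Rightarrow> 'e \<Rightarrow> ('v + 'e \<times> real) set" where
  "closed_edge ends e \<equiv> edge_char ends e ` {0..1}"

lemma edge_char_simps [simp]:
  "edge_char ends e 0 = Inl (fst (ends e))" "edge_char ends e 1 = Inl (snd (ends e))"
  "0 < t \<Longrightarrow> t < 1 \<Longrightarrow> edge_char ends e t = Inr (e, t)"
  by (auto simp: edge_char_def)

lemma edge_char_cases:
  assumes "t \<in> {0..1}"
  obtains "t = 0" "edge_char ends e t = Inl (fst (ends e))"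
    | "t = 1" "edge_char ends e t = Inl (snd (ends e))"
    | "0 < t" "t < 1" "edge_char ends e t = Inr (e, t)"
  using assms by (cases "t = 0"; cases "t = 1") auto

lemma edge_char_in_points: "edge_char ends e t \<in> graph_points ends"
  by (auto simp: edge_char_def graph_points_def)

lemma openin_graph_top:
  "openin (graph_top ends) U \<longleftrightarrow> U \<subseteq> graph_points ends \<and>
      (\<forall>e. openin unit_space {t \<in> {0..1}. edge_char ends e t \<in> U})"
proof -
  have "istopology (\<lambda>U. U \<subseteq> graph_points ends \<and>
      (\<forall>e. openin unit_space {t \<in> {0..1}. edge_char ends e t \<in> U}))"
    unfolding istopology_def
  proof (intro conjI allI impI)
    fix S U e assume S: "S \<subseteq> graph_points ends \<and> (\<forall>e. openin unit_space {t \<in> {0..1}. edge_char ends e t \<in> S})"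
      and U: "U \<subseteq> graph_points ends \<and> (\<forall>e. openin unit_space {t \<in> {0..1}. edge_char ends e t \<in> U})"
    have eq: "{t \<in> {0..1}. edge_char ends e t \<in> S \<inter> U}
      = {t \<in> {0..1}. edge_char ends e t \<in> S} \<inter> {t \<in> {0..1}. edge_char ends e t \<in> U}" by auto
    show "openin unit_space {t \<in> {0..1}. edge_char ends e t \<in> S \<inter> U}"
      unfolding eq by (rule openin_Int) (use S U in blast)+
  next
    fix \<K> e assume K: "\<forall>K\<in>\<K>. K \<subseteq> graph_points ends \<and> (\<forall>e. openin unit_space {t \<in> {0..1}. edge_char ends e t \<in> K})"
    have "{t \<in> {0..1}. edge_char ends e t \<in> \<Union>\<K>} = (\<Union>K\<in>\<K>. {t \<in> {0..1}. edge_char ends e t \<in> K})" by auto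
    moreover have "openin unit_space (\<Union>K\<in>\<K>. {t \<in> {0..1}. edge_char ends e t \<in> K})"
      using K by (intro openin_Union) auto
    ultimately show "openin unit_space {t \<in> {0..1}. edge_char ends e t \<in> \<Union>\<K>}" by metis
  qed auto
  then show ?thesis unfolding graph_top_def by (simp add: topology_inverse')
qed

lemma topspace_graph_top: "topspace (graph_top ends) = graph_points ends"
proof -
  have "{t \<in> {0..1}. edge_char ends e t \<in> graph_points ends} = topspace unit_space" for e
    using edge_char_in_points by auto
  then have "openin (graph_top ends) (graph_points ends)"
    unfolding openin_graph_top by (metis openin_topspace order_refl)
  then show ?thesis
    by (metis openin_graph_top openin_subset openin_topspace subset_antisym)
qed

lemma closedin_graph_top:
  "closedin (graph_top ends) C \<longleftrightarrow> C \<subseteq> graph_points ends \<and>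
      (\<forall>e. closedin unit_space {t \<in> {0..1}. edge_char ends e t \<in> C})"
proof -
  have "{0..1} - {t \<in> {0..1}. edge_char ends e t \<in> C} = {t \<in> {0..1}. edge_char ends e t \<in> graph_points ends - C}" for e
    using edge_char_in_points by auto
  then show ?thesis
    unfolding closedin_def openin_graph_top topspace_graph_top by auto
qed

lemma continuous_edge_char: "continuous_map unit_space (graph_top ends) (edge_char ends e)"
  unfolding continuous_map_def openin_graph_top topspace_graph_top
  using edge_char_in_points by (auto simp: openin_graph_top)

lemma continuous_map_graph_iff:
  "continuous_map (graph_top ends) Y f \<longleftrightarrow> f \<in> graph_points ends \<rightarrow> topspace Y \<and>
     (\<forall>e. continuous_map unit_space Y (f \<circ> edge_char ends e))"
proof (intro iffI conjI)
  assume f: "continuous_map (graph_top ends) Y f"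
  then show "f \<in> graph_points ends \<rightarrow> topspace Y"
    by (auto simp: continuous_map_def topspace_graph_top)
  show "\<forall>e. continuous_map unit_space Y (f \<circ> edge_char ends e)"
    using continuous_map_compose[OF continuous_edge_char f] by blast
next
  assume f: "f \<in> graph_points ends \<rightarrow> topspace Y \<and> (\<forall>e. continuous_map unit_space Y (f \<circ> edge_char ends e))"
  show "continuous_map (graph_top ends) Y f"
    unfolding continuous_map_def topspace_graph_top
  proof (intro conjI allI impI)
    fix U assume U: "openin Y U"
    have eq: "{t \<in> {0..1}. edge_char ends e t \<in> {x \<in> graph_points ends. f x \<in> U}}
      = {t \<in> topspace unit_space. (f \<circ> edge_char ends e) t \<in> U}" for e
      using edge_char_in_points by auto
    have "openin unit_space {t \<in> topspace unit_space. (f \<circ> edge_char ends e) t \<in> U}" for e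
      using f U openin_continuous_map_preimage by blast
    then show "openin (graph_top ends) {x \<in> graph_points ends. f x \<in> U}"
      unfolding openin_graph_top eq by blast
  qed (use f in auto)
qed

lemma graph_points_cases:
  assumes "x \<in> graph_points ends"
  obtains v where "x = Inl v" | e t where "x = Inr (e, t)" "0 < t" "t < 1" "x = edge_char ends e t"
  using assms by (auto simp: graph_points_def)

lemma Inl_in_points [simp]: "Inl v \<in> graph_points ends"
  by (simp add: graph_points_def)

text \<open>Tent functions and barycentric coordinates of vertices separate points.\<close>

lemma graph_separation:
  fixes ends :: "'e \<Rightarrow> 'v \<times> 'v"
  assumes "x \<in> graph_points ends" "y \<in> graph_points ends" "x \<noteq> y"
  shows "\<exists>f. continuous_map (graph_top ends) euclideanreal f \<and> f x \<noteq> f y"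
proof -
  have tent: "\<exists>f. continuous_map (graph_top ends) euclideanreal f \<and> f x \<noteq> f y"
    if "x = Inr (e, t)" "0 < t" "t < 1" "x \<noteq> y" "y \<in> graph_points ends"
    for x y :: "'v + 'e \<times> real" and e t
  proof -
    \<comment> \<open>The tent on the edge: zero at both ends, with value 1 at \<open>t\<close>
      only.\<close>
    define g where "g = (\<lambda>s. min (s / t) ((1 - s) / (1 - t)))"
    define f where "f = (\<lambda>p :: 'v + 'e \<times> real. case p of Inl v \<Rightarrow> 0 | Inr (e', s) \<Rightarrow> if e' = e then g s else 0)"
    have g01: "g 0 = 0" "g 1 = 0" using that by (auto simp: g_def)
    have "(f \<circ> edge_char ends e') s = (if e' = e then g s else 0)" if "s \<in> {0..1}" for e' s
      using that g01 by (cases rule: edge_char_cases[OF that, of ends e']) (auto simp: f_def)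
    moreover have "continuous_map unit_space euclideanreal (\<lambda>s. if e' = e then g s else 0)" for e'
      using that unfolding g_def by (cases "e' = e") (auto intro!: continuous_intros)
    ultimately have "continuous_map unit_space euclideanreal (f \<circ> edge_char ends e')" for e'
      using continuous_map_eq[of unit_space euclideanreal "\<lambda>s. if e' = e then g s else 0" "f \<circ> edge_char ends e'"]
      by auto
    then have "continuous_map (graph_top ends) euclideanreal f" by (simp add: continuous_map_graph_iff)
    moreover have "f x = 1" using that by (simp add: f_def g_def)
    moreover have "f y \<noteq> 1"
      using that(5)
    proof (cases rule: graph_points_cases)
      case (2 e' s)
      show ?thesis
      proof (cases "e' = e")
        case True
        then have "s \<noteq> t" using that 2 by auto
        then have "s / t < 1 \<or> (1 - s) / (1 - t) < 1" using that by (auto simp: field_simps)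
        then show ?thesis using 2 True by (auto simp: f_def g_def min_def)
      qed (use 2 in \<open>auto simp: f_def\<close>)
    qed (auto simp: f_def)
    ultimately show ?thesis by metis
  qed
  from assms(1) show ?thesis
  proof (cases rule: graph_points_cases)
    case (2 e t)
    then show ?thesis using tent[of x e t y] assms by blast
  next
    case (1 v)
    from assms(2) show ?thesis
    proof (cases rule: graph_points_cases)
      case (2 e t)
      then show ?thesis using tent[of y e t x] assms by metis
    next
      case (1 w)
      \<comment> \<open>The barycentric coordinate of \<open>v\<close>. The two summands make it
        constantly 1 on a loop at \<open>v\<close>.\<close>
      define f where "f = (\<lambda>p :: 'v + 'e \<times> real. case p of Inl u \<Rightarrow> if u = v then 1 else 0 | Inr (e', s) \<Rightarrow>
        (if fst (ends e') = v then 1 - s else 0) + (if snd (ends e') = v then s else (0::real)))"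
      have eq: "(f \<circ> edge_char ends e') s =
        (if fst (ends e') = v then 1 - s else 0) + (if snd (ends e') = v then s else (0::real))"
        if "s \<in> {0..1}" for e' s
        using that by (cases rule: edge_char_cases[OF that, of ends e']) (auto simp: f_def)
      have "continuous_map unit_space euclideanreal (\<lambda>s.
        (if fst (ends e') = v then 1 - s else 0) + (if snd (ends e') = v then s else (0::real)))" for e'
        by (cases "fst (ends e') = v"; cases "snd (ends e') = v") (auto intro!: continuous_intros)
      then have "continuous_map unit_space euclideanreal (f \<circ> edge_char ends e')" for e'
        by (rule continuous_map_eq) (use eq in simp)
      then have "continuous_map (graph_top ends) euclideanreal f" by (simp add: continuous_map_graph_iff)
      moreover have "f x \<noteq> f y" using \<open>x = Inl v\<close> 1 assms by (auto simp: f_def)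
      ultimately show ?thesis by blast
    qed
  qed
qed

lemma Hausdorff_graph_top: "Hausdorff_space (graph_top ends)"
  unfolding Hausdorff_space_def topspace_graph_top
proof (intro allI impI)
  fix x y assume "x \<in> graph_points ends \<and> y \<in> graph_points ends \<and> x \<noteq> y"
  then obtain f where f: "continuous_map (graph_top ends) euclideanreal f" "f x \<noteq> f y"
    and xy: "x \<in> graph_points ends" "y \<in> graph_points ends"
    using graph_separation by blast
  then obtain U V where UV: "open U" "open V" "f x \<in> U" "f y \<in> V" "U \<inter> V = {}"
    using hausdorff[of "f x" "f y"] by blast
  have "openin (graph_top ends) {p \<in> graph_points ends. f p \<in> W}" if "open W" for W
    using openin_continuous_map_preimage[OF f(1), of W] that by (simp add: topspace_graph_top)
  then show "\<exists>U V. openin (graph_top ends) U \<and> openin (graph_top ends) V \<and> x \<in> U \<and> y \<in> V \<and> disjnt U V"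
    using UV xy by (intro exI[of _ "{p \<in> graph_points ends. f p \<in> U}"] exI[of _ "{p \<in> graph_points ends. f p \<in> V}"])
      (auto simp: disjnt_def)
qed

lemma compactin_closed_edge: "compactin (graph_top ends) (closed_edge ends e)"
  by (rule image_compactin[OF _ continuous_edge_char]) (simp add: compactin_subtopology)

text \<open>The weak topology tests closedness on the closed edges, and these are compact.\<close>

lemma k_space_graph_top: "k_space (graph_top ends)"
  unfolding k_space_def topspace_graph_top
proof (intro allI impI iffI)
  fix S K assume "closedin (graph_top ends) S"
  then show "closedin (subtopology (graph_top ends) K) (K \<inter> S)"
    by (rule closedin_subtopology_Int_closed)
next
  fix S assume S: "S \<subseteq> graph_points ends"
    and K: "\<forall>K. compactin (graph_top ends) K \<longrightarrow> closedin (subtopology (graph_top ends) K) (K \<inter> S)"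
  show "closedin (graph_top ends) S"
    unfolding closedin_graph_top
  proof (intro conjI allI S)
    fix e
    let ?K = "closed_edge ends e"
    have cl: "closedin (graph_top ends) ?K"
      using compactin_imp_closedin[OF Hausdorff_graph_top compactin_closed_edge] .
    have "closedin (subtopology (graph_top ends) ?K) (?K \<inter> S)"
      by (rule K[rule_format, OF compactin_closed_edge])
    from closedin_trans_full[OF this cl] have "closedin (graph_top ends) (?K \<inter> S)" .
    then have "closedin unit_space {t \<in> topspace unit_space. edge_char ends e t \<in> ?K \<inter> S}"
      by (rule closedin_continuous_map_preimage[OF continuous_edge_char])
    moreover have "{t \<in> topspace unit_space. edge_char ends e t \<in> ?K \<inter> S} = {t \<in> {0..1}. edge_char ends e t \<in> S}"
      by auto
    ultimately show "closedin unit_space {t \<in> {0..1}. edge_char ends e t \<in> S}" by simp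
  qed
qed

interpretation graph: mapping_space "graph_top ends"
  by unfold_locales (rule k_space_graph_top, rule Hausdorff_graph_top)

section \<open>Local finiteness, compact sets and ends of a graph\<close>

definition incident :: "('e \<Rightarrow> 'v \<times> 'v) \<Rightarrow> 'v \<Rightarrow> 'e set" where
  "incident ends v = {e. fst (ends e) = v \<or> snd (ends e) = v}"

text \<open>Ensures that closed edges cover the graph, so that maps and homotopies can be handled
  edge by edge.\<close>

definition no_isolated_vertices :: "('e \<Rightarrow> 'v \<times> 'v) \<Rightarrow> bool" where
  "no_isolated_vertices ends \<longleftrightarrow> (\<forall>v. incident ends v \<noteq> {})"

lemma finite_incident: "graph_locally_finite ends \<Longrightarrow> finite (incident ends v)"
  by (simp add: graph_locally_finite_def incident_def)

lemma point_in_closed_edge: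
  assumes "no_isolated_vertices ends" "x \<in> graph_points ends"
  obtains e t where "t \<in> {0..1}" "x = edge_char ends e t"
  using assms(2)
proof (cases rule: graph_points_cases)
  case (1 v)
  obtain e where "fst (ends e) = v \<or> snd (ends e) = v"
    using assms(1) by (auto simp: no_isolated_vertices_def incident_def)
  then show thesis using that[of 0 e] that[of 1 e] 1 by auto
next
  case (2 e t)
  then show thesis using that[of t e] by auto
qed

lemma Inl_in_closed_edge [simp]:
  "Inl v \<in> closed_edge ends e \<longleftrightarrow> v = fst (ends e) \<or> v = snd (ends e)"
proof
  assume "Inl v \<in> closed_edge ends e"
  then obtain t where t: "t \<in> {0..1}" "Inl v = edge_char ends e t" by blast
  then show "v = fst (ends e) \<or> v = snd (ends e)"
    by (cases rule: edge_char_cases[OF t(1), of ends e]) auto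
next
  have "edge_char ends e 0 \<in> closed_edge ends e" "edge_char ends e 1 \<in> closed_edge ends e"
    by (rule imageI, simp)+
  then show "v = fst (ends e) \<or> v = snd (ends e) \<Longrightarrow> Inl v \<in> closed_edge ends e" by auto
qed

lemma Inr_in_closed_edge [simp]:
  "Inr (e', t) \<in> closed_edge ends e \<longleftrightarrow> e' = e \<and> 0 < t \<and> t < 1"
proof
  assume "Inr (e', t) \<in> closed_edge ends e"
  then obtain s where s: "s \<in> {0..1}" "Inr (e', t) = edge_char ends e s" by blast
  then show "e' = e \<and> 0 < t \<and> t < 1"
    by (cases rule: edge_char_cases[OF s(1), of ends e]) auto
next
  assume t: "e' = e \<and> 0 < t \<and> t < 1"
  then have "edge_char ends e t \<in> closed_edge ends e" by (intro imageI) auto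
  then show "Inr (e', t) \<in> closed_edge ends e" using t by simp
qed

definition open_star :: "('e \<Rightarrow> 'v \<times> 'v) \<Rightarrow> 'v \<Rightarrow> ('v + 'e \<times> real) set" where
  "open_star ends v = insert (Inl v) {Inr (e, t) | e t. e \<in> incident ends v \<and> 0 < t \<and> t < 1}"

lemma openin_open_star: "openin (graph_top ends) (open_star ends v)"
  unfolding openin_graph_top
proof (intro conjI allI)
  show "open_star ends v \<subseteq> graph_points ends"
    by (auto simp: open_star_def graph_points_def)
  fix e
  define A where "A = (if fst (ends e) = v then {..<1} else {}) \<union> (if snd (ends e) = v then {0<..} else {} :: real set)"
  have "open A" by (auto simp: A_def)
  have "edge_char ends e t \<in> open_star ends v \<longleftrightarrow> t \<in> A" if "t \<in> {0..1}" for t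
    using that
    by (cases rule: edge_char_cases[OF that, of ends e]) (auto simp: A_def open_star_def incident_def)
  then have "{t \<in> {0..1}. edge_char ends e t \<in> open_star ends v} = {0..1} \<inter> A" by auto
  then show "openin unit_space {t \<in> {0..1}. edge_char ends e t \<in> open_star ends v}"
    using \<open>open A\<close> by (simp add: openin_open_Int)
qed

lemma compactin_subgraph: "finite F \<Longrightarrow> compactin (graph_top ends) (\<Union>e\<in>F. closed_edge ends e)"
  by (intro compactin_Union) (auto simp: compactin_closed_edge)

text \<open>Finitely many open stars of vertices cover \<open>K\<close>, and each star lies in the
  finitely many closed edges at its vertex.\<close>

lemma compact_in_finite_subgraph:
  assumes "graph_locally_finite ends" "no_isolated_vertices ends" "compactin (graph_top ends) K"
  obtains F where "finite F" "K \<subseteq> (\<Union>e\<in>F. closed_edge ends e)"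
proof -
  have "x \<in> \<Union> (range (open_star ends))" if x: "x \<in> graph_points ends" for x
    using x
  proof (cases rule: graph_points_cases)
    case (2 e t)
    then have "x \<in> open_star ends (fst (ends e))" by (auto simp: open_star_def incident_def)
    then show ?thesis by blast
  qed (auto simp: open_star_def)
  then have "K \<subseteq> \<Union> (range (open_star ends))"
    using compactin_subset_topspace[OF assms(3)] by (auto simp: topspace_graph_top)
  then obtain \<F> where F: "finite \<F>" "\<F> \<subseteq> range (open_star ends)" "K \<subseteq> \<Union>\<F>"
    using assms(3) openin_open_star unfolding compactin_def by (metis (no_types, lifting) imageE)
  then obtain V where V: "finite V" "\<F> = open_star ends ` V" by (meson finite_subset_image)
  have star: "open_star ends v \<subseteq> (\<Union>e\<in>incident ends v. closed_edge ends e)" for v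
  proof
    fix x assume "x \<in> open_star ends v"
    then consider "x = Inl v" | e t where "x = edge_char ends e t" "e \<in> incident ends v" "0 < t" "t < 1"
      by (auto simp: open_star_def)
    then show "x \<in> (\<Union>e\<in>incident ends v. closed_edge ends e)"
    proof cases
      case 1
      obtain e where e: "e \<in> incident ends v" using assms(2) by (auto simp: no_isolated_vertices_def)
      then have "x \<in> closed_edge ends e" using 1 by (auto simp: incident_def)
      then show ?thesis using e by blast
    next
      case (2 e t)
      then have "x \<in> closed_edge ends e" by auto
      then show ?thesis using 2 by blast
    qed
  qed
  show thesis
  proof (rule that)
    show "finite (\<Union>v\<in>V. incident ends v)" by (rule finite_UN_I[OF V(1) finite_incident[OF assms(1)]])
    show "K \<subseteq> (\<Union>e\<in>(\<Union>v\<in>V. incident ends v). closed_edge ends e)"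
    proof
      fix x assume "x \<in> K"
      then have "x \<in> \<Union> (open_star ends ` V)" using F(3) V(2) by auto
      then obtain v where v: "v \<in> V" "x \<in> open_star ends v" by blast
      from subsetD[OF star v(2)] obtain e where "e \<in> incident ends v" "x \<in> closed_edge ends e" ..
      with v(1) show "x \<in> (\<Union>e\<in>(\<Union>v\<in>V. incident ends v). closed_edge ends e)"
        by (intro UN_I)
    qed
  qed
qed

text \<open>The point is that every neighbourhood of an end contains a vertex.\<close>

lemma maps_end_to_if_fixes_vertices:
  assumes lf: "graph_locally_finite ends" and ni: "no_isolated_vertices ends"
    and f: "compactly_proper (graph_top ends) (graph_top ends) f"
    and vfix: "\<And>v. f (Inl v) = Inl v" and \<epsilon>: "\<epsilon> \<in> ends_of (graph_top ends)"
  shows "maps_end_to (graph_top ends) f \<epsilon> \<epsilon>"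
  unfolding maps_end_to_def
proof (intro allI impI)
  let ?G = "graph_top ends"
  fix K assume K: "compactin ?G K"
  define K' where "K' = {x \<in> topspace ?G. f x \<in> K}"
  have "compactin ?G (K \<union> K')" unfolding K'_def using compactly_properD(3)[OF f K] K by (simp add: compactin_Un)
  then obtain F where F: "finite F" "K \<union> K' \<subseteq> (\<Union>e\<in>F. closed_edge ends e)"
    using compact_in_finite_subgraph[OF lf ni] by blast
  define V where "V = (\<Union>e\<in>F. {fst (ends e), snd (ends e)})"
  \<comment> \<open>All edges spanned by \<open>V\<close> are added. An edge outside
    \<open>F'\<close> then has an end vertex outside \<open>L\<close>, and a point on it can be
    moved to that vertex without meeting \<open>L\<close>.\<close>
  define F' where "F' = {e. fst (ends e) \<in> V \<and> snd (ends e) \<in> V}"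
  have "finite V" unfolding V_def using F by auto
  moreover have "F' \<subseteq> (\<Union>v\<in>V. incident ends v)" by (auto simp: F'_def incident_def)
  ultimately have "finite F'" using finite_incident[OF lf] by (meson finite_UN finite_subset)
  define L where "L = (\<Union>e\<in>F'. closed_edge ends e)"
  have L: "compactin ?G L" unfolding L_def using \<open>finite F'\<close> by (rule compactin_subgraph)
  have "F \<subseteq> F'" by (auto simp: F'_def V_def)
  then have KL: "K \<union> K' \<subseteq> L" using F unfolding L_def by blast
  have L_vertex: "v \<in> V" if "Inl v \<in> L" for v
    using that by (auto simp: L_def F'_def)
  have L_edge: "e \<in> F'" if "Inr (e, t) \<in> L" for e t
    using that by (auto simp: L_def)
  obtain x where x: "x \<in> \<epsilon> L" using graph.end_connected(3)[OF \<epsilon> L] by blast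
  then have xL: "x \<in> graph_points ends" "x \<notin> L"
    using graph.end_connected(2)[OF \<epsilon> L] by (auto simp: topspace_graph_top)
  have "\<exists>v. Inl v \<in> \<epsilon> L"
    using xL(1)
  proof (cases rule: graph_points_cases)
    case (1 v)
    then show ?thesis using x by blast
  next
    case (2 e t)
    have "e \<notin> F'" using xL(2) 2 unfolding L_def by auto
    have conn: "edge_char ends e ` I \<subseteq> \<epsilon> L"
      if I: "connected I" "I \<subseteq> {0..1}" "t \<in> I" "\<And>v. Inl v \<in> edge_char ends e ` I \<Longrightarrow> v \<notin> V" for I
    proof (rule graph.end_absorbs[OF \<epsilon> L])
      show "connectedin ?G (edge_char ends e ` I)"
        using I by (intro connectedin_continuous_map_image[OF continuous_edge_char])
          (simp add: connectedin_subtopology)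
      show "edge_char ends e ` I \<inter> L = {}"
      proof (rule ccontr)
        assume "edge_char ends e ` I \<inter> L \<noteq> {}"
        then obtain s where s: "s \<in> I" "edge_char ends e s \<in> L" by blast
        then have "s \<in> {0..1}" using I by blast
        then show False
        proof (cases rule: edge_char_cases[of s ends e])
          case 3
          then show False using s L_edge \<open>e \<notin> F'\<close> by metis
        qed (use s L_vertex I(4) in \<open>metis imageI\<close>)+
      qed
      show "edge_char ends e ` I \<inter> \<epsilon> L \<noteq> {}" using x 2 I by auto
    qed
    from \<open>e \<notin> F'\<close> consider "fst (ends e) \<notin> V" | "snd (ends e) \<notin> V" by (auto simp: F'_def)
    then show ?thesis
    proof cases
      case 1
      have "edge_char ends e ` {0..t} \<subseteq> \<epsilon> L"
      proof (rule conn)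
        fix v assume "Inl v \<in> edge_char ends e ` {0..t}"
        then obtain s where s: "Inl v = edge_char ends e s" "s \<in> {0..1}" "s < 1" using 2 by auto
        then show "v \<notin> V" using 1 by (cases rule: edge_char_cases[OF s(2), of ends e]) auto
      qed (use 2 in auto)
      moreover have "Inl (fst (ends e)) \<in> edge_char ends e ` {0..t}"
        using 2 by (intro image_eqI[of _ _ 0]) auto
      ultimately show ?thesis by blast
    next
      case far: 2
      have "edge_char ends e ` {t..1} \<subseteq> \<epsilon> L"
      proof (rule conn)
        fix v assume "Inl v \<in> edge_char ends e ` {t..1}"
        then obtain s where s: "Inl v = edge_char ends e s" "s \<in> {0..1}" "0 < s" using 2 by auto
        then show "v \<notin> V" using far by (cases rule: edge_char_cases[OF s(2), of ends e]) auto
      qed (use 2 in auto)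
      moreover have "Inl (snd (ends e)) \<in> edge_char ends e ` {t..1}"
        using 2 by (intro image_eqI[of _ _ 1]) auto
      ultimately show ?thesis by blast
    qed
  qed
  then obtain v where v: "Inl v \<in> \<epsilon> L" by blast
  have "f ` \<epsilon> L \<subseteq> \<epsilon> K"
  proof (rule graph.end_absorbs[OF \<epsilon> K])
    show "connectedin ?G (f ` \<epsilon> L)"
      using connectedin_continuous_map_image[OF compactly_properD(1)[OF f] graph.end_connected(1)[OF \<epsilon> L]] .
    show "f ` \<epsilon> L \<inter> K = {}"
      using graph.end_connected(2)[OF \<epsilon> L] KL by (auto simp: K'_def)
    have "Inl v \<in> \<epsilon> K" using graph.end_antimono[OF \<epsilon> K L] KL v by blast
    then show "f ` \<epsilon> L \<inter> \<epsilon> K \<noteq> {}" using v vfix[of v] by (metis disjoint_iff imageI)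
  qed
  then show "\<exists>L. compactin ?G L \<and> f ` \<epsilon> L \<subseteq> \<epsilon> K" using L by blast
qed

lemma compactly_properI:
  assumes "continuous_map S Y f" "Hausdorff_space Y"
    and "\<And>K. compactin Y K \<Longrightarrow> \<exists>L. compactin S L \<and> {x \<in> topspace S. f x \<in> K} \<subseteq> L"
  shows "compactly_proper S Y f"
  unfolding compactly_proper_def
proof (intro conjI allI impI assms(1))
  fix K assume K: "compactin Y K"
  then obtain L where L: "compactin S L" "{x \<in> topspace S. f x \<in> K} \<subseteq> L" using assms(3) by blast
  have "closedin S {x \<in> topspace S. f x \<in> K}"
    using closedin_continuous_map_preimage[OF assms(1) compactin_imp_closedin[OF assms(2) K]] .
  with L show "compactin S {x \<in> topspace S. f x \<in> K}" by (rule closed_compactin)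
qed

text \<open>Compact sets lie in finite subgraphs on both sides, so properness becomes a count: each
  target edge is reached by the tracks of finitely many source edges. The next lemma is the same for
  maps.\<close>

lemma compactly_proper_graph_homotopy:
  assumes "graph_locally_finite ends'" "no_isolated_vertices ends'" "no_isolated_vertices ends"
    and c: "continuous_map (prod_topology unit_space (graph_top ends)) (graph_top ends') H"
    and fin: "\<And>e'. finite {e. \<exists>s\<in>{0..1}. \<exists>t\<in>{0..1}. H (s, edge_char ends e t) \<in> closed_edge ends' e'}"
  shows "compactly_proper (prod_topology unit_space (graph_top ends)) (graph_top ends') H"
proof (rule compactly_properI[OF c Hausdorff_graph_top])
  fix K assume K: "compactin (graph_top ends') K"
  then obtain F' where F': "finite F'" "K \<subseteq> (\<Union>e\<in>F'. closed_edge ends' e)"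
    using compact_in_finite_subgraph[OF assms(1,2)] by blast
  define F where "F = (\<Union>e'\<in>F'. {e. \<exists>s\<in>{0..1}. \<exists>t\<in>{0..1}. H (s, edge_char ends e t) \<in> closed_edge ends' e'})"
  have "finite F" unfolding F_def using F' fin by blast
  then have "compactin (prod_topology unit_space (graph_top ends)) ({0..1} \<times> (\<Union>e\<in>F. closed_edge ends e))"
    using compactin_subgraph by (auto simp: compactin_Times compactin_subtopology)
  moreover have "z \<in> {0..1} \<times> (\<Union>e\<in>F. closed_edge ends e)"
    if z: "z \<in> topspace (prod_topology unit_space (graph_top ends))" "H z \<in> K" for z
  proof -
    obtain s x where sx: "z = (s, x)" "s \<in> {0..1}" "x \<in> graph_points ends"
      using z(1) by (auto simp: topspace_graph_top)
    obtain e t where et: "t \<in> {0..1}" "x = edge_char ends e t"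
      using point_in_closed_edge[OF assms(3) sx(3)] by blast
    obtain e' where e': "e' \<in> F'" "H z \<in> closed_edge ends' e'" using z(2) F' by blast
    then have "H (s, edge_char ends e t) \<in> closed_edge ends' e'" using sx et by simp
    then have "e \<in> F" unfolding F_def using e'(1) sx(2) et(1) by blast
    then show ?thesis using sx et by blast
  qed
  ultimately show "\<exists>L. compactin (prod_topology unit_space (graph_top ends)) L \<and>
      {z \<in> topspace (prod_topology unit_space (graph_top ends)). H z \<in> K} \<subseteq> L"
    by (metis (mono_tags, lifting) mem_Collect_eq subsetI)
qed

lemma compactly_proper_graph_map:
  assumes "graph_locally_finite ends'" "no_isolated_vertices ends'" "no_isolated_vertices ends"
    and c: "continuous_map (graph_top ends) (graph_top ends') f"
    and fin: "\<And>e'. finite {e. \<exists>t\<in>{0..1}. f (edge_char ends e t) \<in> closed_edge ends' e'}"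
  shows "compactly_proper (graph_top ends) (graph_top ends') f"
proof (rule compactly_properI[OF c Hausdorff_graph_top])
  fix K assume K: "compactin (graph_top ends') K"
  then obtain F' where F': "finite F'" "K \<subseteq> (\<Union>e\<in>F'. closed_edge ends' e)"
    using compact_in_finite_subgraph[OF assms(1,2)] by blast
  define F where "F = (\<Union>e'\<in>F'. {e. \<exists>t\<in>{0..1}. f (edge_char ends e t) \<in> closed_edge ends' e'})"
  have "finite F" unfolding F_def using F' fin by blast
  then have "compactin (graph_top ends) (\<Union>e\<in>F. closed_edge ends e)" by (rule compactin_subgraph)
  moreover have "x \<in> (\<Union>e\<in>F. closed_edge ends e)" if x: "x \<in> graph_points ends" "f x \<in> K" for x
  proof -
    obtain e t where et: "t \<in> {0..1}" "x = edge_char ends e t"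
      using point_in_closed_edge[OF assms(3) x(1)] by blast
    obtain e' where e': "e' \<in> F'" "f x \<in> closed_edge ends' e'" using x(2) F' by blast
    then have "e \<in> F" unfolding F_def using et by blast
    then show ?thesis using et by blast
  qed
  ultimately show "\<exists>L. compactin (graph_top ends) L \<and> {x \<in> topspace (graph_top ends). f x \<in> K} \<subseteq> L"
    by (metis (mono_tags, lifting) mem_Collect_eq subsetI topspace_graph_top)
qed

section \<open>Homotopies on graphs\<close>

abbreviation edge_sum :: "('e \<times> real) topology" where
  "edge_sum \<equiv> prod_topology (discrete_topology UNIV) unit_space"

lemma openin_edge_sum:
  fixes W :: "('e \<times> real) set"
  shows "openin edge_sum W \<longleftrightarrow> (\<forall>e. openin unit_space {t. (e, t) \<in> W})"
proof
  assume W: "openin edge_sum W"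
  show "\<forall>e. openin unit_space {t. (e, t) \<in> W}"
  proof
    fix e :: 'e
    have "continuous_map unit_space edge_sum (\<lambda>t. (e, t))" by (simp add: continuous_map_paired)
    from openin_continuous_map_preimage[OF this W]
    have "openin unit_space {t \<in> topspace unit_space. (e, t) \<in> W}" .
    moreover have "{t \<in> topspace unit_space. (e, t) \<in> W} = {t. (e, t) \<in> W}"
      using openin_subset[OF W] by auto
    ultimately show "openin unit_space {t. (e, t) \<in> W}" by simp
  qed
next
  assume W: "\<forall>e. openin unit_space {t. (e, t) \<in> W}"
  have "W = (\<Union>e. {e} \<times> {t. (e, t) \<in> W})" by auto
  moreover have "openin edge_sum (\<Union>e. {e} \<times> {t. (e, t) \<in> W})"
    using W by (intro openin_Union) (auto simp: openin_prod_Times_iff)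
  ultimately show "openin edge_sum W" by simp
qed

lemma quotient_edge_char:
  assumes "no_isolated_vertices ends"
  shows "quotient_map edge_sum (graph_top ends) (\<lambda>(e, t). edge_char ends e t)"
  unfolding quotient_map_def
proof (intro conjI allI impI)
  show "(\<lambda>(e, t). edge_char ends e t) ` topspace edge_sum = topspace (graph_top ends)"
  proof
    show "(\<lambda>(e, t). edge_char ends e t) ` topspace edge_sum \<subseteq> topspace (graph_top ends)"
      using edge_char_in_points by (auto simp: topspace_graph_top)
    show "topspace (graph_top ends) \<subseteq> (\<lambda>(e, t). edge_char ends e t) ` topspace edge_sum"
      unfolding topspace_graph_top
    proof
      fix x assume "x \<in> graph_points ends"
      then obtain e t where "t \<in> {0..1}" "x = edge_char ends e t"
        using point_in_closed_edge[OF assms] by blast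
      then show "x \<in> (\<lambda>(e, t). edge_char ends e t) ` topspace edge_sum"
        by (intro image_eqI[of _ _ "(e, t)"]) auto
    qed
  qed
  fix U assume "U \<subseteq> topspace (graph_top ends)"
  then show "openin edge_sum {x \<in> topspace edge_sum. (case x of (e, t) \<Rightarrow> edge_char ends e t) \<in> U} =
      openin (graph_top ends) U"
    unfolding openin_edge_sum openin_graph_top topspace_graph_top by auto
qed

text \<open>The graph is a quotient of the disjoint union of its edges, and the product of this
  quotient map with the locally compact Hausdorff interval is again a quotient map; this is what
  justifies checking a homotopy edge by edge. The open set \<open>U\<close> serves the charts used
  for the fundamental group.\<close>

lemma continuous_map_edgewise_homotopy:
  assumes ni: "no_isolated_vertices ends" and U: "openin (graph_top ends) U"
    and maps: "\<And>s x. s \<in> {0..1} \<Longrightarrow> x \<in> U \<Longrightarrow> H (s, x) \<in> topspace Y"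
    and edge: "\<And>e. continuous_map
      (prod_topology unit_space (top_of_set {t \<in> {0..1}. edge_char ends e t \<in> U})) Y
      (\<lambda>(s, t). H (s, edge_char ends e t))"
  shows "continuous_map (prod_topology unit_space (subtopology (graph_top ends) U)) Y H"
proof -
  define q where "q = (\<lambda>(e, t). edge_char ends e t)"
  define S where "S = {x \<in> topspace edge_sum. q x \<in> U}"
  have "quotient_map (subtopology edge_sum S) (subtopology (graph_top ends) U) q"
    by (rule quotient_map_restriction[OF quotient_edge_char[OF ni, folded q_def]])
      (use U in \<open>auto simp: S_def\<close>)
  then have quo: "quotient_map (prod_topology unit_space (subtopology edge_sum S))
      (prod_topology unit_space (subtopology (graph_top ends) U)) (\<lambda>(x, y). (x, q y))"
    by (intro quotient_map_prod_right)
      (auto simp: Hausdorff_space_subtopology compact_imp_locally_compact_space compact_space_subtopology compactin_subtopology)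
  have "continuous_map (prod_topology unit_space (subtopology edge_sum S)) Y (H \<circ> (\<lambda>(x, y). (x, q y)))"
    unfolding continuous_map_def
  proof (intro conjI allI impI)
    show "H \<circ> (\<lambda>(x, y). (x, q y)) \<in> topspace (prod_topology unit_space (subtopology edge_sum S)) \<rightarrow> topspace Y"
      using maps by (auto simp: S_def)
    fix W assume W: "openin Y W"
    let ?P = "{z \<in> topspace (prod_topology unit_space (subtopology edge_sum S)). (H \<circ> (\<lambda>(x, y). (x, q y))) z \<in> W}"
    show "openin (prod_topology unit_space (subtopology edge_sum S)) ?P"
    proof (subst openin_subopen, intro ballI)
      fix z assume "z \<in> ?P"
      then obtain s e t where z: "z = (s, (e, t))" "s \<in> {0..1}" "t \<in> {0..1}" "(e, t) \<in> S"
        "H (s, edge_char ends e t) \<in> W"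
        by (auto simp: q_def)
      let ?I = "{t \<in> {0..1}. edge_char ends e t \<in> U}"
      define Q where "Q = {x \<in> topspace (prod_topology unit_space (top_of_set ?I)).
        (case x of (s, t) \<Rightarrow> H (s, edge_char ends e t)) \<in> W}"
      have Q: "openin (prod_topology unit_space (top_of_set ?I)) Q"
        unfolding Q_def by (rule openin_continuous_map_preimage[OF edge W])
      have "(s, t) \<in> Q" using z by (auto simp: Q_def S_def q_def)
      from Q[unfolded openin_prod_topology_alt, rule_format, OF this]
      obtain A B where AB: "openin unit_space A" "openin (top_of_set ?I) B" "s \<in> A" "t \<in> B"
        "A \<times> B \<subseteq> Q"
        by (elim exE conjE)
      obtain B' where B': "open B'" "B = ?I \<inter> B'" using AB(2) by (auto simp: openin_open)
      have "openin edge_sum ({e} \<times> ({0..1} \<inter> B'))"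
        using B' by (simp add: openin_prod_Times_iff openin_open_Int)
      then have "openin (subtopology edge_sum S) (({e} \<times> ({0..1} \<inter> B')) \<inter> S)"
        by (rule openin_subtopology_Int)
      then have "openin (prod_topology unit_space (subtopology edge_sum S)) (A \<times> (({e} \<times> ({0..1} \<inter> B')) \<inter> S))"
        using AB(1) by (simp add: openin_prod_Times_iff)
      moreover have "z \<in> A \<times> (({e} \<times> ({0..1} \<inter> B')) \<inter> S)" using z AB B' by auto
      moreover have "A \<times> (({e} \<times> ({0..1} \<inter> B')) \<inter> S) \<subseteq> ?P"
      proof
        fix y assume y: "y \<in> A \<times> (({e} \<times> ({0..1} \<inter> B')) \<inter> S)"
        then obtain s' t' where y': "y = (s', (e, t'))" "s' \<in> A" "t' \<in> {0..1}" "t' \<in> B'" "(e, t') \<in> S" by auto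
        then have "t' \<in> B" unfolding B' by (auto simp: S_def q_def)
        then have "(s', t') \<in> A \<times> B" using y' by blast
        then have "s' \<in> {0..1} \<and> H (s', edge_char ends e t') \<in> W" using AB(5) by (auto simp: Q_def)
        then show "y \<in> ?P" using y' by (auto simp: q_def)
      qed
      ultimately show "\<exists>V. openin (prod_topology unit_space (subtopology edge_sum S)) V \<and> z \<in> V \<and> V \<subseteq> ?P"
        by blast
    qed
  qed
  then show ?thesis
    using continuous_compose_quotient_map[OF quo] by blast
qed

lemma continuous_map_graph_homotopy:
  assumes ni: "no_isolated_vertices ends"
    and maps: "\<And>s x. s \<in> {0..1} \<Longrightarrow> x \<in> graph_points ends \<Longrightarrow> H (s, x) \<in> topspace Y"
    and edge: "\<And>e. continuous_map (prod_topology unit_space unit_space) Y (\<lambda>(s, t). H (s, edge_char ends e t))"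
  shows "continuous_map (prod_topology unit_space (graph_top ends)) Y H"
proof -
  have "{t \<in> {0..1}. edge_char ends e t \<in> graph_points ends} = {0..1}" for e
    using edge_char_in_points by auto
  then have "continuous_map (prod_topology unit_space (subtopology (graph_top ends) (graph_points ends))) Y H"
    using assms openin_topspace[of "graph_top ends"]
    by (intro continuous_map_edgewise_homotopy[OF ni]) (auto simp: topspace_graph_top)
  then show ?thesis by (metis subtopology_topspace topspace_graph_top)
qed

section \<open>Sliding edges\<close>

lemma continuous_map_glue:
  fixes a b c :: real
  assumes f: "continuous_map (top_of_set {a..b}) Y f" and g: "continuous_map (top_of_set {b..c}) Y g"
    and "f b = g b"
  shows "continuous_map (top_of_set {a..c}) Y (\<lambda>t. if t \<le> b then f t else g t)"
proof (rule continuous_map_cases_le)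
  have "continuous_map (subtopology (top_of_set {a..b}) {a..c}) Y f"
    using f by (rule continuous_map_from_subtopology)
  moreover have "subtopology (top_of_set {a..c}) {x \<in> topspace (top_of_set {a..c}). x \<le> b}
      = subtopology (top_of_set {a..b}) {a..c}"
    by (auto simp: subtopology_subtopology intro!: arg_cong[where f = "subtopology euclidean"])
  ultimately show "continuous_map (subtopology (top_of_set {a..c}) {x \<in> topspace (top_of_set {a..c}). x \<le> b}) Y f"
    by simp
  have "continuous_map (subtopology (top_of_set {b..c}) {a..c}) Y g"
    using g by (rule continuous_map_from_subtopology)
  moreover have "subtopology (top_of_set {a..c}) {x \<in> topspace (top_of_set {a..c}). b \<le> x}
      = subtopology (top_of_set {b..c}) {a..c}"
    by (auto simp: subtopology_subtopology intro!: arg_cong[where f = "subtopology euclidean"])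
  ultimately show "continuous_map (subtopology (top_of_set {a..c}) {x \<in> topspace (top_of_set {a..c}). b \<le> x}) Y g"
    by simp
  show "continuous_map (top_of_set {a..c}) euclideanreal (\<lambda>t. t)"
    "continuous_map (top_of_set {a..c}) euclideanreal (\<lambda>t. b)" by auto
qed (use assms in auto)

lemma continuous_map_reparam:
  assumes f: "continuous_map (top_of_set T) Y f" and g: "continuous_on S g" "g ` S \<subseteq> T"
  shows "continuous_map (top_of_set S) Y (\<lambda>t. f (g t))"
proof -
  have "continuous_map (top_of_set S) (top_of_set T) g"
    using g by (auto simp: continuous_map_in_subtopology)
  from continuous_map_compose[OF this f] show ?thesis by (simp add: o_def)
qed

text \<open>The detour replacing a slid edge: along \<open>P\<close> to the old start, across the
  edge, along \<open>Q\<close> to the new end. It has length 3, which is the factor in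
  \<open>slide_map\<close>.\<close>

definition slide_path ::
  "('e \<Rightarrow> 'v \<times> 'v) \<Rightarrow> ('e \<Rightarrow> real \<Rightarrow> 'v + 'e \<times> real) \<Rightarrow> ('e \<Rightarrow> real \<Rightarrow> 'v + 'e \<times> real) \<Rightarrow>
   'e \<Rightarrow> real \<Rightarrow> 'v + 'e \<times> real" where
  "slide_path ends P Q e y =
     (if y \<le> 1 then P e y else if y \<le> 2 then edge_char ends e (y - 1) else Q e (y - 2))"

lemma slide_path_continuous:
  assumes P: "continuous_map unit_space (graph_top ends) (P e)"
    and Q: "continuous_map unit_space (graph_top ends) (Q e)"
    and "P e 1 = Inl (fst (ends e))" "Q e 0 = Inl (snd (ends e))"
  shows "continuous_map (top_of_set {0..3}) (graph_top ends) (slide_path ends P Q e)"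
proof -
  have edge: "continuous_map (top_of_set {1..2}) (graph_top ends) (\<lambda>y. edge_char ends e (y - 1))"
    by (rule continuous_map_reparam[OF continuous_edge_char]) (auto intro!: continuous_intros)
  have Q': "continuous_map (top_of_set {2..3}) (graph_top ends) (\<lambda>y. Q e (y - 2))"
    by (rule continuous_map_reparam[OF Q]) (auto intro!: continuous_intros)
  have "continuous_map (top_of_set {1..3}) (graph_top ends)
      (\<lambda>y. if y \<le> 2 then edge_char ends e (y - 1) else Q e (y - 2))"
    by (rule continuous_map_glue[OF edge Q']) (simp add: assms)
  from continuous_map_glue[OF P this] show ?thesis
    unfolding slide_path_def by (simp add: assms)
qed

definition slide_map ::
  "('e \<Rightarrow> 'v \<times> 'v) \<Rightarrow> 'e set \<Rightarrow> ('e \<Rightarrow> real \<Rightarrow> 'v + 'e \<times> real) \<Rightarrow> ('e \<Rightarrow> real \<Rightarrow> 'v + 'e \<times> real) \<Rightarrow>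
   'v + 'e \<times> real \<Rightarrow> 'v + 'e \<times> real" where
  "slide_map ends B P Q p = (case p of Inl v \<Rightarrow> Inl v
     | Inr (e, t) \<Rightarrow> if e \<in> B then slide_path ends P Q e (3 * t) else Inr (e, t))"

text \<open>Two graphs differing only in the endpoints of the edges in \<open>B\<close>, which are moved along paths
  \<open>P e\<close>, \<open>Q e\<close> through the edges \<open>F e\<close> outside \<open>B\<close>. The situation is symmetric in the two graphs.\<close>

locale edge_slide =
  fixes ends ends' :: "'e \<Rightarrow> 'v \<times> 'v" and B :: "'e set"
    and P Q :: "'e \<Rightarrow> real \<Rightarrow> 'v + 'e \<times> real" and F :: "'e \<Rightarrow> 'e set"
  assumes lf: "graph_locally_finite ends" and lf': "graph_locally_finite ends'"
    and ni: "no_isolated_vertices ends" and ni': "no_isolated_vertices ends'"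
    and same: "\<And>e. e \<notin> B \<Longrightarrow> ends' e = ends e"
    and P_ends: "\<And>e. e \<in> B \<Longrightarrow> P e 0 = Inl (fst (ends' e))" "\<And>e. e \<in> B \<Longrightarrow> P e 1 = Inl (fst (ends e))"
    and Q_ends: "\<And>e. e \<in> B \<Longrightarrow> Q e 0 = Inl (snd (ends e))" "\<And>e. e \<in> B \<Longrightarrow> Q e 1 = Inl (snd (ends' e))"
    and P_cont: "\<And>e. e \<in> B \<Longrightarrow> continuous_map unit_space (graph_top ends) (P e)"
      "\<And>e. e \<in> B \<Longrightarrow> continuous_map unit_space (graph_top ends') (P e)"
    and Q_cont: "\<And>e. e \<in> B \<Longrightarrow> continuous_map unit_space (graph_top ends) (Q e)"
      "\<And>e. e \<in> B \<Longrightarrow> continuous_map unit_space (graph_top ends') (Q e)"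
    and support: "\<And>e. F e \<inter> B = {}"
      "\<And>e t. e \<in> B \<Longrightarrow> t \<in> {0..1} \<Longrightarrow> P e t \<in> (\<Union>f\<in>F e. closed_edge ends f)"
      "\<And>e t. e \<in> B \<Longrightarrow> t \<in> {0..1} \<Longrightarrow> Q e t \<in> (\<Union>f\<in>F e. closed_edge ends f)"
    and finite_support: "\<And>f. finite {e \<in> B. f \<in> F e}"
begin

abbreviation "\<phi> \<equiv> slide_path ends P Q"
abbreviation "\<beta> \<equiv> slide_map ends B P Q"
abbreviation "\<psi> \<equiv> slide_path ends' (\<lambda>e t. P e (1 - t)) (\<lambda>e t. Q e (1 - t))"
abbreviation "\<alpha> \<equiv> slide_map ends' B (\<lambda>e t. P e (1 - t)) (\<lambda>e t. Q e (1 - t))"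

lemma same_edge_char: "e \<notin> B \<Longrightarrow> edge_char ends' e t = edge_char ends e t"
  by (simp add: edge_char_def same)

text \<open>Exchanging the graphs and reversing the paths turns \<open>\<beta>\<close> into
  \<open>\<alpha>\<close>, so every fact about \<open>\<beta>\<close> is also one about
  \<open>\<alpha>\<close>.\<close>

lemma dual: "edge_slide ends' ends B (\<lambda>e t. P e (1 - t)) (\<lambda>e t. Q e (1 - t)) F"
proof (unfold_locales)
  fix e t assume e: "e \<in> B"
  have r: "continuous_on {0..1} (\<lambda>t :: real. 1 - t)" "(\<lambda>t. 1 - t) ` {0..1} \<subseteq> {0..1 :: real}"
    by (auto intro!: continuous_intros)
  show "continuous_map unit_space (graph_top ends') (\<lambda>t. P e (1 - t))"
    "continuous_map unit_space (graph_top ends) (\<lambda>t. P e (1 - t))"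
    "continuous_map unit_space (graph_top ends') (\<lambda>t. Q e (1 - t))"
    "continuous_map unit_space (graph_top ends) (\<lambda>t. Q e (1 - t))"
    using continuous_map_reparam[OF P_cont(1)[OF e] r] continuous_map_reparam[OF P_cont(2)[OF e] r]
      continuous_map_reparam[OF Q_cont(1)[OF e] r] continuous_map_reparam[OF Q_cont(2)[OF e] r] by auto
  have eq: "(\<Union>f\<in>F e. closed_edge ends' f) = (\<Union>f\<in>F e. closed_edge ends f)"
    using support(1)[of e] same_edge_char by (intro SUP_cong image_cong) auto
  assume "t \<in> {0..1 :: real}"
  then have "1 - t \<in> {0..1}" by auto
  then show "P e (1 - t) \<in> (\<Union>f\<in>F e. closed_edge ends' f)"
    "Q e (1 - t) \<in> (\<Union>f\<in>F e. closed_edge ends' f)"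
    unfolding eq using support(2,3)[OF e] by blast+
qed (use lf lf' ni ni' same P_ends Q_ends support(1) finite_support in auto)

lemma \<beta>_Inl [simp]: "\<beta> (Inl v) = Inl v"
  by (simp add: slide_map_def)

lemma \<beta>_edge_char:
  assumes "t \<in> {0..1}"
  shows "\<beta> (edge_char ends' e t) = (if e \<in> B then \<phi> e (3 * t) else edge_char ends e t)"
  using assms
  by (cases rule: edge_char_cases[OF assms, of ends' e])
    (auto simp: slide_map_def slide_path_def P_ends Q_ends same)

lemma \<phi>_continuous:
  "e \<in> B \<Longrightarrow> continuous_map (top_of_set {0..3}) (graph_top ends) (\<phi> e)"
  by (intro slide_path_continuous P_cont Q_cont P_ends Q_ends)

lemma \<beta>_fixes: "f \<notin> B \<Longrightarrow> p \<in> closed_edge ends f \<Longrightarrow> \<beta> p = p"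
proof -
  assume f: "f \<notin> B" "p \<in> closed_edge ends f"
  then obtain t where t: "t \<in> {0..1}" "p = edge_char ends f t" by blast
  then have "\<beta> p = \<beta> (edge_char ends' f t)" using same_edge_char[OF f(1)] by simp
  also have "\<dots> = p" using \<beta>_edge_char[OF t(1), of f] f(1) t(2) by simp
  finally show "\<beta> p = p" .
qed

lemma \<beta>_fixes_paths:
  assumes "e \<in> B" "t \<in> {0..1}"
  shows "\<beta> (P e t) = P e t" "\<beta> (Q e t) = Q e t"
  using support(1)[of e] support(2,3)[OF assms] \<beta>_fixes by blast+

text \<open>On [0,1], [1,2], [2,3] this is \<open>1 - y\<close>, \<open>3 * (y - 1)\<close>,
  \<open>5 - y\<close>. After sliding there and back, an edge runs back along \<open>P\<close>, over
  the whole detour, and back along \<open>Q\<close>; its ends 1 and 2 are the positions of the ends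
  of the edge on the detour.\<close>

definition zigzag :: "real \<Rightarrow> real" where
  "zigzag y = max (1 - y) (min (3 * (y - 1)) (5 - y))"

lemma \<beta>_\<psi>:
  assumes "e \<in> B" "y \<in> {0..3}"
  shows "\<beta> (\<psi> e y) = \<phi> e (zigzag y)"
proof -
  consider "y \<le> 1" | "1 < y" "y \<le> 2" | "2 < y" by linarith
  then show ?thesis
  proof cases
    case 1
    then have "zigzag y = 1 - y" by (auto simp: zigzag_def)
    then show ?thesis using 1 assms by (simp add: slide_path_def \<beta>_fixes_paths)
  next
    case 2
    then have "zigzag y = 3 * (y - 1)" by (auto simp: zigzag_def)
    then show ?thesis using 2 assms \<beta>_edge_char[of "y - 1" e] by (simp add: slide_path_def[of ends'])
  next
    case 3
    then have z: "zigzag y = 5 - y" by (auto simp: zigzag_def)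
    show ?thesis
    proof (cases "y = 3")
      \<comment> \<open>The position is 2, which \<open>\<phi>\<close> evaluates on the edge and not
        on \<open>Q\<close>; both give the end vertex.\<close>
      case True
      then show ?thesis using z assms by (simp add: slide_path_def Q_ends)
    next
      case False
      then show ?thesis using 3 assms z by (simp add: slide_path_def \<beta>_fixes_paths)
    qed
  qed
qed

definition meeting :: "'e \<Rightarrow> 'e set" where
  "meeting e' = {e. closed_edge ends e \<inter> closed_edge ends e' \<noteq> {}}"

lemma finite_meeting: "finite (meeting e')"
proof -
  have "e \<in> incident ends (fst (ends e')) \<union> incident ends (snd (ends e')) \<union> {e'}"
    if meet: "e \<in> meeting e'" for e
  proof -
    obtain x where "x \<in> closed_edge ends e" "x \<in> closed_edge ends e'"
      using meet unfolding meeting_def by blast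
    then obtain t where t: "t \<in> {0..1}" "edge_char ends e t \<in> closed_edge ends e'" by blast
    then show ?thesis
      by (cases rule: edge_char_cases[OF t(1), of ends e]) (auto simp: incident_def)
  qed
  then show ?thesis
    by (rule finite_subset[OF subsetI]) (simp_all add: finite_incident lf)
qed

lemma \<phi>_in: 
  assumes "e \<in> B" "y \<in> {0..3}"
  shows "\<phi> e y \<in> closed_edge ends e \<union> (\<Union>f\<in>F e. closed_edge ends f)"
proof -
  consider "y \<le> 1" | "1 < y" "y \<le> 2" | "2 < y" by linarith
  then show ?thesis
    using support(2)[OF assms(1), of y] support(3)[OF assms(1), of "y - 2"] assms
    by cases (auto simp: slide_path_def)
qed

lemma finite_near:
  "finite (meeting e' \<union> (\<Union>f\<in>meeting e'. {e \<in> B. f \<in> F e}))"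
  using finite_meeting finite_support by blast

text \<open>An edge whose detour meets \<open>e'\<close> touches \<open>e'\<close> itself or is slid
  through an edge touching \<open>e'\<close>. Local finiteness and \<open>finite_support\<close>
  leave finitely many such edges.\<close>

lemma \<phi>_near:
  assumes "e \<in> B" "y \<in> {0..3}" "\<phi> e y \<in> closed_edge ends e'"
  shows "e \<in> meeting e' \<union> (\<Union>f\<in>meeting e'. {e \<in> B. f \<in> F e})"
proof -
  consider "\<phi> e y \<in> closed_edge ends e" | f where "f \<in> F e" "\<phi> e y \<in> closed_edge ends f"
    using \<phi>_in[OF assms(1,2)] by (elim UnE UN_E)
  then show ?thesis
  proof cases
    case 1
    then have "e \<in> meeting e'" using assms(3) unfolding meeting_def by blast
    then show ?thesis by simp
  next
    case 2
    then have "f \<in> meeting e'" using assms(3) unfolding meeting_def by blast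
    then show ?thesis using 2 assms(1) by (intro UnI2 UN_I) auto
  qed
qed

lemma edge_near:
  "t \<in> {0..1} \<Longrightarrow> edge_char ends e t \<in> closed_edge ends e' \<Longrightarrow> e \<in> meeting e'"
  unfolding meeting_def by blast

lemma \<phi>_points: "e \<in> B \<Longrightarrow> y \<in> {0..3} \<Longrightarrow> \<phi> e y \<in> graph_points ends"
  using \<phi>_continuous[of e] by (auto simp: continuous_map_def topspace_graph_top Pi_iff)

lemma \<beta>_proper: "compactly_proper (graph_top ends') (graph_top ends) \<beta>"
proof (rule compactly_proper_graph_map[OF lf ni ni'])
  show "continuous_map (graph_top ends') (graph_top ends) \<beta>"
    unfolding continuous_map_graph_iff topspace_graph_top
  proof (intro conjI allI)
    show "\<beta> \<in> graph_points ends' \<rightarrow> graph_points ends"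
    proof
      fix x assume "x \<in> graph_points ends'"
      then obtain e t where et: "t \<in> {0..1}" "x = edge_char ends' e t"
        using point_in_closed_edge[OF ni'] by blast
      then show "\<beta> x \<in> graph_points ends"
        by (simp add: \<beta>_edge_char \<phi>_points edge_char_in_points)
    qed
    fix e
    show "continuous_map unit_space (graph_top ends) (\<beta> \<circ> edge_char ends' e)"
    proof (cases "e \<in> B")
      case True
      have "continuous_map unit_space (graph_top ends) (\<lambda>t. \<phi> e (3 * t))"
        by (rule continuous_map_reparam[OF \<phi>_continuous[OF True]]) (auto intro!: continuous_intros)
      then show ?thesis by (rule continuous_map_eq) (use True \<beta>_edge_char in auto)
    next
      case False
      show ?thesis by (rule continuous_map_eq[OF continuous_edge_char[of ends e]]) (use False \<beta>_edge_char in auto)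
    qed
  qed
  fix e'
  have "e \<in> meeting e' \<union> (\<Union>f\<in>meeting e'. {e \<in> B. f \<in> F e})"
    if t: "t \<in> {0..1}" "\<beta> (edge_char ends' e t) \<in> closed_edge ends e'" for e t
  proof (cases "e \<in> B")
    case True
    then show ?thesis using \<phi>_near[of e "3 * t" e'] t by (auto simp: \<beta>_edge_char)
  next
    case False
    then show ?thesis using edge_near[of t e e'] t by (auto simp: \<beta>_edge_char)
  qed
  then show "finite {e. \<exists>t\<in>{0..1}. \<beta> (edge_char ends' e t) \<in> closed_edge ends e'}"
    by (intro finite_subset[OF _ finite_near[of e']]) blast
qed

text \<open>Position on the detour is deformed linearly from \<open>zigzag (3 * t)\<close> to
  \<open>1 + t\<close>, the position on the edge itself. Both run from 1 to 2, so the vertices stay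
  fixed and the homotopies on different edges fit together.\<close>

lemma \<beta>_\<alpha>: "compactly_homotopic (graph_top ends) (graph_top ends) (\<beta> \<circ> \<alpha>) id"
proof -
  interpret dual: edge_slide ends' ends B "\<lambda>e t. P e (1 - t)" "\<lambda>e t. Q e (1 - t)" F
    by (rule dual)
  define r where "r = (\<lambda>(s, t). (1 - s) * zigzag (3 * t) + s * (1 + t))"
  define H where "H = (\<lambda>(s, p). case p of Inl v \<Rightarrow> Inl v
     | Inr (e, t) \<Rightarrow> if e \<in> B then \<phi> e (r (s, t)) else Inr (e, t))"
  have r03: "r (s, t) \<in> {0..3}" if "s \<in> {0..1}" "t \<in> {0..1}" for s t
  proof -
    have z: "0 \<le> zigzag (3 * t)" "zigzag (3 * t) \<le> 3" using that by (auto simp: zigzag_def max_def min_def)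
    have "(1 - s) * zigzag (3 * t) \<le> (1 - s) * 3"
      by (rule mult_left_mono) (use that z in auto)
    moreover have "s * (1 + t) \<le> s * 3"
      by (rule mult_left_mono) (use that in auto)
    ultimately have "r (s, t) \<le> 3" by (simp add: r_def algebra_simps)
    moreover have "0 \<le> r (s, t)" using that z by (simp add: r_def)
    ultimately show ?thesis by simp
  qed
  have H_edge: "H (s, edge_char ends e t) = (if e \<in> B then \<phi> e (r (s, t)) else edge_char ends e t)"
    if "t \<in> {0..1}" for s e t
    using that
  proof (cases rule: edge_char_cases[OF that, of ends e])
    case 1
    then have "r (s, t) = 1" by (simp add: r_def zigzag_def)
    then show ?thesis using 1 by (simp add: H_def slide_path_def P_ends)
  next
    case 2
    then have "r (s, t) = 2" by (simp add: r_def zigzag_def)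
    then show ?thesis using 2 by (simp add: H_def slide_path_def)
  qed (simp add: H_def)
  have H_points: "H (s, x) \<in> graph_points ends" if s: "s \<in> {0..1}" and x: "x \<in> graph_points ends" for s x
  proof -
    obtain e t where et: "t \<in> {0..1}" "x = edge_char ends e t"
      using point_in_closed_edge[OF ni x] by blast
    then show ?thesis using r03[of s t] s \<phi>_points[of e "r (s, t)"]
      by (simp add: H_edge edge_char_in_points)
  qed
  have "continuous_map (prod_topology unit_space (graph_top ends)) (graph_top ends) H"
  proof (rule continuous_map_graph_homotopy[OF ni])
    show "H (s, x) \<in> topspace (graph_top ends)" if "s \<in> {0..1}" "x \<in> graph_points ends" for s x
      using H_points[OF that] by (simp add: topspace_graph_top)
    fix e
    show "continuous_map (prod_topology unit_space unit_space) (graph_top ends) (\<lambda>(s, t). H (s, edge_char ends e t))"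
    proof (cases "e \<in> B")
      case True
      have "continuous_on ({0..1} \<times> {0..1}) r"
        unfolding r_def zigzag_def case_prod_unfold by (intro continuous_intros)
      then have "continuous_map (prod_topology unit_space unit_space) (top_of_set {0..3}) r"
        using r03 by (auto simp: prod_topology_subtopology_eu continuous_map_in_subtopology Pi_iff)
      from continuous_map_compose[OF this \<phi>_continuous[OF True]]
      have "continuous_map (prod_topology unit_space unit_space) (graph_top ends) (\<phi> e \<circ> r)" .
      then show ?thesis by (rule continuous_map_eq) (use True H_edge in auto)
    next
      case False
      have "continuous_map (prod_topology unit_space unit_space) (graph_top ends) (edge_char ends e \<circ> snd)"
        using continuous_map_compose[OF continuous_map_snd continuous_edge_char] .
      then show ?thesis by (rule continuous_map_eq) (use False H_edge in auto)
    qed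
  qed
  moreover have "finite {e. \<exists>s\<in>{0..1}. \<exists>t\<in>{0..1}. H (s, edge_char ends e t) \<in> closed_edge ends e'}" for e'
  proof -
    have "e \<in> meeting e' \<union> (\<Union>f\<in>meeting e'. {e \<in> B. f \<in> F e})"
      if t: "s \<in> {0..1}" "t \<in> {0..1}" "H (s, edge_char ends e t) \<in> closed_edge ends e'" for e s t
    proof (cases "e \<in> B")
      case True
      then show ?thesis using \<phi>_near[OF _ r03[OF t(1,2)]] t by (simp add: H_edge)
    next
      case False
      then show ?thesis using edge_near[of t e e'] t by (simp add: H_edge)
    qed
    then show ?thesis by (intro finite_subset[OF _ finite_near[of e']]) blast
  qed
  ultimately have "compactly_proper (prod_topology unit_space (graph_top ends)) (graph_top ends) H"
    by (intro compactly_proper_graph_homotopy lf ni)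
  moreover have "H (0, x) = (\<beta> \<circ> \<alpha>) x \<and> H (1, x) = id x" if x: "x \<in> graph_points ends" for x
  proof -
    obtain e t where et: "t \<in> {0..1}" "x = edge_char ends e t"
      using point_in_closed_edge[OF ni x] by blast
    show ?thesis
    proof (cases "e \<in> B")
      case True
      have "\<phi> e (1 + t) = edge_char ends e t"
      proof (cases "t = 0")
        case True
        then show ?thesis using \<open>e \<in> B\<close> by (simp add: slide_path_def P_ends)
      qed (use et in \<open>simp add: slide_path_def\<close>)
      then show ?thesis
        using et True by (simp add: H_edge dual.\<beta>_edge_char \<beta>_\<psi> r_def)
    next
      case False
      then show ?thesis
        using et by (simp add: H_edge dual.\<beta>_edge_char \<beta>_edge_char)
    qed
  qed
  ultimately show ?thesis
    unfolding compactly_homotopic_def topspace_graph_top by blast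
qed

end

section \<open>Permuting parallel edges\<close>

definition permute_edges :: "('e \<Rightarrow> 'e) \<Rightarrow> 'v + 'e \<times> real \<Rightarrow> 'v + 'e \<times> real" where
  "permute_edges \<sigma> p = (case p of Inl v \<Rightarrow> Inl v | Inr (e, t) \<Rightarrow> Inr (\<sigma> e, t))"

lemma permute_edges_Inl [simp]: "permute_edges \<sigma> (Inl v) = Inl v"
  by (simp add: permute_edges_def)

lemma permute_edges_edge_char:
  assumes "ends (\<sigma> e) = ends e" "t \<in> {0..1}"
  shows "permute_edges \<sigma> (edge_char ends e t) = edge_char ends (\<sigma> e) t"
  using assms(2)
  by (cases rule: edge_char_cases[OF assms(2), of ends e]) (auto simp: permute_edges_def assms(1))

lemma permute_edges_compose: "permute_edges \<sigma> \<circ> permute_edges \<tau> = permute_edges (\<sigma> \<circ> \<tau>)"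
  by (auto simp: fun_eq_iff permute_edges_def split: sum.splits)

lemma permute_edges_id: "permute_edges id = id"
  by (auto simp: fun_eq_iff permute_edges_def split: sum.splits)

lemma permute_edges_continuous:
  assumes ends: "\<And>e. ends (\<sigma> e) = ends e"
  shows "continuous_map (graph_top ends) (graph_top ends) (permute_edges \<sigma>)"
  unfolding continuous_map_graph_iff topspace_graph_top
proof (intro conjI allI)
  show "permute_edges \<sigma> \<in> graph_points ends \<rightarrow> graph_points ends"
    by (auto simp: permute_edges_def graph_points_def)
  show "continuous_map unit_space (graph_top ends) (permute_edges \<sigma> \<circ> edge_char ends e)" for e
    by (rule continuous_map_eq[OF continuous_edge_char[of ends "\<sigma> e"]])
      (simp add: permute_edges_edge_char ends)
qed

text \<open>A proper homotopy need not respect a base point, so it moves a loop only freely; winding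
  numbers are invariant under such homotopies.\<close>

lemma homotopic_loops_of_homotopy:
  fixes c :: "'a \<Rightarrow> complex"
  assumes H: "continuous_map (prod_topology unit_space T) T H" and c: "continuous_map T euclidean c"
    and \<gamma>: "continuous_map unit_space T \<gamma>" "\<gamma> 0 = \<gamma> 1" and nz: "\<And>x. x \<in> topspace T \<Longrightarrow> c x \<noteq> 0"
    and "\<And>t. t \<in> {0..1} \<Longrightarrow> c (H (0, \<gamma> t)) = p t" "\<And>t. t \<in> {0..1} \<Longrightarrow> c (H (1, \<gamma> t)) = q t"
  shows "homotopic_loops (- {0}) p q"
proof -
  define h where "h = (\<lambda>(s, t). c (H (s, \<gamma> t)))"
  have "continuous_map (prod_topology unit_space unit_space) (prod_topology unit_space T) (\<lambda>(s, t). (s, \<gamma> t))"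
    by (subst continuous_map_prod_top) (use \<gamma>(1) in simp)
  note Hg = continuous_map_compose[OF this H]
  have "continuous_map (prod_topology unit_space unit_space) euclidean h"
    using continuous_map_compose[OF Hg c] by (simp add: h_def o_def case_prod_unfold)
  then have "continuous_on ({0..1} \<times> {0..1}) h"
    by (simp add: prod_topology_subtopology_eu)
  moreover have "h z \<noteq> 0" if "z \<in> {0..1} \<times> {0..1}" for z
    using that Hg nz by (auto simp: h_def continuous_map_def Pi_iff)
  ultimately show ?thesis
    using assms(2-) unfolding homotopic_loops
    by (intro exI[of _ h]) (auto simp: h_def pathstart_def pathfinish_def)
qed

text \<open>Collapsing everything but the edge \<open>\<sigma> e\<^sub>0\<close> to a point turns the loop \<open>e\<^sub>0 e\<^sub>1\<inverse>\<close> into a loop of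
  winding number 1 after \<open>\<sigma>\<close>, but of winding number 0 or -1 after \<open>\<tau>\<close>.\<close>

lemma permute_edges_not_homotopic:
  fixes ends :: "'e \<Rightarrow> 'v \<times> 'v"
  assumes \<sigma>: "\<And>e. ends (\<sigma> e) = ends e" "inj \<sigma>" and \<tau>: "\<And>e. ends (\<tau> e) = ends e"
    and e: "\<sigma> e\<^sub>0 \<noteq> \<tau> e\<^sub>0" "e\<^sub>1 \<noteq> e\<^sub>0" "ends e\<^sub>1 = ends e\<^sub>0"
  shows "\<not> compactly_homotopic (graph_top ends) (graph_top ends) (permute_edges \<sigma>) (permute_edges \<tau>)"
proof
  assume "compactly_homotopic (graph_top ends) (graph_top ends) (permute_edges \<sigma>) (permute_edges \<tau>)"
  then obtain H where H: "continuous_map (prod_topology unit_space (graph_top ends)) (graph_top ends) H"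
    "\<And>x. x \<in> graph_points ends \<Longrightarrow> H (0, x) = permute_edges \<sigma> x \<and> H (1, x) = permute_edges \<tau> x"
    unfolding compactly_homotopic_def compactly_proper_def topspace_graph_top by blast
  define d where "d = \<sigma> e\<^sub>0"
  \<comment> \<open>This map winds the edge \<open>d\<close> once around the circle and sends the
    rest of the graph to 1.\<close>
  define c where "c = (\<lambda>p :: 'v + 'e \<times> real. case p of Inl v \<Rightarrow> 1
     | Inr (e, t) \<Rightarrow> if e = d then exp (2 * of_real pi * \<i> * of_real t) else (1 :: complex))"
  have c_edge: "c (edge_char ends e t) = (if e = d then exp (2 * of_real pi * \<i> * of_real t) else 1)"
    if "t \<in> {0..1}" for e t
    using that by (cases rule: edge_char_cases[OF that, of ends e]) (auto simp: c_def)
  have c: "continuous_map (graph_top ends) euclidean c"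
    unfolding continuous_map_graph_iff
  proof (intro conjI allI)
    fix e
    have "continuous_map unit_space euclidean
        (\<lambda>t. if e = d then exp (2 * of_real pi * \<i> * of_real t) else (1 :: complex))"
      by (cases "e = d") (auto intro!: continuous_intros)
    then show "continuous_map unit_space euclidean (c \<circ> edge_char ends e)"
      by (rule continuous_map_eq) (use c_edge in auto)
  qed auto
  define \<gamma> where "\<gamma> = (\<lambda>t. if t \<le> 1/2 then edge_char ends e\<^sub>0 (2 * t) else edge_char ends e\<^sub>1 (2 - 2 * t))"
  have "continuous_map (top_of_set {0..1/2}) (graph_top ends) (\<lambda>t. edge_char ends e\<^sub>0 (2 * t))"
    "continuous_map (top_of_set {1/2..1}) (graph_top ends) (\<lambda>t. edge_char ends e\<^sub>1 (2 - 2 * t))"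
    by (rule continuous_map_reparam[OF continuous_edge_char]; auto intro!: continuous_intros)+
  from continuous_map_glue[OF this] have \<gamma>: "continuous_map unit_space (graph_top ends) \<gamma>"
    unfolding \<gamma>_def by (simp add: e(3))
  have \<gamma>01: "\<gamma> 0 = \<gamma> 1" by (simp add: \<gamma>_def e(3))
  \<comment> \<open>A continuous lift of the angle, in full turns: the first half of the loop may
    run along \<open>d\<close>, the second half may run back along it.\<close>
  define w where "w = (\<lambda>\<rho> t. (if \<rho> e\<^sub>0 = d then min (2 * t) 1 else 0) -
      (if \<rho> e\<^sub>1 = d then max 0 (2 * t - 1) else (0 :: real)))"
  define p where "p = (\<lambda>\<rho> t. 2 * of_real pi * \<i> * of_real (w \<rho> t))"
  have path: "c (permute_edges \<rho> (\<gamma> t)) = (exp \<circ> p \<rho>) t"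
    if \<rho>: "\<And>e. ends (\<rho> e) = ends e" and t: "t \<in> {0..1}" for \<rho> t
  proof (cases "t \<le> 1/2")
    case True
    then have "min (2 * t) 1 = 2 * t" "max 0 (2 * t - 1) = 0" by auto
    then show ?thesis using t True
      by (simp add: \<gamma>_def permute_edges_edge_char \<rho> c_edge p_def w_def)
  next
    case False
    then have m: "min (2 * t) 1 = 1" "max 0 (2 * t - 1) = 2 * t - 1" by auto
    \<comment> \<open>On the way back the edge parameter is \<open>2 - 2 * t\<close>, one full turn
      more than the lift.\<close>
    have "exp (2 * of_real pi * \<i> * of_real (2 - 2 * t)) = exp (2 * of_real pi * \<i> * of_real (0 - (2 * t - 1)))"
    proof -
      have "2 * of_real pi * \<i> * of_real (2 - 2 * t) =
          2 * of_real pi * \<i> * of_real (0 - (2 * t - 1)) + (2 * of_real pi * \<i> :: complex)"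
        by (simp add: algebra_simps)
      then show ?thesis by (simp only: exp_add exp_two_pi_i mult_1_right)
    qed
    moreover have "exp (2 * of_real pi * \<i> * of_real (1 - (2 * t - 1))) = exp (2 * of_real pi * \<i> * of_real (2 - 2 * t))"
      by simp
    moreover have "exp (2 * of_real pi * \<i> * of_real (1 - 0)) = (1 :: complex)" by simp
    moreover have "exp (2 * of_real pi * \<i> * of_real (0 - 0)) = (1 :: complex)" by simp
    moreover have "c (permute_edges \<rho> (\<gamma> t)) =
        (if \<rho> e\<^sub>1 = d then exp (2 * of_real pi * \<i> * of_real (2 - 2 * t)) else 1)"
      using t False by (simp add: \<gamma>_def permute_edges_edge_char \<rho> c_edge)
    ultimately show ?thesis
      unfolding o_apply p_def w_def m by (simp only: split: if_split) metis
  qed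
  have "homotopic_loops (- {0}) (exp \<circ> p \<sigma>) (exp \<circ> p \<tau>)"
  proof (rule homotopic_loops_of_homotopy[OF H(1) c \<gamma> \<gamma>01])
    show "c x \<noteq> 0" if "x \<in> topspace (graph_top ends)" for x
      by (auto simp: c_def split: sum.splits)
    have "\<gamma> t \<in> graph_points ends" if "t \<in> {0..1}" for t
      using \<gamma> that by (auto simp: continuous_map_def topspace_graph_top Pi_iff)
    then show "c (H (0, \<gamma> t)) = (exp \<circ> p \<sigma>) t" "c (H (1, \<gamma> t)) = (exp \<circ> p \<tau>) t"
      if "t \<in> {0..1}" for t
      using that H(2) path[OF \<sigma>(1)] path[OF \<tau>] by auto
  qed
  then have "winding_number (exp \<circ> p \<sigma>) 0 = winding_number (exp \<circ> p \<tau>) 0"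
    by (rule winding_number_homotopic_loops)
  moreover have "winding_number (exp \<circ> p \<rho>) 0 = of_real (w \<rho> 1)" for \<rho>
  proof -
    have "path (p \<rho>)"
      unfolding path_def p_def w_def
      by (cases "\<rho> e\<^sub>0 = d"; cases "\<rho> e\<^sub>1 = d") (auto intro!: continuous_intros)
    moreover have "pathstart (p \<rho>) = 0" by (simp add: pathstart_def p_def w_def)
    ultimately show ?thesis
      by (simp add: winding_number_compose_exp pathfinish_def p_def)
  qed
  ultimately have "w \<sigma> 1 = w \<tau> 1" by simp
  \<comment> \<open>Injectivity of \<open>\<sigma>\<close> keeps the second edge off
    \<open>d\<close>, so \<open>w \<sigma> 1\<close> is 1, whereas \<open>w \<tau> 1\<close> is 0 or
    -1.\<close>
  moreover have "\<sigma> e\<^sub>1 \<noteq> d" "\<tau> e\<^sub>0 \<noteq> d" using e \<sigma>(2) by (auto simp: d_def inj_eq)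
  ultimately show False by (auto simp: w_def d_def split: if_splits)
qed

section \<open>Mapping classes from symmetries of the slid graph\<close>

context edge_slide
begin

definition symmetry :: "('e \<Rightarrow> 'e) \<Rightarrow> bool" where
  "symmetry \<sigma> \<longleftrightarrow> bij \<sigma> \<and> (\<forall>e. ends' (\<sigma> e) = ends' e)"

definition twist :: "('e \<Rightarrow> 'e) \<Rightarrow> 'v + 'e \<times> real \<Rightarrow> 'v + 'e \<times> real" where
  "twist \<sigma> = \<beta> \<circ> permute_edges \<sigma> \<circ> \<alpha>"

lemma permute_proper:
  assumes "symmetry \<sigma>"
  shows "compactly_proper (graph_top ends') (graph_top ends') (permute_edges \<sigma>)"
proof (rule compactly_proper_graph_map[OF lf' ni' ni'])
  interpret dual: edge_slide ends' ends B "\<lambda>e t. P e (1 - t)" "\<lambda>e t. Q e (1 - t)" F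
    by (rule dual)
  have \<sigma>: "ends' (\<sigma> e) = ends' e" for e using assms by (simp add: symmetry_def)
  then show "continuous_map (graph_top ends') (graph_top ends') (permute_edges \<sigma>)"
    by (rule permute_edges_continuous)
  fix e'
  have "inj \<sigma>" using assms by (simp add: symmetry_def bij_is_inj)
  then have "finite (\<sigma> -` dual.meeting e')" using dual.finite_meeting by (intro finite_vimageI)
  then show "finite {e. \<exists>t\<in>{0..1}. permute_edges \<sigma> (edge_char ends' e t) \<in> closed_edge ends' e'}"
    by (rule finite_subset[rotated]) (use dual.edge_near in \<open>auto simp: permute_edges_edge_char \<sigma>\<close>)
qed

lemma \<alpha>_proper: "compactly_proper (graph_top ends) (graph_top ends') \<alpha>"
  using edge_slide.\<beta>_proper[OF dual] .

lemma \<alpha>_\<beta>: "compactly_homotopic (graph_top ends') (graph_top ends') (\<alpha> \<circ> \<beta>) id"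
  using edge_slide.\<beta>_\<alpha>[OF dual] by simp

lemma twist_proper:
  assumes "symmetry \<sigma>"
  shows "compactly_proper (graph_top ends) (graph_top ends) (twist \<sigma>)"
  unfolding twist_def comp_assoc
  using compactly_proper_compose[OF compactly_proper_compose[OF \<alpha>_proper permute_proper[OF assms]] \<beta>_proper] .

lemma twist_Inl: "twist \<sigma> (Inl v) = Inl v"
  by (simp add: twist_def slide_map_def)

lemma symmetry_compose: "symmetry \<sigma> \<Longrightarrow> symmetry \<tau> \<Longrightarrow> symmetry (\<sigma> \<circ> \<tau>)"
  by (simp add: symmetry_def bij_comp)

text \<open>The factor \<open>\<alpha> \<circ> \<beta>\<close> in the middle is homotopic to the
  identity, so multiplicativity holds up to homotopy.\<close>

lemma twist_compose:
  assumes "symmetry \<sigma>" "symmetry \<tau>"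
  shows "compactly_homotopic (graph_top ends) (graph_top ends) (twist \<sigma> \<circ> twist \<tau>) (twist (\<sigma> \<circ> \<tau>))"
proof -
  have "compactly_homotopic (graph_top ends) (graph_top ends')
      ((\<alpha> \<circ> \<beta>) \<circ> (permute_edges \<tau> \<circ> \<alpha>)) (id \<circ> (permute_edges \<tau> \<circ> \<alpha>))"
    using compactly_homotopic_pre[OF \<alpha>_\<beta>
        compactly_proper_compose[OF \<alpha>_proper permute_proper[OF assms(2)]] Hausdorff_graph_top] .
  from compactly_homotopic_post[OF this compactly_proper_compose[OF permute_proper[OF assms(1)] \<beta>_proper]]
  have "compactly_homotopic (graph_top ends) (graph_top ends)
     (\<beta> \<circ> permute_edges \<sigma> \<circ> (\<alpha> \<circ> \<beta> \<circ> (permute_edges \<tau> \<circ> \<alpha>)))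
     (\<beta> \<circ> permute_edges \<sigma> \<circ> (id \<circ> (permute_edges \<tau> \<circ> \<alpha>)))" .
  moreover have "\<beta> \<circ> permute_edges \<sigma> \<circ> (id \<circ> (permute_edges \<tau> \<circ> \<alpha>)) = twist (\<sigma> \<circ> \<tau>)"
    unfolding twist_def permute_edges_compose[symmetric] by (simp add: fun_eq_iff)
  moreover have "\<beta> \<circ> permute_edges \<sigma> \<circ> (\<alpha> \<circ> \<beta> \<circ> (permute_edges \<tau> \<circ> \<alpha>)) = twist \<sigma> \<circ> twist \<tau>"
    unfolding twist_def by (simp add: fun_eq_iff)
  ultimately show ?thesis by simp
qed

lemma twist_id: "compactly_homotopic (graph_top ends) (graph_top ends) (twist id) id"
  unfolding twist_def permute_edges_id using \<beta>_\<alpha> by simp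

lemma twist_equivalence:
  assumes "symmetry \<sigma>"
  shows "proper_homotopy_equivalence (graph_top ends) (twist \<sigma>)"
proof -
  have bij: "bij \<sigma>" using assms by (simp add: symmetry_def)
  have "ends' (inv_into UNIV \<sigma> e) = ends' (\<sigma> (inv_into UNIV \<sigma> e))" for e
    using assms unfolding symmetry_def by simp
  then have "ends' (inv_into UNIV \<sigma> e) = ends' e" for e
    using bij by (simp add: bij_is_surj surj_f_inv_f)
  then have s: "symmetry (inv_into UNIV \<sigma>)" using bij by (simp add: symmetry_def bij_imp_bij_inv)
  have "\<sigma> \<circ> inv_into UNIV \<sigma> = id" "inv_into UNIV \<sigma> \<circ> \<sigma> = id"
    using bij by (auto simp: fun_eq_iff bij_is_surj surj_f_inv_f bij_is_inj)
  then show ?thesis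
    unfolding graph.proper_homotopy_equivalence_iff
    using twist_proper[OF assms] twist_proper[OF s] twist_compose[OF assms s] twist_compose[OF s assms]
      twist_id compactly_homotopic_trans by metis
qed

lemma twist_maps_end:
  assumes "symmetry \<sigma>" "\<epsilon> \<in> ends_of (graph_top ends)"
  shows "maps_end_to (graph_top ends) (twist \<sigma>) \<epsilon> \<epsilon>"
  by (rule maps_end_to_if_fixes_vertices[OF lf ni twist_proper[OF assms(1)] twist_Inl assms(2)])

lemma twist_class_in_PMapGroup:
  "symmetry \<sigma> \<Longrightarrow> ph_class (graph_top ends) (twist \<sigma>) \<in> carrier (PMapGroup (graph_top ends))"
  by (simp add: graph.ph_class_in_PMapGroup twist_equivalence twist_maps_end)

lemma twist_class_mult:
  "symmetry \<sigma> \<Longrightarrow> symmetry \<tau> \<Longrightarrow>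
   ph_class (graph_top ends) (twist \<sigma>) \<otimes>\<^bsub>MapGroup (graph_top ends)\<^esub> ph_class (graph_top ends) (twist \<tau>)
     = ph_class (graph_top ends) (twist (\<sigma> \<circ> \<tau>))"
  by (simp add: graph.mult_MapGroup graph.ph_class_eq_iff twist_equivalence symmetry_compose twist_compose)

text \<open>Conjugating back with \<open>\<alpha>\<close> and \<open>\<beta>\<close> recovers the
  permutations up to homotopy; the question of faithfulness moves to the slid graph.\<close>

lemma permute_homotopic_if_twist_homotopic:
  assumes \<sigma>: "symmetry \<sigma>" and \<tau>: "symmetry \<tau>"
    and h: "compactly_homotopic (graph_top ends) (graph_top ends) (twist \<sigma>) (twist \<tau>)"
  shows "compactly_homotopic (graph_top ends') (graph_top ends') (permute_edges \<sigma>) (permute_edges \<tau>)"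
proof -
  have conj: "compactly_homotopic (graph_top ends') (graph_top ends') (\<alpha> \<circ> (twist \<rho> \<circ> \<beta>)) (permute_edges \<rho>)"
    if "symmetry \<rho>" for \<rho>
  proof -
    have "compactly_homotopic (graph_top ends') (graph_top ends')
        (\<alpha> \<circ> \<beta> \<circ> (permute_edges \<rho> \<circ> (\<alpha> \<circ> \<beta>))) (id \<circ> (permute_edges \<rho> \<circ> id))"
      using compactly_homotopic_compose[OF compactly_homotopic_post[OF \<alpha>_\<beta> permute_proper[OF that]] \<alpha>_\<beta>]
        permute_proper[OF that] compactly_proper_compose[OF \<beta>_proper \<alpha>_proper]
      by (simp add: Hausdorff_graph_top)
    then show ?thesis by (simp add: twist_def comp_assoc)
  qed
  have "compactly_homotopic (graph_top ends') (graph_top ends') (\<alpha> \<circ> (twist \<sigma> \<circ> \<beta>)) (\<alpha> \<circ> (twist \<tau> \<circ> \<beta>))"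
    using compactly_homotopic_post[OF compactly_homotopic_pre[OF h \<beta>_proper Hausdorff_graph_top] \<alpha>_proper] .
  then show ?thesis
    using conj[OF \<sigma>] conj[OF \<tau>] compactly_homotopic_sym compactly_homotopic_trans by blast
qed

lemma twist_class_neq:
  assumes "symmetry \<sigma>" "symmetry \<tau>" "\<sigma> e\<^sub>0 \<noteq> \<tau> e\<^sub>0" "e\<^sub>1 \<noteq> e\<^sub>0" "ends' e\<^sub>1 = ends' e\<^sub>0"
  shows "ph_class (graph_top ends) (twist \<sigma>) \<noteq> ph_class (graph_top ends) (twist \<tau>)"
  using permute_edges_not_homotopic[of ends' \<sigma> \<tau> e\<^sub>0 e\<^sub>1] permute_homotopic_if_twist_homotopic[OF assms(1,2)]
    assms twist_equivalence by (auto simp: symmetry_def bij_is_inj graph.ph_class_eq_iff)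

end

section \<open>Fundamental groups\<close>

abbreviation unit_square :: "(real \<times> real) topology" where
  "unit_square \<equiv> top_of_set ({0..1} \<times> {0..1})"

definition loop_homotopic :: "'a topology \<Rightarrow> 'a \<Rightarrow> (real \<Rightarrow> 'a) \<Rightarrow> (real \<Rightarrow> 'a) \<Rightarrow> bool" where
  "loop_homotopic T r = homotopic_with (\<lambda>k. k 0 = r \<and> k 1 = r) unit_space T"

lemma loops_at_iff:
  "g \<in> loops_at T r \<longleftrightarrow> continuous_map unit_space T g \<and> g 0 = r \<and> g 1 = r"
  by (auto simp: loops_at_def pathin_def)

lemma loop_homotopicI:
  assumes "continuous_map unit_square T H"
    and "\<And>t. t \<in> {0..1} \<Longrightarrow> H (0, t) = g t" "\<And>t. t \<in> {0..1} \<Longrightarrow> H (1, t) = h t"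
    and "\<And>s. s \<in> {0..1} \<Longrightarrow> H (s, 0) = r" "\<And>s. s \<in> {0..1} \<Longrightarrow> H (s, 1) = r"
  shows "loop_homotopic T r g h"
proof -
  have "continuous_map (prod_topology unit_space unit_space) T H"
    using assms(1) by (simp add: prod_topology_subtopology_eu)
  then show ?thesis
    unfolding loop_homotopic_def
    using assms(2-) by (subst homotopic_with) (auto intro!: exI[of _ H])
qed

lemma loop_homotopicE:
  assumes "loop_homotopic T r g h"
  obtains H where "continuous_map unit_square T H"
    "\<And>t. H (0, t) = g t" "\<And>t. H (1, t) = h t"
    "\<And>s. s \<in> {0..1} \<Longrightarrow> H (s, 0) = r" "\<And>s. s \<in> {0..1} \<Longrightarrow> H (s, 1) = r"
proof -
  obtain H where H: "continuous_map (prod_topology unit_space unit_space) T H"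
    "\<forall>t. H (0, t) = g t" "\<forall>t. H (1, t) = h t"
    "\<forall>s\<in>{0..1}. H (s, 0) = r \<and> H (s, 1) = r"
    using assms unfolding loop_homotopic_def homotopic_with_def by blast
  then have "continuous_map unit_square T H" by (simp add: prod_topology_subtopology_eu)
  then show thesis using that H by blast
qed

lemma loop_homotopic_cong:
  assumes "loop_homotopic T r g h" "\<And>t. t \<in> {0..1} \<Longrightarrow> g' t = g t"
  shows "loop_homotopic T r g' h"
  using assms(1) unfolding loop_homotopic_def
  by (rule homotopic_with_eq) (use assms(2) in auto)

lemma loop_homotopic_refl: "g \<in> loops_at T r \<Longrightarrow> loop_homotopic T r g g"
  by (simp add: loop_homotopic_def loops_at_iff)

lemma loop_homotopic_sym: "loop_homotopic T r g h \<Longrightarrow> loop_homotopic T r h g"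
  unfolding loop_homotopic_def by (rule homotopic_with_symD)

lemma loop_homotopic_trans:
  "loop_homotopic T r g h \<Longrightarrow> loop_homotopic T r h k \<Longrightarrow> loop_homotopic T r g k"
  unfolding loop_homotopic_def by (rule homotopic_with_trans)

lemma mem_loop_class: "h \<in> loop_class T r g \<longleftrightarrow> h \<in> loops_at T r \<and> loop_homotopic T r g h"
  by (simp add: loop_class_def loop_homotopic_def)

lemma loop_class_eqI:
  assumes "loop_homotopic T r g h"
  shows "loop_class T r g = loop_class T r h"
proof -
  have "loop_homotopic T r g k \<longleftrightarrow> loop_homotopic T r h k" for k
    using assms by (meson loop_homotopic_sym loop_homotopic_trans)
  then show ?thesis by (auto simp: mem_loop_class)
qed

text \<open>Linear interpolation between the two parameter functions. The group laws below follow by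
  writing both sides as one path run through in two ways.\<close>

lemma loop_homotopic_reparam:
  fixes a b :: real
  assumes f: "continuous_map (top_of_set {a..b}) T f"
    and \<theta>: "continuous_on {0..1} \<theta>" "\<theta> ` {0..1} \<subseteq> {a..b}"
    and \<eta>: "continuous_on {0..1} \<eta>" "\<eta> ` {0..1} \<subseteq> {a..b}"
    and e: "\<theta> 0 = \<eta> 0" "\<theta> 1 = \<eta> 1" "f (\<eta> 0) = r" "f (\<eta> 1) = r"
  shows "loop_homotopic T r (\<lambda>t. f (\<theta> t)) (\<lambda>t. f (\<eta> t))"
proof (rule loop_homotopicI)
  let ?R = "{0..1} \<times> {0..1} :: (real \<times> real) set"
  define h where "h = (\<lambda>z. (1 - fst z) * \<theta> (snd z) + fst z * \<eta> (snd z))"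
  have c: "continuous_on ?R (\<lambda>z. \<theta> (snd z))" "continuous_on ?R (\<lambda>z. \<eta> (snd z))"
    by (rule continuous_on_compose2[OF \<theta>(1)] continuous_on_compose2[OF \<eta>(1)];
        auto intro!: continuous_intros)+
  show "continuous_map (top_of_set ?R) T (\<lambda>z. f (h z))"
  proof (rule continuous_map_reparam[OF f])
    show "continuous_on ?R h" unfolding h_def by (intro continuous_intros c)
    show "h ` ?R \<subseteq> {a..b}"
    proof
      fix y assume "y \<in> h ` ?R"
      then obtain s t where st: "s \<in> {0..1}" "t \<in> {0..1}" "y = (1 - s) * \<theta> t + s * \<eta> t"
        by (auto simp: h_def)
      have "\<theta> t \<in> {a..b}" "\<eta> t \<in> {a..b}" using st(2) \<theta>(2) \<eta>(2) by blast+
      then have "(1 - s) *\<^sub>R \<theta> t + s *\<^sub>R \<eta> t \<in> {a..b}"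
        using st by (intro convexD[OF convex_real_interval(5)]) auto
      then show "y \<in> {a..b}" using st by simp
    qed
  qed
qed (use e in \<open>auto simp: algebra_simps\<close>)

lemma continuous_map_glue_square:
  assumes f: "continuous_map (top_of_set ({0..1} \<times> {0..1/2::real} :: (real \<times> real) set)) T f"
    and g: "continuous_map (top_of_set ({0..1} \<times> {1/2..1::real} :: (real \<times> real) set)) T g"
    and "\<And>s. s \<in> {0..1} \<Longrightarrow> f (s, 1/2) = g (s, 1/2)"
  shows "continuous_map unit_square T (\<lambda>z :: real \<times> real. if snd z \<le> 1/2 then f z else g z)"
proof (rule continuous_map_cases_le)
  let ?R = "{0..1} \<times> {0..1} :: (real \<times> real) set"
  have "subtopology (top_of_set ?R) {z \<in> topspace (top_of_set ?R). snd z \<le> 1/2} = top_of_set ({0..1} \<times> {0..1/2})"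
    "subtopology (top_of_set ?R) {z \<in> topspace (top_of_set ?R). 1/2 \<le> snd z} = top_of_set ({0..1} \<times> {1/2..1})"
    by (auto simp: subtopology_subtopology intro!: arg_cong[where f = "subtopology euclidean"])
  then show "continuous_map (subtopology (top_of_set ?R) {z \<in> topspace (top_of_set ?R). snd z \<le> 1/2}) T f"
    "continuous_map (subtopology (top_of_set ?R) {z \<in> topspace (top_of_set ?R). 1/2 \<le> snd z}) T g"
    using f g by auto
  show "continuous_map (top_of_set ?R) euclideanreal snd" "continuous_map (top_of_set ?R) euclideanreal (\<lambda>z. 1/2)"
    by (auto intro!: continuous_intros)
  show "f z = g z" if z: "z \<in> topspace unit_square" "snd z = 1/2" for z
  proof -
    obtain s where "z = (s, 1/2)" "s \<in> {0..1}" using z by (cases z) auto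
    then show ?thesis using assms(3) by blast
  qed
qed

lemma loop_join_in_loops:
  assumes "g \<in> loops_at T r" "h \<in> loops_at T r"
  shows "loop_join g h \<in> loops_at T r"
proof -
  have "continuous_map (top_of_set {0..1/2}) T (\<lambda>t. g (2 * t))"
    "continuous_map (top_of_set {1/2..1}) T (\<lambda>t. h (2 * t - 1))"
    using assms by (auto simp: loops_at_iff intro!: continuous_map_reparam[where T = "{0..1}"] continuous_intros)
  from continuous_map_glue[OF this] show ?thesis
    using assms by (simp add: loops_at_iff loop_join_def)
qed

lemma loop_join_homotopic:
  assumes "loop_homotopic T r g g'" "loop_homotopic T r h h'"
  shows "loop_homotopic T r (loop_join g h) (loop_join g' h')"
proof -
  obtain G where G: "continuous_map unit_square T G"
    "\<And>t. G (0, t) = g t" "\<And>t. G (1, t) = g' t"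
    "\<And>s. s \<in> {0..1} \<Longrightarrow> G (s, 0) = r" "\<And>s. s \<in> {0..1} \<Longrightarrow> G (s, 1) = r"
    using assms(1) by (rule loop_homotopicE) blast
  obtain K where K: "continuous_map unit_square T K"
    "\<And>t. K (0, t) = h t" "\<And>t. K (1, t) = h' t"
    "\<And>s. s \<in> {0..1} \<Longrightarrow> K (s, 0) = r" "\<And>s. s \<in> {0..1} \<Longrightarrow> K (s, 1) = r"
    using assms(2) by (rule loop_homotopicE) blast
  have "continuous_map (top_of_set ({0..1} \<times> {0..1/2::real} :: (real \<times> real) set)) T (\<lambda>z. G (fst z, 2 * snd z))"
    by (rule continuous_map_reparam[OF G(1)]) (auto intro!: continuous_intros)
  moreover have "continuous_map (top_of_set ({0..1} \<times> {1/2..1::real} :: (real \<times> real) set)) T (\<lambda>z. K (fst z, 2 * snd z - 1))"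
    by (rule continuous_map_reparam[OF K(1)]) (auto intro!: continuous_intros)
  ultimately have "continuous_map unit_square T
     (\<lambda>z. if snd z \<le> 1/2 then G (fst z, 2 * snd z) else K (fst z, 2 * snd z - 1))"
    by (rule continuous_map_glue_square) (simp add: G K)
  then show ?thesis
    by (rule loop_homotopicI) (auto simp: loop_join_def G K)
qed

lemma mult_fundamental_group:
  assumes g: "g \<in> loops_at T r" and h: "h \<in> loops_at T r"
  shows "loop_class T r g \<otimes>\<^bsub>fundamental_group T r\<^esub> loop_class T r h = loop_class T r (loop_join g h)"
proof -
  define a where "a = (SOME a. a \<in> loop_class T r g)"
  define b where "b = (SOME b. b \<in> loop_class T r h)"
  have "a \<in> loop_class T r g" "b \<in> loop_class T r h"
    unfolding a_def b_def
    using someI[of "\<lambda>a. a \<in> loop_class T r g" g] someI[of "\<lambda>b. b \<in> loop_class T r h" h]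
    by (simp_all add: mem_loop_class loop_homotopic_refl g h)
  then have "loop_homotopic T r (loop_join g h) (loop_join a b)"
    by (simp add: mem_loop_class loop_join_homotopic)
  then show ?thesis
    by (simp add: fundamental_group_def a_def b_def loop_class_eqI)
qed

lemma carrier_fundamental_group:
  "carrier (fundamental_group T r) = loop_class T r ` loops_at T r"
  by (simp add: fundamental_group_def)

lemma one_fundamental_group: "\<one>\<^bsub>fundamental_group T r\<^esub> = loop_class T r (\<lambda>t. r)"
  by (simp add: fundamental_group_def)

lemma loop_join_assoc:
  assumes f: "f \<in> loops_at T r" and g: "g \<in> loops_at T r" and h: "h \<in> loops_at T r"
  shows "loop_homotopic T r (loop_join (loop_join f g) h) (loop_join f (loop_join g h))"
proof -
  define \<Phi> where "\<Phi> = (\<lambda>y. if y \<le> 1 then f y else if y \<le> 2 then g (y - 1) else h (y - 2))"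
  have "continuous_map (top_of_set {1..2}) T (\<lambda>y. g (y - 1))"
    "continuous_map (top_of_set {2..3}) T (\<lambda>y. h (y - 2))"
    using g h by (auto simp: loops_at_iff intro!: continuous_map_reparam[where T = "{0..1}"] continuous_intros)
  from continuous_map_glue[OF this]
  have "continuous_map (top_of_set {1..3}) T (\<lambda>y. if y \<le> 2 then g (y - 1) else h (y - 2))"
    using g h by (simp add: loops_at_iff)
  from continuous_map_glue[OF _ this, of 0 f]
  have \<Phi>: "continuous_map (top_of_set {0..3}) T \<Phi>"
    unfolding \<Phi>_def using f g by (simp add: loops_at_iff)
  \<comment> \<open>The piecewise linear positions on \<open>\<Phi>\<close> of the two bracketings:
    speeds 4, 4, 2 and 2, 4, 4.\<close>
  have "loop_homotopic T r (\<lambda>t. \<Phi> (min (4 * t) (2 * t + 1))) (\<lambda>t. \<Phi> (max (2 * t) (4 * t - 1)))"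
    by (rule loop_homotopic_reparam[OF \<Phi>]) (use f h in \<open>auto intro!: continuous_intros simp: \<Phi>_def loops_at_iff\<close>)
  moreover have "\<Phi> (min (4 * t) (2 * t + 1)) = loop_join (loop_join f g) h t" for t
  proof -
    consider "t \<le> 1/4" | "1/4 < t" "t \<le> 1/2" | "1/2 < t" by linarith
    then show ?thesis by cases (auto simp: \<Phi>_def loop_join_def min_def)
  qed
  moreover have "\<Phi> (max (2 * t) (4 * t - 1)) = loop_join f (loop_join g h) t" for t
  proof -
    consider "t \<le> 1/2" | "1/2 < t" "t \<le> 3/4" | "3/4 < t" by linarith
    then show ?thesis
    proof cases
      case 1
      then show ?thesis by (simp add: \<Phi>_def loop_join_def max_absorb1)
    next
      case 2
      then show ?thesis by (simp add: \<Phi>_def loop_join_def max_absorb2)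
    next
      case 3
      have "2 * (2 * t - 1) - 1 = 4 * t - 3" by simp
      then show ?thesis using 3 by (simp add: \<Phi>_def loop_join_def max_def)
    qed
  qed
  ultimately show ?thesis by simp
qed

lemma loop_join_const:
  assumes "g \<in> loops_at T r"
  shows "loop_homotopic T r (loop_join (\<lambda>t. r) g) g" "loop_homotopic T r (loop_join g (\<lambda>t. r)) g"
proof -
  have g: "continuous_map (top_of_set {0..1}) T g" "g 0 = r" "g 1 = r"
    using assms by (auto simp: loops_at_iff)
  have "loop_homotopic T r (\<lambda>t. g (max 0 (2 * t - 1))) (\<lambda>t. g t)"
    "loop_homotopic T r (\<lambda>t. g (min (2 * t) 1)) (\<lambda>t. g t)"
    by (rule loop_homotopic_reparam[OF g(1)]; use g in \<open>auto intro!: continuous_intros\<close>)+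
  moreover have "g (max 0 (2 * t - 1)) = loop_join (\<lambda>t. r) g t" "g (min (2 * t) 1) = loop_join g (\<lambda>t. r) t" for t
    using g by (cases "t \<le> 1/2"; simp add: loop_join_def max_absorb1 max_absorb2 min_absorb1 min_absorb2)+
  ultimately show "loop_homotopic T r (loop_join (\<lambda>t. r) g) g" "loop_homotopic T r (loop_join g (\<lambda>t. r)) g"
    by simp_all
qed

lemma loop_join_reverse:
  assumes "g \<in> loops_at T r"
  shows "loop_homotopic T r (loop_join (\<lambda>t. g (1 - t)) g) (\<lambda>t. r)"
proof -
  have g: "continuous_map (top_of_set {0..1}) T g" "g 0 = r" "g 1 = r"
    using assms by (auto simp: loops_at_iff)
  \<comment> \<open>The position runs from 1 down to 0 and back to 1, and contracts to the constant
    1.\<close>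
  have "loop_homotopic T r (\<lambda>t. g (max (1 - 2 * t) (2 * t - 1))) (\<lambda>t. g 1)"
    by (rule loop_homotopic_reparam[OF g(1)]) (use g in \<open>auto intro!: continuous_intros\<close>)
  moreover have "g (max (1 - 2 * t) (2 * t - 1)) = loop_join (\<lambda>t. g (1 - t)) g t" for t
    by (cases "t \<le> 1/2"; simp add: loop_join_def max_absorb1 max_absorb2)
  ultimately show ?thesis using g by simp
qed

lemma reverse_in_loops:
  assumes "g \<in> loops_at T r"
  shows "(\<lambda>t. g (1 - t)) \<in> loops_at T r"
  using assms by (auto simp: loops_at_iff intro!: continuous_map_reparam[where T = "{0..1}"] continuous_intros)

lemma const_in_loops: "r \<in> topspace T \<Longrightarrow> (\<lambda>t. r) \<in> loops_at T r"
  by (simp add: loops_at_iff)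

lemma group_fundamental_group:
  assumes "r \<in> topspace T"
  shows "group (fundamental_group T r)"
proof (rule groupI)
  show "\<one>\<^bsub>fundamental_group T r\<^esub> \<in> carrier (fundamental_group T r)"
    using const_in_loops[OF assms] by (auto simp: one_fundamental_group carrier_fundamental_group)
  fix x assume x: "x \<in> carrier (fundamental_group T r)"
  then obtain g where g: "x = loop_class T r g" "g \<in> loops_at T r"
    by (auto simp: carrier_fundamental_group)
  then show "\<one>\<^bsub>fundamental_group T r\<^esub> \<otimes>\<^bsub>fundamental_group T r\<^esub> x = x"
    using loop_class_eqI[OF loop_join_const(1)] const_in_loops[OF assms]
    by (simp add: one_fundamental_group mult_fundamental_group)
  show "\<exists>y\<in>carrier (fundamental_group T r). y \<otimes>\<^bsub>fundamental_group T r\<^esub> x = \<one>\<^bsub>fundamental_group T r\<^esub>"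
    using g reverse_in_loops[OF g(2)] loop_class_eqI[OF loop_join_reverse[OF g(2)]]
    by (intro bexI[of _ "loop_class T r (\<lambda>t. g (1 - t))"])
      (simp_all add: one_fundamental_group mult_fundamental_group carrier_fundamental_group)
  fix y assume "y \<in> carrier (fundamental_group T r)"
  then obtain h where h: "y = loop_class T r h" "h \<in> loops_at T r"
    by (auto simp: carrier_fundamental_group)
  then show "x \<otimes>\<^bsub>fundamental_group T r\<^esub> y \<in> carrier (fundamental_group T r)"
    using g by (simp add: mult_fundamental_group carrier_fundamental_group loop_join_in_loops)
  fix z assume "z \<in> carrier (fundamental_group T r)"
  then obtain k where "z = loop_class T r k" "k \<in> loops_at T r"
    by (auto simp: carrier_fundamental_group)
  then show "x \<otimes>\<^bsub>fundamental_group T r\<^esub> y \<otimes>\<^bsub>fundamental_group T r\<^esub> z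
     = x \<otimes>\<^bsub>fundamental_group T r\<^esub> (y \<otimes>\<^bsub>fundamental_group T r\<^esub> z)"
    using g h by (simp add: mult_fundamental_group loop_join_in_loops loop_class_eqI[OF loop_join_assoc])
qed

section \<open>Generating the fundamental group from contractible charts\<close>

definition close_up :: "(real \<times> 'a \<Rightarrow> 'a) \<Rightarrow> (real \<Rightarrow> 'a) \<Rightarrow> real \<Rightarrow> 'a" where
  "close_up \<kappa> p u = (if u \<le> 1/2 then p (2 * u) else \<kappa> (2 * u - 1, p 1))"

text \<open>Every path from the base point is closed up to a loop by the contraction of a chart containing
  its end point. Along a loop \<open>g\<close> the classes of the loops obtained from \<open>g\<close> restricted to
  \<open>[0, t]\<close> are locally constant in \<open>t\<close>, up to switching charts.\<close>

lemma loops_generated_by_charts: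
  fixes T :: "'a topology" and W :: "'j \<Rightarrow> 'a set" and \<kappa> :: "'j \<Rightarrow> real \<times> 'a \<Rightarrow> 'a"
  assumes W: "\<And>j. j \<in> J \<Longrightarrow> openin T (W j)" "topspace T \<subseteq> (\<Union>j\<in>J. W j)"
    and \<kappa>: "\<And>j. j \<in> J \<Longrightarrow> continuous_map (prod_topology unit_space (subtopology T (W j))) T (\<kappa> j)"
      "\<And>j x. j \<in> J \<Longrightarrow> x \<in> W j \<Longrightarrow> \<kappa> j (0, x) = x" "\<And>j x. j \<in> J \<Longrightarrow> x \<in> W j \<Longrightarrow> \<kappa> j (1, x) = r"
    and j0: "j0 \<in> J" "r \<in> W j0" "\<And>s. s \<in> {0..1} \<Longrightarrow> \<kappa> j0 (s, r) = r"
    and one: "loop_class T r (\<lambda>t. r) \<in> \<H>"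
    and switch: "\<And>j k p. \<lbrakk>j \<in> J; k \<in> J; continuous_map unit_space T p; p 0 = r; p 1 \<in> W j; p 1 \<in> W k;
      loop_class T r (close_up (\<kappa> j) p) \<in> \<H>\<rbrakk> \<Longrightarrow> loop_class T r (close_up (\<kappa> k) p) \<in> \<H>"
    and g: "g \<in> loops_at T r"
  shows "loop_class T r g \<in> \<H>"
proof -
  have gc: "continuous_map unit_space T g" "g 0 = r" "g 1 = r" using g by (auto simp: loops_at_iff)
  define p where "p = (\<lambda>t u. g (u * t))"
  have p: "continuous_map unit_space T (p t)" "p t 0 = r" "p t 1 = g t" if "t \<in> {0..1}" for t
  proof -
    have "u * t \<in> {0..1}" if "u \<in> {0..1}" for u
      using mult_le_one[of u t] \<open>t \<in> {0..1}\<close> that by auto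
    then show "continuous_map unit_space T (p t)"
      unfolding p_def by (intro continuous_map_reparam[OF gc(1)] continuous_intros) blast
  qed (simp_all add: p_def gc)
  \<comment> \<open>All charts containing \<open>g t\<close> are required at once; by
    \<open>switch\<close> it suffices to check one of them.\<close>
  define good where "good = (\<lambda>t. \<forall>j\<in>J. g t \<in> W j \<longrightarrow> loop_class T r (close_up (\<kappa> j) (p t)) \<in> \<H>)"
  have goodI: "good t" if "t \<in> {0..1}" "j \<in> J" "g t \<in> W j" "loop_class T r (close_up (\<kappa> j) (p t)) \<in> \<H>" for t j
    unfolding good_def using switch[OF that(2)] that p[OF that(1)] by simp
  have move: "loop_homotopic T r (close_up (\<kappa> j) (p x)) (close_up (\<kappa> j) (p y))"
    if j: "j \<in> J" and x: "x \<in> {0..1}" and y: "y \<in> {0..1}"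
      and seg: "\<And>s. s \<in> {0..1} \<Longrightarrow> g ((1 - s) * x + s * y) \<in> W j" for j x y
  proof -
    \<comment> \<open>The time at which \<open>g\<close> is cut off moves from \<open>x\<close> to
      \<open>y\<close>. Its end point stays in the chart, so one contraction closes up all
      intermediate paths.\<close>
    define \<tau> where "\<tau> = (\<lambda>s. (1 - s) * x + s * y)"
    have \<tau>: "\<tau> s \<in> {0..1}" if "s \<in> {0..1}" for s
      using convexD[OF convex_real_interval(5), of x 0 1 y "1 - s" s] x y that by (auto simp: \<tau>_def)
    have m: "2 * u * \<tau> s \<in> {0..1}" if "s \<in> {0..1}" "u \<in> {0..1/2}" for s u
      using mult_le_one[of "2 * u" "\<tau> s"] \<tau>[OF that(1)] that(2) by auto
    have \<tau>c: "continuous_on S (\<lambda>z :: real \<times> real. \<tau> (fst z))" for S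
      unfolding \<tau>_def by (intro continuous_intros)
    have 1: "continuous_map (top_of_set ({0..1} \<times> {0..1/2::real} :: (real \<times> real) set)) T (\<lambda>z. g (2 * snd z * \<tau> (fst z)))"
      by (rule continuous_map_reparam[OF gc(1)]) (use m in \<open>auto intro!: continuous_intros \<tau>c\<close>)
    have "continuous_map (top_of_set ({0..1} \<times> {1/2..1::real} :: (real \<times> real) set)) T (\<lambda>z. g (\<tau> (fst z)))"
    proof (rule continuous_map_reparam[OF gc(1) \<tau>c])
      show "(\<lambda>z. \<tau> (fst z)) ` ({0..1} \<times> {1/2..1 :: real}) \<subseteq> {0..1}"
        by (rule image_subsetI, rule \<tau>) (simp add: mem_Times_iff)
    qed
    then have "continuous_map (top_of_set ({0..1} \<times> {1/2..1::real} :: (real \<times> real) set)) (subtopology T (W j)) (\<lambda>z. g (\<tau> (fst z)))"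
      using seg by (auto simp: continuous_map_in_subtopology \<tau>_def)
    moreover have "continuous_map (top_of_set ({0..1} \<times> {1/2..1::real} :: (real \<times> real) set)) unit_space (\<lambda>z :: real \<times> real. 2 * snd z - 1)"
      by (auto simp: continuous_map_in_subtopology intro!: continuous_intros)
    ultimately have "continuous_map (top_of_set ({0..1} \<times> {1/2..1::real} :: (real \<times> real) set)) (prod_topology unit_space (subtopology T (W j)))
        (\<lambda>z. (2 * snd z - 1, g (\<tau> (fst z))))"
      by (simp add: continuous_map_paired)
    from continuous_map_compose[OF this \<kappa>(1)[OF j]]
    have 2: "continuous_map (top_of_set ({0..1} \<times> {1/2..1::real} :: (real \<times> real) set)) T (\<lambda>z. \<kappa> j (2 * snd z - 1, g (\<tau> (fst z))))"
      by (simp add: o_def)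
    have seg': "g (\<tau> s) \<in> W j" if "s \<in> {0..1}" for s using seg that by (simp add: \<tau>_def)
    have "continuous_map unit_square T
       (\<lambda>z. if snd z \<le> 1/2 then g (2 * snd z * \<tau> (fst z)) else \<kappa> j (2 * snd z - 1, g (\<tau> (fst z))))"
      by (rule continuous_map_glue_square[OF 1 2]) (use \<kappa>(2)[OF j] seg' in auto)
    then show ?thesis
      by (rule loop_homotopicI)
        (use gc \<kappa>(3)[OF j] seg' in \<open>auto simp: close_up_def p_def \<tau>_def\<close>)
  qed
  have "good 1"
  proof (rule connected_induction_simple[of "{0..1::real}" 0 1 good])
    \<comment> \<open>At time 0 the path is constant, and the contraction of the chart
      \<open>j0\<close> does not move \<open>r\<close>.\<close>
    have "close_up (\<kappa> j0) (p 0) u = r" if "u \<in> {0..1}" for u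
      using that gc j0 by (auto simp: close_up_def p_def)
    then have "loop_homotopic T r (close_up (\<kappa> j0) (p 0)) (\<lambda>t. r)"
      using openin_subset[OF W(1)[OF j0(1)]] j0 by (intro loop_homotopicI[of _ "\<lambda>z. r"]) auto
    then have "loop_class T r (close_up (\<kappa> j0) (p 0)) \<in> \<H>"
      using one by (simp add: loop_class_eqI)
    then show "good 0" using goodI[of 0 j0] j0 gc by simp
    fix a :: real assume a: "a \<in> {0..1}"
    then have "g a \<in> topspace T" using gc(1) by (auto simp: continuous_map_def)
    then obtain j where j: "j \<in> J" "g a \<in> W j" using W(2) by blast
    have "openin unit_space {t \<in> topspace unit_space. g t \<in> W j}"
      using openin_continuous_map_preimage[OF gc(1) W(1)[OF j(1)]] .
    then obtain U where U: "open U" "{t \<in> topspace unit_space. g t \<in> W j} = {0..1} \<inter> U"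
      by (auto simp: openin_open)
    then have "a \<in> U" using a j by auto
    then obtain e where e: "e > 0" "ball a e \<subseteq> U" using U(1) open_contains_ball by blast
    have WU: "g t \<in> W j" if "t \<in> {0..1}" "t \<in> U" for t
    proof -
      have "t \<in> {t \<in> topspace unit_space. g t \<in> W j}" unfolding U(2) using that by blast
      then show ?thesis by blast
    qed
    show "\<exists>V. openin (top_of_set {0..1}) V \<and> a \<in> V \<and> (\<forall>x\<in>V. \<forall>y\<in>V. good x \<longrightarrow> good y)"
    proof (intro exI[of _ "{0..1} \<inter> ball a e"] conjI ballI impI)
      show "openin (top_of_set {0..1}) ({0..1} \<inter> ball a e)" by (simp add: openin_open_Int)
      show "a \<in> {0..1} \<inter> ball a e" using a e by simp
      fix x y assume xy: "x \<in> {0..1} \<inter> ball a e" "y \<in> {0..1} \<inter> ball a e" and "good x"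
      have "convex ({0..1} \<inter> ball a e)" by (intro convex_Int convex_real_interval convex_ball)
      then have "(1 - s) * x + s * y \<in> {0..1} \<inter> ball a e" if "s \<in> {0..1}" for s
        using convexD[of "{0..1} \<inter> ball a e" x y "1 - s" s] xy that by auto
      then have seg: "g ((1 - s) * x + s * y) \<in> W j" if "s \<in> {0..1}" for s
        using WU e(2) that by blast
      have "loop_homotopic T r (close_up (\<kappa> j) (p x)) (close_up (\<kappa> j) (p y))"
        by (rule move[OF j(1) _ _ seg]) (use xy in auto)
      then have "loop_class T r (close_up (\<kappa> j) (p x)) = loop_class T r (close_up (\<kappa> j) (p y))"
        by (rule loop_class_eqI)
      moreover have "g x \<in> W j" "g y \<in> W j" using WU e(2) xy by auto
      ultimately show "good y"
        using goodI[of y j] \<open>good x\<close> j xy unfolding good_def by auto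
    qed
  qed auto
  then have "loop_class T r (close_up (\<kappa> j0) (p 1)) \<in> \<H>"
    using j0 gc unfolding good_def by simp
  \<comment> \<open>At time 1 closing up only appends a constant path, again because
    \<open>j0\<close> fixes \<open>r\<close>.\<close>
  moreover have "loop_homotopic T r (close_up (\<kappa> j0) (p 1)) (loop_join g (\<lambda>t. r))"
  proof (rule loop_homotopicI[of _ "\<lambda>z. loop_join g (\<lambda>t. r) (snd z)"])
    have "r \<in> topspace T" using openin_subset[OF W(1)[OF j0(1)]] j0(2) by blast
    then have l: "loop_join g (\<lambda>t. r) \<in> loops_at T r" by (intro loop_join_in_loops g const_in_loops)
    then show "continuous_map unit_square T (\<lambda>z :: real \<times> real. loop_join g (\<lambda>t. r) (snd z))"
      by (intro continuous_map_reparam[of "{0..1}" T "loop_join g (\<lambda>t. r)" _ snd])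
        (auto simp: loops_at_iff intro!: continuous_intros)
    show "loop_join g (\<lambda>t. r) (snd (s, 0)) = r" "loop_join g (\<lambda>t. r) (snd (s, 1)) = r" for s :: real
      using l by (auto simp: loops_at_iff)
  qed (use gc j0 in \<open>auto simp: close_up_def loop_join_def p_def\<close>)
  ultimately show ?thesis
    using loop_class_eqI loop_join_const(2)[OF g] by metis
qed

text \<open>From a point on the loop \<open>\<phi>\<close> one can return to \<open>r\<close>
  backwards or forwards; the two closures differ by the whole loop. This is the cost of changing
  between the chart of an edge and that of the tree.\<close>

lemma switch_exit:
  assumes \<phi>: "continuous_map (top_of_set {0..3}) T \<phi>" "\<phi> 0 = r" "\<phi> 3 = r"
    and p: "continuous_map unit_space T p" "p 0 = r" "p 1 = \<phi> x" and x: "x \<in> {0..3}"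
  defines "f \<equiv> \<lambda>u. if u \<le> 1/2 then p (2 * u) else \<phi> (x * (1 - (2 * u - 1)))"
    and "h \<equiv> \<lambda>u. if u \<le> 1/2 then p (2 * u) else \<phi> (x + (3 - x) * (2 * u - 1))"
  shows "f \<in> loops_at T r" "h \<in> loops_at T r"
    "loop_homotopic T r (loop_join f (\<lambda>u. \<phi> (3 * u))) h"
proof -
  have p2: "continuous_map (top_of_set {0..1/2}) T (\<lambda>u. p (2 * u))"
    by (rule continuous_map_reparam[OF p(1)]) (auto intro!: continuous_intros)
  have range: "x * (1 - v) \<in> {0..3}" "x + (3 - x) * v \<in> {0..3}" if "v \<in> {0..1}" for v
  proof -
    have "x * (1 - v) \<le> 3 * 1" using x that by (intro mult_mono) auto
    then show "x * (1 - v) \<in> {0..3}" using x that by auto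
    have "(3 - x) * v \<le> (3 - x) * 1" using x that by (intro mult_left_mono) auto
    then show "x + (3 - x) * v \<in> {0..3}" using x that by auto
  qed
  have "continuous_map (top_of_set {1/2..1}) T (\<lambda>u. \<phi> (x * (1 - (2 * u - 1))))"
    by (rule continuous_map_reparam[OF \<phi>(1)]) (use range(1)[of "2 * _ - 1"] in \<open>auto intro!: continuous_intros\<close>)
  from continuous_map_glue[OF p2 this] show fl: "f \<in> loops_at T r"
    unfolding f_def loops_at_iff using p \<phi> by simp
  have "continuous_map (top_of_set {1/2..1}) T (\<lambda>u. \<phi> (x + (3 - x) * (2 * u - 1)))"
    by (rule continuous_map_reparam[OF \<phi>(1)]) (use range(2)[of "2 * _ - 1"] in \<open>auto intro!: continuous_intros\<close>)
  from continuous_map_glue[OF p2 this] show hl: "h \<in> loops_at T r"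
    unfolding h_def loops_at_iff using p \<phi> by simp
  \<comment> \<open>Position on \<open>\<phi>\<close> after the path \<open>p\<close>: from
    \<open>x\<close> back to 0 until time 3/4, then from 0 to 3.\<close>
  define A where "A = (\<lambda>u. max (x * (3 - 4 * u)) (3 * (4 * u - 3)))"
  have A: "A u \<in> {0..3}" if "u \<in> {1/2..1}" for u
  proof -
    have "x * (3 - 4 * u) \<le> 3" "3 * (4 * u - 3) \<le> 3"
    proof -
      show "x * (3 - 4 * u) \<le> 3"
      proof (cases "3 - 4 * u \<ge> 0")
        case True
        have "x * (3 - 4 * u) \<le> 3 * 1" using x that True by (intro mult_mono) auto
        then show ?thesis by simp
      next
        case False
        then have "x * (3 - 4 * u) \<le> 0" using x by (intro mult_nonneg_nonpos) auto
        then show ?thesis by simp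
      qed
    qed (use that in auto)
    moreover have "0 \<le> A u"
    proof (cases "3 - 4 * u \<ge> 0")
      case True
      then have "0 \<le> x * (3 - 4 * u)" using x by auto
      then show ?thesis by (simp add: A_def)
    qed (simp add: A_def)
    ultimately show ?thesis by (simp add: A_def)
  qed
  define w where "w = (\<lambda>u. if u \<le> 1/2 then p (2 * u) else \<phi> (A u))"
  have Ac: "continuous_on S A" for S unfolding A_def by (intro continuous_intros)
  have A2: "A (1/2) = x" using x by (simp add: A_def)
  have A1: "A 1 = 3" using x by (simp add: A_def)
  have "continuous_map (top_of_set {1/2..1}) T (\<lambda>u. \<phi> (A u))"
    by (rule continuous_map_reparam[OF \<phi>(1) Ac]) (use A in auto)
  from continuous_map_glue[OF p2 this] have wc: "continuous_map (top_of_set {0..1}) T w"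
    unfolding w_def using p A2 by simp
  \<comment> \<open>Turns the time shares 1/4, 1/4, 1/2 of the joined loop into the shares 1/2, 1/4,
    1/4 of \<open>w\<close>.\<close>
  define \<theta> where "\<theta> = (\<lambda>u :: real. min (2 * u) (min (u + 1/4) ((u + 1) / 2)))"
  have \<theta>: "continuous_on {0..1} \<theta>" "\<theta> ` {0..1} \<subseteq> {0..1}" "\<theta> 0 = 0" "\<theta> 1 = 1"
    unfolding \<theta>_def by (auto simp: min_le_iff_disj intro!: continuous_intros)
  have w01: "w 0 = r" "w 1 = r" using p \<phi> A1 by (simp_all add: w_def)
  have 0: "loop_homotopic T r (\<lambda>u. w (\<theta> u)) (\<lambda>u. w u)"
    by (rule loop_homotopic_reparam[OF wc \<theta>(1,2)]) (auto simp: \<theta> w01)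
  have join: "w (\<theta> u) = loop_join f (\<lambda>u. \<phi> (3 * u)) u" if "u \<in> {0..1}" for u
  proof -
    consider "u \<le> 1/4" | "1/4 < u" "u \<le> 1/2" | "1/2 < u" by linarith
    then show ?thesis
    proof cases
      case 1
      then show ?thesis by (auto simp: w_def \<theta>_def loop_join_def f_def min_def)
    next
      case 2
      then have t: "\<theta> u = u + 1/4" by (auto simp: \<theta>_def min_def)
      have "A (u + 1/4) = max (x * (2 - 4 * u)) (3 * (4 * u - 2))"
        unfolding A_def by (rule arg_cong2[where f = max]) (simp_all add: algebra_simps)
      moreover have "0 \<le> x * (2 - 4 * u)" using x 2 by auto
      ultimately have "A (u + 1/4) = x * (2 - 4 * u)" using 2 by simp
      moreover have "w (u + 1/4) = \<phi> (A (u + 1/4))" using 2 by (simp add: w_def)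
      moreover have "loop_join f (\<lambda>u. \<phi> (3 * u)) u = \<phi> (x * (1 - (2 * (2 * u) - 1)))"
        using 2 by (simp add: loop_join_def f_def)
      moreover have "x * (1 - (2 * (2 * u) - 1)) = x * (2 - 4 * u)" by (simp add: algebra_simps)
      ultimately show ?thesis using t by metis
    next
      case 3
      then have t: "\<theta> u = (u + 1) / 2" by (auto simp: \<theta>_def min_def)
      have "A ((u + 1) / 2) = max (x * (1 - 2 * u)) (3 * (2 * u - 1))"
        unfolding A_def by (rule arg_cong2[where f = max]) (simp_all add: field_simps)
      moreover have "x * (1 - 2 * u) \<le> 0" using x 3 by (intro mult_nonneg_nonpos) auto
      ultimately have "A ((u + 1) / 2) = 3 * (2 * u - 1)" using 3 by simp
      moreover have "w ((u + 1) / 2) = \<phi> (A ((u + 1) / 2))" using 3 by (simp add: w_def)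
      moreover have "loop_join f (\<lambda>u. \<phi> (3 * u)) u = \<phi> (3 * (2 * u - 1))"
        using 3 by (simp add: loop_join_def)
      ultimately show ?thesis using t by metis
    qed
  qed
  have 1: "loop_homotopic T r (loop_join f (\<lambda>u. \<phi> (3 * u))) w"
    by (rule loop_homotopic_cong[OF 0]) (simp add: join)
  \<comment> \<open>Deforms the detour through position 0 into the direct run from \<open>x\<close>
    to 3; both start at \<open>x\<close> and end at 3.\<close>
  define B where "B = (\<lambda>z. (1 - fst z) * A (snd z) + fst z * (x + (3 - x) * (2 * snd z - 1)))"
  have "continuous_map (top_of_set ({0..1} \<times> {0..1/2::real} :: (real \<times> real) set)) T (\<lambda>z :: real \<times> real. p (2 * snd z))"
    by (rule continuous_map_reparam[OF p(1)]) (auto intro!: continuous_intros)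
  moreover have "continuous_map (top_of_set ({0..1} \<times> {1/2..1::real} :: (real \<times> real) set)) T (\<lambda>z. \<phi> (B z))"
  proof (rule continuous_map_reparam[OF \<phi>(1)])
    show "continuous_on ({0..1} \<times> {1/2..1}) B"
      unfolding B_def A_def by (intro continuous_intros)
    show "B ` ({0..1} \<times> {1/2..1}) \<subseteq> {0..3}"
    proof
      fix y assume "y \<in> B ` ({0..1} \<times> {1/2..1})"
      then obtain s u where su: "s \<in> {0..1}" "u \<in> {1/2..1}" "y = B (s, u)" by auto
      then have "A u \<in> {0..3}" "x + (3 - x) * (2 * u - 1) \<in> {0..3}" using A range(2) by auto
      then have "(1 - s) *\<^sub>R A u + s *\<^sub>R (x + (3 - x) * (2 * u - 1)) \<in> {0..3}"
        using su by (intro convexD[OF convex_real_interval(5)]) auto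
      then show "y \<in> {0..3}" using su by (simp add: B_def)
    qed
  qed
  ultimately have "continuous_map unit_square T
     (\<lambda>z. if snd z \<le> 1/2 then p (2 * snd z) else \<phi> (B z))"
    by (rule continuous_map_glue_square) (use A2 p in \<open>simp add: B_def algebra_simps\<close>)
  then have "loop_homotopic T r w h"
    by (rule loop_homotopicI) (use p \<phi> A1 in \<open>auto simp: w_def h_def B_def algebra_simps\<close>)
  with 1 show "loop_homotopic T r (loop_join f (\<lambda>u. \<phi> (3 * u))) h"
    by (rule loop_homotopic_trans)
qed

section \<open>Rooted spanning trees\<close>

text \<open>A spanning tree given by functions on the vertices. Tree edges may be oriented either
  way, hence the case distinctions; \<open>parent\<close> and \<open>tree_edge\<close> are left
  unspecified at the root.\<close>

locale rooted_graph =
  fixes ends :: "'e \<Rightarrow> 'v \<times> 'v" and root :: 'v and depth :: "'v \<Rightarrow> nat"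
    and parent :: "'v \<Rightarrow> 'v" and tree_edge :: "'v \<Rightarrow> 'e"
  assumes lf: "graph_locally_finite ends" and ni: "no_isolated_vertices ends"
    and depth_0: "depth v = 0 \<longleftrightarrow> v = root"
    and depth_parent: "v \<noteq> root \<Longrightarrow> depth v = Suc (depth (parent v))"
    and tree_edge: "v \<noteq> root \<Longrightarrow>
      ends (tree_edge v) = (parent v, v) \<or> ends (tree_edge v) = (v, parent v)"
begin

definition non_tree :: "'e set" where
  "non_tree = - tree_edge ` (- {root})"

text \<open>Two vertices sharing a tree edge would be parents of each other, contradicting
  depth.\<close>

lemma tree_edge_inj:
  assumes "u \<noteq> root" "v \<noteq> root" "tree_edge u = tree_edge v"
  shows "u = v"
proof -
  have "u = v \<or> parent u = v \<and> parent v = u"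
    using tree_edge[OF assms(1)] tree_edge[OF assms(2)] assms(3) by auto
  then show ?thesis using depth_parent[OF assms(1)] depth_parent[OF assms(2)] by auto
qed

definition ancestor :: "nat \<Rightarrow> 'v \<Rightarrow> 'v" where
  "ancestor n v = (parent ^^ (depth v - n)) v"

lemma ancestor_self [simp]: "ancestor (depth v) v = v"
  by (simp add: ancestor_def)

lemma ancestor_parent:
  assumes "v \<noteq> root" "n \<le> depth (parent v)"
  shows "ancestor n v = ancestor n (parent v)"
  using assms by (simp add: ancestor_def depth_parent Suc_diff_le funpow_swap1)

lemma depth_ancestor: "n \<le> depth v \<Longrightarrow> depth (ancestor n v) = n"
proof (induction "depth v" arbitrary: v)
  case 0
  then show ?case by (simp add: ancestor_def)
next
  case (Suc d)
  have v: "v \<noteq> root" using Suc(2) depth_0[of v] by auto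
  have d: "depth (parent v) = d" using Suc(2) depth_parent[OF v] by simp
  show ?case
  proof (cases "n = depth v")
    case False
    then have "n \<le> depth (parent v)" using Suc(2,3) d by simp
    then show ?thesis using Suc(1)[OF d[symmetric]] v ancestor_parent by simp
  qed simp
qed

text \<open>The tree edge at \<open>v\<close>, traversed towards \<open>v\<close>.\<close>

definition descend :: "'v \<Rightarrow> real \<Rightarrow> 'v + 'e \<times> real" where
  "descend v t = edge_char ends (tree_edge v) (if ends (tree_edge v) = (parent v, v) then t else 1 - t)"

lemma descend_ends: "v \<noteq> root \<Longrightarrow> descend v 0 = Inl (parent v)" "v \<noteq> root \<Longrightarrow> descend v 1 = Inl v"
  using tree_edge[of v] by (auto simp: descend_def)

lemma descend_in: "t \<in> {0..1} \<Longrightarrow> descend v t \<in> closed_edge ends (tree_edge v)"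
  unfolding descend_def by (intro imageI) auto

lemma descend_continuous:
  assumes "ends' (tree_edge v) = ends (tree_edge v)"
  shows "continuous_map unit_space (graph_top ends') (descend v)"
proof -
  have eq: "edge_char ends (tree_edge v) = edge_char ends' (tree_edge v)"
    by (simp add: fun_eq_iff edge_char_def assms)
  show ?thesis
    unfolding descend_def eq
    by (cases "ends (tree_edge v) = (parent v, v)")
      (auto intro!: continuous_map_reparam[OF continuous_edge_char] continuous_intros continuous_edge_char)
qed

fun path_upto :: "nat \<Rightarrow> 'v \<Rightarrow> real \<Rightarrow> 'v + 'e \<times> real" where
  "path_upto 0 v y = Inl v"
| "path_upto (Suc n) v y = (if y \<le> real n then path_upto n (parent v) y else descend v (y - real n))"

text \<open>The tree path from the root to \<open>v\<close>, parametrized by depth.\<close>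

definition tree_path :: "'v \<Rightarrow> real \<Rightarrow> 'v + 'e \<times> real" where
  "tree_path v = path_upto (depth v) v"

lemma tree_path_root: "tree_path root y = Inl root"
  using depth_0[of root] by (simp add: tree_path_def)

lemma tree_path_step:
  "v \<noteq> root \<Longrightarrow> tree_path v y =
    (if y \<le> real (depth (parent v)) then tree_path (parent v) y else descend v (y - real (depth (parent v))))"
  by (simp add: tree_path_def depth_parent)

lemma tree_induct [case_names root child]:
  assumes "P root" "\<And>v. v \<noteq> root \<Longrightarrow> P (parent v) \<Longrightarrow> P v"
  shows "P v"
proof (induction "depth v" arbitrary: v)
  case 0
  then show ?case using depth_0 assms(1) by auto
next
  case (Suc n)
  have v: "v \<noteq> root" using Suc(2) depth_0[of v] by auto
  have "depth (parent v) = n" using Suc(2) depth_parent[OF v] by simp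
  then show ?case using assms(2)[OF v] Suc(1) by simp
qed

lemma tree_path_depth: "tree_path v (real (depth v)) = Inl v"
proof (cases "v = root")
  case False
  then show ?thesis by (simp add: tree_path_step depth_parent descend_ends)
qed (simp add: tree_path_root)

lemma tree_path_0: "tree_path v 0 = Inl root"
proof (induction v rule: tree_induct)
  case (child v)
  then show ?case by (simp add: tree_path_step)
qed (simp add: tree_path_root)

lemma tree_path_continuous:
  assumes "\<And>v. v \<noteq> root \<Longrightarrow> ends' (tree_edge v) = ends (tree_edge v)"
  shows "continuous_map (top_of_set {0..real (depth v)}) (graph_top ends') (tree_path v)"
proof (induction v rule: tree_induct)
  case root
  then show ?case by (simp add: tree_path_root topspace_graph_top)
next
  case (child v)
  let ?d = "real (depth (parent v))"
  have "continuous_map unit_space (graph_top ends') (descend v)"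
    by (rule descend_continuous) (rule assms[OF child(1)])
  then have "continuous_map (top_of_set {?d..?d + 1}) (graph_top ends') (\<lambda>y. descend v (y - ?d))"
    by (rule continuous_map_reparam) (auto intro!: continuous_intros)
  from continuous_map_glue[OF child(2) this]
  have "continuous_map (top_of_set {0..?d + 1}) (graph_top ends')
      (\<lambda>y. if y \<le> ?d then tree_path (parent v) y else descend v (y - ?d))"
    using child(1) by (simp add: tree_path_depth descend_ends)
  moreover have "real (depth v) = ?d + 1" using depth_parent[OF child(1)] by simp
  moreover have "(\<lambda>y. if y \<le> ?d then tree_path (parent v) y else descend v (y - ?d)) = tree_path v"
    using tree_path_step[OF child(1)] by auto
  ultimately show ?case by simp
qed

lemma tree_path_ancestor: "n \<le> depth v \<Longrightarrow> tree_path v (real n) = Inl (ancestor n v)"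
proof (induction v rule: tree_induct)
  case root
  then show ?case using depth_0[of root] by (simp add: tree_path_root ancestor_def)
next
  case (child v)
  show ?case
  proof (cases "n = depth v")
    case True
    then show ?thesis by (simp add: tree_path_depth)
  next
    case False
    then have "n \<le> depth (parent v)" using child depth_parent[of v] by simp
    then show ?thesis using child by (simp add: tree_path_step ancestor_parent)
  qed
qed

text \<open>A slide that stops at depth \<open>n\<close> uses only tree edges leading to depth at
  least \<open>n\<close>. This is the source of \<open>finite_support\<close>.\<close>

lemma tree_path_support:
  "\<lbrakk>y \<in> {real n..real (depth v)}; n > 0\<rbrakk> \<Longrightarrow>
    \<exists>u. n \<le> depth u \<and> tree_path v y \<in> closed_edge ends (tree_edge u)"
proof (induction v rule: tree_induct)
  case root
  then show ?case using depth_0[of root] by simp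
next
  case (child v)
  show ?case
  proof (cases "y \<le> real (depth (parent v))")
    case True
    then show ?thesis using child by (simp add: tree_path_step)
  next
    case False
    have d: "real (depth v) = real (depth (parent v)) + 1" using depth_parent[OF child(1)] by simp
    have "tree_path v y \<in> closed_edge ends (tree_edge v)"
      using False child(1,3) d descend_in[of "y - real (depth (parent v))" v] by (simp add: tree_path_step)
    moreover have "n \<le> depth v" using child(3) by simp
    ultimately show ?thesis by blast
  qed
qed

lemma finite_level: "finite {v. depth v = n}"
proof (induction n)
  case 0
  then show ?case by (simp add: depth_0)
next
  case (Suc n)
  have sub: "v \<in> (\<Union>u\<in>{u. depth u = n}. \<Union>e\<in>incident ends u. {fst (ends e), snd (ends e)})"
    if "depth v = Suc n" for v
  proof -
    have v: "v \<noteq> root" using that depth_0[of v] by auto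
    then have "depth (parent v) = n" using that depth_parent by simp
    moreover have "tree_edge v \<in> incident ends (parent v)"
      "v \<in> {fst (ends (tree_edge v)), snd (ends (tree_edge v))}"
      using tree_edge[OF v] by (auto simp: incident_def)
    ultimately show ?thesis by blast
  qed
  have "finite (\<Union>u\<in>{u. depth u = n}. \<Union>e\<in>incident ends u. {fst (ends e), snd (ends e)})"
    using Suc finite_incident[OF lf] by (intro finite_UN_I) auto
  then show ?case by (rule finite_subset[rotated]) (use sub in blast)
qed

section \<open>Edges outside the tree far from the root\<close>

definition deep :: "nat \<Rightarrow> 'e set" where
  "deep n = {e \<in> non_tree. n \<le> depth (fst (ends e)) \<and> n \<le> depth (snd (ends e))}"

text \<open>Finitely many vertices have depth below \<open>n\<close>, and finitely many edges touch
  them.\<close>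

lemma infinite_deep:
  assumes "infinite non_tree"
  shows "infinite (deep n)"
proof
  assume "finite (deep n)"
  have "finite (\<Union>k\<in>{..<n}. {v. depth v = k})" using finite_level by auto
  then have "finite (\<Union>v\<in>(\<Union>k\<in>{..<n}. {v. depth v = k}). incident ends v)"
    by (rule finite_UN_I) (rule finite_incident[OF lf])
  moreover have "non_tree \<subseteq> deep n \<union> (\<Union>v\<in>(\<Union>k\<in>{..<n}. {v. depth v = k}). incident ends v)"
    by (auto simp: deep_def incident_def not_le)
  ultimately show False using assms \<open>finite (deep n)\<close> by (meson finite_UnI finite_subset)
qed

lemma infinite_parallel:
  assumes "infinite non_tree"
  obtains u w where "infinite {e \<in> deep n. ancestor n (fst (ends e)) = u \<and> ancestor n (snd (ends e)) = w}"
proof -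
  define f where "f = (\<lambda>e. (ancestor n (fst (ends e)), ancestor n (snd (ends e))))"
  have "f ` deep n \<subseteq> {v. depth v = n} \<times> {v. depth v = n}"
    by (auto simp: f_def deep_def depth_ancestor)
  then have "finite (f ` deep n)" using finite_level by (meson finite_SigmaI finite_subset)
  then obtain e where "infinite {e' \<in> deep n. f e' = f e}"
    using pigeonhole_infinite[OF infinite_deep[OF assms]] by blast
  then show thesis using that by (simp add: f_def)
qed

section \<open>Graphs of infinite rank have infinitely many edges outside a spanning tree\<close>

definition branch :: "'v \<Rightarrow> real \<Rightarrow> 'v + 'e \<times> real" where
  "branch v t = tree_path v (real (depth v) * t)"

lemma branch_ends: "branch v 0 = Inl root" "branch v 1 = Inl v"
  by (simp_all add: branch_def tree_path_0 tree_path_depth)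

lemma branch_continuous: "continuous_map unit_space (graph_top ends) (branch v)"
  unfolding branch_def
  by (rule continuous_map_reparam[OF tree_path_continuous])
    (auto intro!: continuous_intros simp: mult_left_le)

text \<open>The loop through the edge \<open>e\<close> outside the tree, with \<open>e\<close> itself traversed on \<open>[1, 2]\<close>.\<close>

definition edge_loop :: "'e \<Rightarrow> real \<Rightarrow> 'v + 'e \<times> real" where
  "edge_loop = slide_path ends (\<lambda>e. branch (fst (ends e))) (\<lambda>e t. branch (snd (ends e)) (1 - t))"

lemma edge_loop_continuous: "continuous_map (top_of_set {0..3}) (graph_top ends) (edge_loop e)"
  unfolding edge_loop_def
proof (rule slide_path_continuous)
  show "continuous_map unit_space (graph_top ends) (\<lambda>t. branch (snd (ends e)) (1 - t))"
    by (rule continuous_map_reparam[OF branch_continuous]) (auto intro!: continuous_intros)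
qed (auto simp: branch_continuous branch_ends)

lemma edge_loop_values:
  "edge_loop e 0 = Inl root" "edge_loop e 3 = Inl root"
  "t \<in> {0..1} \<Longrightarrow> edge_loop e (1 + t) = edge_char ends e t"
  "t \<in> {0..1} \<Longrightarrow> edge_loop e t = branch (fst (ends e)) t"
  "t \<in> {0..1} \<Longrightarrow> edge_loop e (2 + t) = branch (snd (ends e)) (1 - t)"
proof -
  show "t \<in> {0..1} \<Longrightarrow> edge_loop e (1 + t) = edge_char ends e t"
    by (cases "t = 0") (auto simp: edge_loop_def slide_path_def branch_ends)
  show "t \<in> {0..1} \<Longrightarrow> edge_loop e (2 + t) = branch (snd (ends e)) (1 - t)"
    by (cases "t = 0") (auto simp: edge_loop_def slide_path_def branch_ends)
qed (auto simp: edge_loop_def slide_path_def branch_ends)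

definition child :: "'e \<Rightarrow> 'v" where
  "child e = (SOME v. v \<noteq> root \<and> tree_edge v = e)"

lemma child_tree_edge: "v \<noteq> root \<Longrightarrow> child (tree_edge v) = v"
  unfolding child_def by (rule some_equality) (auto intro: tree_edge_inj)

definition tree_part :: "('v + 'e \<times> real) set" where
  "tree_part = graph_points ends - {Inr (e, 1/2) | e. e \<in> non_tree}"

definition open_edge :: "'e \<Rightarrow> ('v + 'e \<times> real) set" where
  "open_edge e = {Inr (e, t) | t. 0 < t \<and> t < 1}"

text \<open>The contraction of the graph minus the midpoints of the edges outside the tree.\<close>

definition contract :: "real \<times> ('v + 'e \<times> real) \<Rightarrow> 'v + 'e \<times> real" where
  "contract = (\<lambda>(s, x). case x of Inl v \<Rightarrow> branch v (1 - s)
     | Inr (e, t) \<Rightarrow>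
         if e \<in> non_tree then edge_loop e ((1 - s) * (1 + t) + (if t < 1/2 then 0 else 3 * s))
         else let v = child e; \<tau> = (if ends e = (parent v, v) then t else 1 - t)
           in tree_path v ((1 - s) * (real (depth (parent v)) + \<tau>)))"

text \<open>The open edge is contracted through its start vertex: the point at position
  \<open>1 + t\<close> of \<open>edge_loop e\<close> runs back to position 0.\<close>

definition retreat :: "'e \<Rightarrow> real \<times> ('v + 'e \<times> real) \<Rightarrow> 'v + 'e \<times> real" where
  "retreat e = (\<lambda>(s, x). case x of Inl v \<Rightarrow> Inl v | Inr (e', t) \<Rightarrow> edge_loop e ((1 - s) * (1 + t)))"

lemma openin_tree_part: "openin (graph_top ends) tree_part"
proof -
  have "{t \<in> {0..1}. edge_char ends e t \<in> tree_part} = {0..1} \<inter> (if e \<in> non_tree then - {1/2} else UNIV)" for e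
    by (auto simp: tree_part_def edge_char_def graph_points_def)
  then show ?thesis
    unfolding openin_graph_top by (auto simp: tree_part_def openin_open_Int)
qed

lemma openin_open_edge: "openin (graph_top ends) (open_edge e)"
proof -
  have "{t \<in> {0..1}. edge_char ends e' t \<in> open_edge e} = {0..1} \<inter> (if e' = e then {0<..<1} else {})" for e'
    by (auto simp: open_edge_def edge_char_def)
  moreover have "open_edge e \<subseteq> graph_points ends" by (auto simp: open_edge_def graph_points_def)
  ultimately show ?thesis
    unfolding openin_graph_top by (simp add: openin_open_Int)
qed

lemma convex_combination_range:
  assumes "s \<in> {0..1}" "a \<in> {0..c}" "b \<in> {0..c}"
  shows "(1 - s) * a + s * b \<in> {0..c :: real}"
  using convexD[OF convex_real_interval(5), of a 0 c b "1 - s" s] assms by auto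

lemma contract_edge_non_tree:
  assumes "e \<in> non_tree" "t \<in> {0..1}" "t \<noteq> 1/2" "s \<in> {0..1}"
  shows "contract (s, edge_char ends e t) = edge_loop e ((1 - s) * (1 + t) + (if t < 1/2 then 0 else 3 * s))"
  using assms(2)
proof (cases rule: edge_char_cases[OF assms(2), of ends e])
  case 1
  then show ?thesis using assms edge_loop_values(4)[of "1 - s" e] by (simp add: contract_def)
next
  case 2
  have "(1 - s) * (1 + 1) + 3 * s = 2 + s" by (simp add: algebra_simps)
  then show ?thesis
    using 2 assms edge_loop_values(5)[of s e, unfolded add.commute[of 2 s]] by (simp add: contract_def)
next
  case 3
  then show ?thesis using assms by (simp add: contract_def)
qed

lemma contract_edge_tree:
  assumes v: "v \<noteq> root" and e: "e = tree_edge v" and t: "t \<in> {0..1}" and s: "s \<in> {0..1}"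
  shows "contract (s, edge_char ends e t) =
    tree_path v ((1 - s) * (real (depth (parent v)) + (if ends e = (parent v, v) then t else 1 - t)))"
proof -
  let ?d = "real (depth (parent v))"
  have d: "real (depth v) = ?d + 1" using depth_parent[OF v] by simp
  have le: "(1 - s) * ?d \<le> ?d" using s mult_right_mono[of "1 - s" 1 ?d] by simp
  \<comment> \<open>The path to \<open>v\<close> prolongs the path to its parent, so both end points
    of the edge move along the single path \<open>tree_path v\<close>.\<close>
  have par: "branch (parent v) (1 - s) = tree_path v ((1 - s) * (?d + 0))"
    using le v by (simp add: branch_def tree_path_step mult.commute)
  have chi: "branch v (1 - s) = tree_path v ((1 - s) * (?d + 1))"
    using d by (simp add: branch_def mult.commute)
  have ne: "parent v \<noteq> v" using depth_parent[OF v] by (metis n_not_Suc_n)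
  have nt: "e \<notin> non_tree" using e v by (simp add: non_tree_def)
  have c: "child e = v" using e v by (simp add: child_tree_edge)
  from t show ?thesis
  proof (cases rule: edge_char_cases[OF t, of ends e])
    case 1
    then show ?thesis using tree_edge[OF v] e par chi ne by (auto simp: contract_def)
  next
    case 2
    then show ?thesis using tree_edge[OF v] e par chi ne by (auto simp: contract_def)
  next
    case 3
    then show ?thesis using nt c by (simp add: contract_def Let_def)
  qed
qed

lemma contract_continuous:
  "continuous_map (prod_topology unit_space (subtopology (graph_top ends) tree_part)) (graph_top ends) contract"
proof (rule continuous_map_edgewise_homotopy[OF ni openin_tree_part])
  have edge: "continuous_map (prod_topology unit_space (top_of_set {t \<in> {0..1}. edge_char ends e t \<in> tree_part}))
      (graph_top ends) (\<lambda>(s, t). contract (s, edge_char ends e t))" for e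
  proof (cases "e \<in> non_tree")
    case True
    have I: "{t \<in> {0..1}. edge_char ends e t \<in> tree_part} = {0..1} - {1/2}"
      using True by (auto simp: tree_part_def edge_char_def graph_points_def)
    \<comment> \<open>The indicator of the second half of the edge is written with
      \<open>sgn\<close>, which is continuous away from 1/2.\<close>
    define q where "q = (\<lambda>z :: real \<times> real. (1 - fst z) * (1 + snd z)
      + 3 * fst z * ((1 + sgn (snd z - 1/2)) / 2))"
    have q: "q z = (1 - fst z) * (1 + snd z) + (if snd z < 1/2 then 0 else 3 * fst z)"
      if "snd z \<noteq> 1/2" for z
      using that by (auto simp: q_def sgn_if)
    have "continuous_map (top_of_set ({0..1} \<times> ({0..1} - {1/2}))) (graph_top ends) (\<lambda>z. edge_loop e (q z))"
    proof (rule continuous_map_reparam[OF edge_loop_continuous])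
      show "continuous_on ({0..1} \<times> ({0..1} - {1/2})) q"
        unfolding q_def by (intro continuous_intros) auto
      show "q ` ({0..1} \<times> ({0..1} - {1/2})) \<subseteq> {0..3}"
      proof
        fix y assume "y \<in> q ` ({0..1} \<times> ({0..1} - {1/2}))"
        then obtain z where z: "z \<in> {0..1} \<times> ({0..1} - {1/2})" "y = q z" by blast
        then have "(1 - fst z) * (1 + snd z) + fst z * (if snd z < 1/2 then 0 else 3) \<in> {0..3}"
          by (intro convex_combination_range) auto
        moreover have "snd z \<noteq> 1/2" using z by auto
        ultimately show "y \<in> {0..3}" using z(2) by (simp add: q mult.commute split: if_splits)
      qed
    qed
    then show ?thesis
      unfolding I prod_topology_subtopology_eu
    proof (rule continuous_map_eq)
      fix z :: "real \<times> real" assume "z \<in> topspace (top_of_set ({0..1} \<times> ({0..1} - {1/2 :: real})))"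
      then have "fst z \<in> {0..1}" "snd z \<in> {0..1}" "snd z \<noteq> 1/2" by auto
      then show "edge_loop e (q z) = (case z of (s, t) \<Rightarrow> contract (s, edge_char ends e t))"
        using contract_edge_non_tree[OF True, of "snd z" "fst z"] q[of z] by (simp add: case_prod_unfold)
    qed
  next
    case False
    then obtain v where v: "v \<noteq> root" "e = tree_edge v" by (auto simp: non_tree_def)
    have I: "{t \<in> {0..1}. edge_char ends e t \<in> tree_part} = {0..1}"
      using False by (auto simp: tree_part_def edge_char_def graph_points_def)
    let ?d = "real (depth (parent v))"
    define q where "q = (\<lambda>z :: real \<times> real. (1 - fst z) * (?d + (if ends e = (parent v, v) then snd z else 1 - snd z)))"
    have "continuous_map unit_square (graph_top ends) (\<lambda>z. tree_path v (q z))"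
    proof (rule continuous_map_reparam[OF tree_path_continuous])
      show "continuous_on ({0..1} \<times> {0..1}) q"
        unfolding q_def by (cases "ends e = (parent v, v)") (auto intro!: continuous_intros)
      have d: "real (depth v) = ?d + 1" using depth_parent[OF v(1)] by simp
      show "q ` ({0..1} \<times> {0..1}) \<subseteq> {0..real (depth v)}"
      proof
        fix y assume "y \<in> q ` ({0..1} \<times> {0..1})"
        then obtain s t where st: "s \<in> {0..1}" "t \<in> {0..1}" "y = q (s, t)" by auto
        then show "y \<in> {0..real (depth v)}"
          using convex_combination_range[of s "?d + (if ends e = (parent v, v) then t else 1 - t)" "?d + 1" 0] d
          by (auto simp: q_def)
      qed
    qed auto
    then show ?thesis
      unfolding I prod_topology_subtopology_eu
      by (rule continuous_map_eq) (use contract_edge_tree[OF v] in \<open>auto simp: q_def\<close>)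
  qed
  show "contract (s, x) \<in> topspace (graph_top ends)" if s: "s \<in> {0..1}" and x: "x \<in> tree_part" for s x
  proof -
    have "x \<in> graph_points ends" using x by (simp add: tree_part_def)
    then obtain e t where et: "t \<in> {0..1}" "x = edge_char ends e t"
      using point_in_closed_edge[OF ni] by blast
    then show ?thesis
      using edge[of e] s x by (auto simp: continuous_map_def Pi_iff)
  qed
  show "continuous_map (prod_topology unit_space (top_of_set {t \<in> {0..1}. edge_char ends e t \<in> tree_part}))
      (graph_top ends) (\<lambda>(s, t). contract (s, edge_char ends e t))" for e by (rule edge)
qed

lemma retreat_continuous:
  "continuous_map (prod_topology unit_space (subtopology (graph_top ends) (open_edge e))) (graph_top ends) (retreat e)"
proof (rule continuous_map_edgewise_homotopy[OF ni openin_open_edge])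
  have q: "(1 - s) * (1 + t) \<in> {0..3}" if "s \<in> {0..1}" "t \<in> {0..1}" for s t :: real
    using convex_combination_range[of s "1 + t" 3 0] that by simp
  show "retreat e (s, x) \<in> topspace (graph_top ends)" if "s \<in> {0..1}" "x \<in> open_edge e" for s x
    using that edge_loop_continuous[of e] q by (auto simp: retreat_def open_edge_def continuous_map_def Pi_iff)
  fix e'
  show "continuous_map (prod_topology unit_space (top_of_set {t \<in> {0..1}. edge_char ends e' t \<in> open_edge e}))
      (graph_top ends) (\<lambda>(s, t). retreat e (s, edge_char ends e' t))"
  proof (cases "e' = e")
    case True
    have I: "{t \<in> {0..1}. edge_char ends e' t \<in> open_edge e} = {0<..<1}"
      using True by (auto simp: open_edge_def edge_char_def)
    have "continuous_map (top_of_set ({0..1} \<times> {0<..<1})) (graph_top ends) (\<lambda>z. edge_loop e ((1 - fst z) * (1 + snd z)))"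
      by (rule continuous_map_reparam[OF edge_loop_continuous]) (use q in \<open>auto intro!: continuous_intros\<close>)
    then show ?thesis
      unfolding I prod_topology_subtopology_eu
      by (rule continuous_map_eq) (auto simp: retreat_def)
  next
    case False
    then have I: "{t \<in> {0..1}. edge_char ends e' t \<in> open_edge e} = {}"
      by (auto simp: open_edge_def edge_char_def)
    show ?thesis unfolding I prod_topology_subtopology_eu by simp
  qed
qed

lemma edge_loop_in_loops: "(\<lambda>u. edge_loop e (3 * u)) \<in> loops_at (graph_top ends) (Inl root)"
  unfolding loops_at_iff
  by (auto simp: edge_loop_values intro!: continuous_map_reparam[OF edge_loop_continuous] continuous_intros)

text \<open>The charts are \<open>tree_part\<close> and the open edges outside the tree. Such an
  edge overlaps \<open>tree_part\<close> in its two halves: on the first both contractions leave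
  through the start vertex, on the second they leave through opposite ends. So a change of charts
  multiplies by the class of \<open>edge_loop e\<close>, by its inverse, or by nothing.\<close>

lemma finitely_generated_if_finite_non_tree:
  assumes "finite non_tree"
  shows "finitely_generated_group (fundamental_group (graph_top ends) (Inl root))"
proof -
  let ?T = "graph_top ends" and ?r = "Inl root :: 'v + 'e \<times> real"
  let ?G = "fundamental_group ?T ?r"
  have r: "?r \<in> topspace ?T" by (simp add: topspace_graph_top)
  interpret \<pi>: group ?G using group_fundamental_group[OF r] .
  define c where "c = (\<lambda>e. loop_class ?T ?r (\<lambda>u. edge_loop e (3 * u)))"
  have c: "c ` non_tree \<subseteq> carrier ?G"
    using edge_loop_in_loops by (auto simp: c_def carrier_fundamental_group)
  define \<H> where "\<H> = generate ?G (c ` non_tree)"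
  have \<H>: "subgroup \<H> ?G" unfolding \<H>_def using c by (rule \<pi>.generate_is_subgroup)
  define W where "W = case_option tree_part open_edge"
  define \<kappa> where "\<kappa> = case_option contract retreat"
  define J where "J = insert None (Some ` non_tree)"
  have exits: "loop_class ?T ?r (close_up (retreat e) p) \<in> \<H> \<longleftrightarrow> loop_class ?T ?r (close_up contract p) \<in> \<H>"
    if e: "e \<in> non_tree" and p: "continuous_map unit_space ?T p" "p 0 = ?r"
      and p1: "p 1 \<in> open_edge e" "p 1 \<in> tree_part" for e p
  proof -
    obtain t where t: "p 1 = Inr (e, t)" "0 < t" "t < 1" "t \<noteq> 1/2"
      using p1 e by (auto simp: open_edge_def tree_part_def)
    have ret: "retreat e (s, p 1) = edge_loop e ((1 + t) * (1 - s))" for s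
      using t by (simp add: retreat_def mult.commute)
    show ?thesis
    proof (cases "t < 1/2")
      case True
      then have "contract (s, p 1) = edge_loop e ((1 + t) * (1 - s))" for s
        using t e by (simp add: contract_def mult.commute)
      then have "close_up (retreat e) p = close_up contract p"
        using ret by (simp add: fun_eq_iff close_up_def)
      then show ?thesis by simp
    next
      case False
      have con: "contract (s, p 1) = edge_loop e ((1 + t) + (3 - (1 + t)) * s)" for s
        using t e False by (simp add: contract_def algebra_simps)
      have pe: "p 1 = edge_loop e (1 + t)" using t edge_loop_values(3)[of t e] by simp
      have t3: "1 + t \<in> {0..3}" using t by simp
      note sw = switch_exit[OF edge_loop_continuous edge_loop_values(1,2) p pe t3]
      have f: "close_up (retreat e) p = (\<lambda>u. if u \<le> 1/2 then p (2 * u) else edge_loop e ((1 + t) * (1 - (2 * u - 1))))"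
        by (simp add: fun_eq_iff close_up_def ret)
      have h: "close_up contract p = (\<lambda>u. if u \<le> 1/2 then p (2 * u) else edge_loop e ((1 + t) + (3 - (1 + t)) * (2 * u - 1)))"
        by (simp add: fun_eq_iff close_up_def con)
      have fl: "close_up (retreat e) p \<in> loops_at ?T ?r" using sw(1) f by simp
      have eq: "loop_class ?T ?r (close_up (retreat e) p) \<otimes>\<^bsub>?G\<^esub> c e = loop_class ?T ?r (close_up contract p)"
        unfolding c_def mult_fundamental_group[OF fl edge_loop_in_loops]
        using loop_class_eqI[OF sw(3)] f h by simp
      have ce: "c e \<in> \<H>" unfolding \<H>_def using e by (intro generate.incl) auto
      have fc: "loop_class ?T ?r (close_up (retreat e) p) \<in> carrier ?G"
        using fl by (simp add: carrier_fundamental_group)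
      have cc: "c e \<in> carrier ?G" using c e by blast
      have hc: "loop_class ?T ?r (close_up contract p) \<in> carrier ?G"
        using \<pi>.m_closed[OF fc cc] eq by simp
      have "loop_class ?T ?r (close_up (retreat e) p) =
          loop_class ?T ?r (close_up contract p) \<otimes>\<^bsub>?G\<^esub> inv\<^bsub>?G\<^esub> c e"
        using \<pi>.inv_solve_right[OF fc hc cc] eq by simp
      then show ?thesis
        using eq ce subgroup.m_closed[OF \<H>] subgroup.m_inv_closed[OF \<H>] by metis
    qed
  qed
  have "loop_class ?T ?r g \<in> \<H>" if g: "g \<in> loops_at ?T ?r" for g
  proof (rule loops_generated_by_charts[where W = W and \<kappa> = \<kappa> and J = J and ?j0.0 = None])
    show "openin ?T (W j)" if "j \<in> J" for j
      using openin_tree_part openin_open_edge by (auto simp: W_def split: option.splits)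
    have "Inr (e, 1/2) \<in> open_edge e" for e
      unfolding open_edge_def by (intro CollectI exI[of _ "1/2"]) auto
    then show "topspace ?T \<subseteq> (\<Union>j\<in>J. W j)"
      by (auto simp: W_def J_def topspace_graph_top tree_part_def)
    show "continuous_map (prod_topology unit_space (subtopology ?T (W j))) ?T (\<kappa> j)" if "j \<in> J" for j
      using contract_continuous retreat_continuous by (auto simp: W_def \<kappa>_def split: option.splits)
    have "contract (0, x) = x \<and> contract (1, x) = ?r" if x: "x \<in> tree_part" for x
    proof -
      have "x \<in> graph_points ends" using x by (simp add: tree_part_def)
      then obtain e t where et: "t \<in> {0..1}" "x = edge_char ends e t"
        using point_in_closed_edge[OF ni] by blast
      show ?thesis
      proof (cases "e \<in> non_tree")
        case True
        then have "t \<noteq> 1/2" using et x by (auto simp: tree_part_def)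
        then show ?thesis using et True by (auto simp: contract_edge_non_tree edge_loop_values)
      next
        case False
        then obtain v where v: "v \<noteq> root" "e = tree_edge v" by (auto simp: non_tree_def)
        define \<tau> where "\<tau> = (if ends e = (parent v, v) then t else 1 - t)"
        have \<tau>: "\<tau> \<in> {0..1}" using et by (simp add: \<tau>_def)
        have "tree_path v (real (depth (parent v)) + \<tau>) = descend v \<tau>"
        proof (cases "\<tau> = 0")
          case True
          then show ?thesis using v by (simp add: tree_path_step tree_path_depth descend_ends)
        qed (use v \<tau> in \<open>simp add: tree_path_step\<close>)
        also have "\<dots> = x" using et v by (simp add: descend_def \<tau>_def)
        finally show ?thesis
          using et contract_edge_tree[OF v et(1), of 0] contract_edge_tree[OF v et(1), of 1]
          by (simp add: \<tau>_def tree_path_0)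
      qed
    qed
    moreover have "retreat e (0, x) = x \<and> retreat e (1, x) = ?r" if "x \<in> open_edge e" for e x
      using that by (auto simp: retreat_def open_edge_def edge_loop_values)
    ultimately show "\<kappa> j (0, x) = x" "\<kappa> j (1, x) = ?r" if "x \<in> W j" for j x
      using that by (auto simp: W_def \<kappa>_def split: option.splits)
    show "None \<in> J" "?r \<in> W None" by (auto simp: J_def W_def tree_part_def)
    show "\<kappa> None (s, ?r) = ?r" for s
      using depth_0[of root] by (simp add: \<kappa>_def contract_def branch_def tree_path_root)
    show "loop_class ?T ?r (\<lambda>t. ?r) \<in> \<H>"
      using subgroup.one_closed[OF \<H>] by (simp add: one_fundamental_group)
    show "loop_class ?T ?r (close_up (\<kappa> k) p) \<in> \<H>"
      if jk: "j \<in> J" "k \<in> J" and p: "continuous_map unit_space ?T p" "p 0 = ?r" "p 1 \<in> W j" "p 1 \<in> W k"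
        and m: "loop_class ?T ?r (close_up (\<kappa> j) p) \<in> \<H>" for j k p
    proof -
      \<comment> \<open>Distinct open edges are disjoint, so proper changes only occur between an
        edge and the tree part.\<close>
      consider "j = k" | e where "j = None" "k = Some e" "e \<in> non_tree" | e where "j = Some e" "k = None" "e \<in> non_tree"
        | e e' where "j = Some e" "k = Some e'" "e \<noteq> e'"
        using jk by (auto simp: J_def)
      then show ?thesis
      proof cases
        case 4
        then show ?thesis using p by (auto simp: W_def open_edge_def)
      qed (use m p exits in \<open>auto simp: W_def \<kappa>_def\<close>)
    qed
    show "g \<in> loops_at ?T ?r" by (rule g)
  qed
  then have "carrier ?G \<subseteq> generate ?G (c ` non_tree)"
    by (auto simp: carrier_fundamental_group \<H>_def)
  then have "generate ?G (c ` non_tree) = carrier ?G"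
    using \<pi>.generate_incl[OF c] by blast
  then show ?thesis
    unfolding finitely_generated_group_def using assms c by blast
qed

end

section \<open>The Grigorchuk group acts on infinitely many parallel edges\<close>

text \<open>The edge type is inhabited. A vertex is either the start vertex of some fixed edge or
  joined to it by a path, whose first step is an incident edge.\<close>

lemma no_isolated_if_connected:
  fixes ends :: "'e \<Rightarrow> 'v \<times> 'v"
  assumes "graph_connected ends"
  shows "no_isolated_vertices ends"
  unfolding no_isolated_vertices_def
proof
  fix v
  obtain e :: 'e where True by blast
  have "(v, fst (ends e)) \<in> (graph_adj ends)\<^sup>*"
    using assms by (simp add: graph_connected_def)
  then show "incident ends v \<noteq> {}"
  proof (cases rule: converse_rtranclE)
    case base
    then show ?thesis by (auto simp: incident_def)
  next
    case (step y)
    then obtain e' where "ends e' = (v, y) \<or> ends e' = (y, v)" by (auto simp: graph_adj_def)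
    then have "e' \<in> incident ends v" by (auto simp: incident_def)
    then show ?thesis by blast
  qed
qed

text \<open>A breadth-first tree: depth is the distance from the root, and the parent is the last
  vertex but one on a shortest path.\<close>

lemma rooted_graph_exists:
  fixes ends :: "'e \<Rightarrow> 'v \<times> 'v"
  assumes "graph_connected ends" "graph_locally_finite ends"
  shows "\<exists>root depth parent tree_edge. rooted_graph ends root depth parent tree_edge"
proof -
  define root where "root = (undefined :: 'v)"
  let ?A = "graph_adj ends"
  define depth where "depth = (\<lambda>v. LEAST n. (root, v) \<in> ?A ^^ n)"
  have reach: "(root, v) \<in> ?A ^^ depth v" for v
  proof -
    have "(root, v) \<in> ?A\<^sup>*" using assms(1) by (simp add: graph_connected_def)
    then show ?thesis unfolding depth_def by (metis LeastI rtrancl_imp_relpow)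
  qed
  have le: "depth v \<le> n" if "(root, v) \<in> ?A ^^ n" for v n
    unfolding depth_def using that by (rule Least_le)
  have d0: "depth v = 0 \<longleftrightarrow> v = root" for v
  proof
    assume "depth v = 0"
    then show "v = root" using reach[of v] by simp
  qed (use le[of root 0] in simp)
  have "\<exists>u e. depth v = Suc (depth u) \<and> (ends e = (u, v) \<or> ends e = (v, u))" if v: "v \<noteq> root" for v
  proof -
    obtain k where k: "depth v = Suc k" using d0[of v] v by (cases "depth v") auto
    then have "(root, v) \<in> ?A ^^ Suc k" using reach[of v] by simp
    then obtain u where u: "(root, u) \<in> ?A ^^ k" "(u, v) \<in> ?A" by auto
    have "(root, v) \<in> ?A ^^ Suc (depth u)" using reach[of u] u(2) by auto
    then have "depth v \<le> Suc (depth u)" by (rule le)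
    then have "depth v = Suc (depth u)" using le[OF u(1)] k by simp
    then show ?thesis using u(2) by (auto simp: graph_adj_def)
  qed
  then obtain parent tree_edge where "\<And>v. v \<noteq> root \<Longrightarrow> depth v = Suc (depth (parent v)) \<and>
      (ends (tree_edge v) = (parent v, v) \<or> ends (tree_edge v) = (v, parent v))"
    by metis
  then have "rooted_graph ends root depth parent tree_edge"
    using assms no_isolated_if_connected d0 by unfold_locales auto
  then show ?thesis by blast
qed

text \<open>Choose recursively, each time avoiding the finitely many earlier values.\<close>

lemma injective_choice:
  fixes A :: "nat \<Rightarrow> 'a set"
  assumes "\<And>k. infinite (A k)"
  shows "\<exists>f. inj f \<and> (\<forall>k. f k \<in> A k)"
proof -
  have "\<exists>f. \<forall>k. f k \<in> A k - f ` {..<k}"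
  proof (rule dependent_wellorder_choice)
    fix f g :: "nat \<Rightarrow> 'a" and r k
    assume "\<And>j. j < k \<Longrightarrow> f j = g j"
    then have "f ` {..<k} = g ` {..<k}" by (intro image_cong) auto
    then show "(r \<in> A k - f ` {..<k}) = (r \<in> A k - g ` {..<k})" by simp
  next
    fix f :: "nat \<Rightarrow> 'a" and k
    have "infinite (A k - f ` {..<k})" using assms by (intro Diff_infinite_finite) auto
    then show "\<exists>r. r \<in> A k - f ` {..<k}" using infinite_imp_nonempty by blast
  qed
  then obtain f where f: "\<And>k. f k \<in> A k - f ` {..<k}" by blast
  have "f j \<noteq> f k" if "j < k" for j k using f[of k] that by (metis Diff_iff imageI lessThan_iff)
  then have "inj f" by (intro injI) (metis nat_neq_iff)
  then show ?thesis using f by blast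
qed

text \<open>The edge \<open>\<iota> w\<close> is slid up the tree to the vertices \<open>U n\<close>, \<open>V n\<close> of depth \<open>n\<close>,
  where \<open>n\<close> is one more than the length of \<open>w\<close>.\<close>

locale labelled_edges = rooted_graph +
  fixes \<iota> :: "bool list \<Rightarrow> 'a" and U V :: "nat \<Rightarrow> 'b"
  assumes \<iota>_inj: "inj \<iota>"
    and \<iota>_deep: "\<iota> w \<in> deep (Suc (length w))"
    and \<iota>_U: "ancestor (Suc (length w)) (fst (ends (\<iota> w))) = U (Suc (length w))"
    and \<iota>_V: "ancestor (Suc (length w)) (snd (ends (\<iota> w))) = V (Suc (length w))"
begin

definition level :: "'a \<Rightarrow> nat" where
  "level e = Suc (length (inv_into UNIV \<iota> e))"

definition slid_ends :: "'a \<Rightarrow> 'b \<times> 'b" where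
  "slid_ends e = (if e \<in> range \<iota> then (U (level e), V (level e)) else ends e)"

definition start_path :: "'a \<Rightarrow> real \<Rightarrow> 'b + 'a \<times> real" where
  "start_path e t = (let v = fst (ends e) in
     tree_path v (real (level e) + t * (real (depth v) - real (level e))))"

definition end_path :: "'a \<Rightarrow> real \<Rightarrow> 'b + 'a \<times> real" where
  "end_path e t = (let v = snd (ends e) in
     tree_path v (real (depth v) - t * (real (depth v) - real (level e))))"

lemma inv_\<iota> [simp]: "inv_into UNIV \<iota> (\<iota> w) = w"
  using \<iota>_inj by simp

lemma level_\<iota>: "level (\<iota> w) = Suc (length w)"
  by (simp add: level_def)

lemma slid_ends_\<iota>: "slid_ends (\<iota> w) = (U (Suc (length w)), V (Suc (length w)))"
  by (simp add: slid_ends_def level_\<iota>)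

lemma depth_UV:
  fixes w :: "bool list"
  shows "depth (U (Suc (length w))) = Suc (length w)" "depth (V (Suc (length w))) = Suc (length w)"
  using \<iota>_deep[of w] by (simp_all add: deep_def depth_ancestor \<iota>_U[symmetric] \<iota>_V[symmetric])

lemma \<iota>_not_tree: "v \<noteq> root \<Longrightarrow> tree_edge v \<notin> range \<iota>"
proof
  assume "v \<noteq> root" "tree_edge v \<in> range \<iota>"
  then obtain w where "tree_edge v = \<iota> w" by blast
  then have "tree_edge v \<in> non_tree" using \<iota>_deep[of w] by (simp add: deep_def)
  then show False using \<open>v \<noteq> root\<close> by (simp add: non_tree_def)
qed

lemma segment_range:
  assumes "real n \<le> d" "t \<in> {0..1}"
  shows "real n + t * (d - real n) \<in> {real n..d}" "d - t * (d - real n) \<in> {real n..d}"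
proof -
  have "t * (d - real n) \<le> 1 * (d - real n)" "0 \<le> t * (d - real n)"
    using assms mult_right_mono[of t 1 "d - real n"] by auto
  then show "real n + t * (d - real n) \<in> {real n..d}" "d - t * (d - real n) \<in> {real n..d}" by auto
qed

lemma finite_short_words: "finite {w :: bool list. Suc (length w) \<le> n}"
  using finite_lists_length_le[of "UNIV :: bool set" n] by (rule finite_subset[rotated]) auto

text \<open>A tree edge leading to depth m supports only slides of level at most m, that is, of
  words shorter than m, and these are finitely many. Levels are positive, so the supporting edges
  are genuine tree edges and are themselves never slid.\<close>

sublocale slide: edge_slide ends slid_ends "range \<iota>" start_path end_path
  "\<lambda>e. tree_edge ` {u. level e \<le> depth u}"
proof
  show "graph_locally_finite ends" by (rule lf)
  show "no_isolated_vertices ends" by (rule ni)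
  show "graph_locally_finite slid_ends"
    unfolding graph_locally_finite_def
  proof
    fix v
    \<comment> \<open>New edges at \<open>v\<close> have level equal to the depth of
      \<open>v\<close>, which bounds the length of their words.\<close>
    have "{e. fst (slid_ends e) = v \<or> snd (slid_ends e) = v}
      \<subseteq> incident ends v \<union> \<iota> ` {w. Suc (length w) \<le> depth v}"
      by (auto simp: slid_ends_def level_\<iota> incident_def depth_UV)
    moreover have "finite (incident ends v \<union> \<iota> ` {w. Suc (length w) \<le> depth v})"
      using finite_incident[OF lf] finite_short_words by blast
    ultimately show "finite {e. fst (slid_ends e) = v \<or> snd (slid_ends e) = v}"
      by (rule finite_subset)
  qed
  show "no_isolated_vertices slid_ends"
    unfolding no_isolated_vertices_def
  proof
    fix v
    have "\<exists>u. u \<noteq> root \<and> (u = v \<or> parent u = v)"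
    proof (cases "v = root")
      case True
      \<comment> \<open>The root needs a child: the edge of the empty word has its ends at depth at
        least 1, so an ancestor of depth 1 exists.\<close>
      define x where "x = ancestor 1 (fst (ends (\<iota> [])))"
      have x: "depth x = 1" unfolding x_def using \<iota>_deep[of "[]"] by (simp add: deep_def depth_ancestor)
      then have "x \<noteq> root" using depth_0[of x] by auto
      then have "parent x = root" using depth_parent[of x] x depth_0[of "parent x"] by simp
      then show ?thesis using True \<open>x \<noteq> root\<close> by blast
    qed blast
    then obtain u where u: "u \<noteq> root" "u = v \<or> parent u = v" by blast
    have "slid_ends (tree_edge u) = ends (tree_edge u)" using \<iota>_not_tree[OF u(1)] by (simp add: slid_ends_def)
    then have "tree_edge u \<in> incident slid_ends v"
      using tree_edge[OF u(1)] u(2) by (auto simp: incident_def)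
    then show "incident slid_ends v \<noteq> {}" by blast
  qed
  show "e \<notin> range \<iota> \<Longrightarrow> slid_ends e = ends e" for e by (simp add: slid_ends_def)
  have tree: "v \<noteq> root \<Longrightarrow> slid_ends (tree_edge v) = ends (tree_edge v)" for v
    using \<iota>_not_tree by (simp add: slid_ends_def)
  show "tree_edge ` {u. level e \<le> depth u} \<inter> range \<iota> = {}" for e
  proof -
    have "u \<noteq> root" if "level e \<le> depth u" for u
      using that depth_0[of u] by (auto simp: level_def)
    then show ?thesis using \<iota>_not_tree by blast
  qed
  show "finite {e \<in> range \<iota>. f \<in> tree_edge ` {u. level e \<le> depth u}}" for f
  proof -
    define n where "n = depth (child f)"
    have "{e \<in> range \<iota>. f \<in> tree_edge ` {u. level e \<le> depth u}} \<subseteq> \<iota> ` {w. Suc (length w) \<le> n}"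
    proof
      fix e assume "e \<in> {e \<in> range \<iota>. f \<in> tree_edge ` {u. level e \<le> depth u}}"
      then obtain w u where w: "e = \<iota> w" "f = tree_edge u" "Suc (length w) \<le> depth u"
        by (auto simp: level_\<iota>)
      then have "u \<noteq> root" using depth_0[of u] by auto
      then have "n = depth u" using w by (simp add: n_def child_tree_edge)
      then show "e \<in> \<iota> ` {w. Suc (length w) \<le> n}" using w by blast
    qed
    then show ?thesis by (rule finite_subset) (simp add: finite_short_words)
  qed
  fix e assume "e \<in> range \<iota>"
  then obtain w where w: "e = \<iota> w" by blast
  let ?n = "Suc (length w)"
  have le: "?n \<le> depth (fst (ends e))" "?n \<le> depth (snd (ends e))"
    using \<iota>_deep[of w] by (simp_all add: w deep_def)
  then have le': "real ?n \<le> real (depth (fst (ends e)))" "real ?n \<le> real (depth (snd (ends e)))"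
    by linarith+
  show "start_path e 0 = Inl (fst (slid_ends e))" "end_path e 1 = Inl (snd (slid_ends e))"
    using tree_path_ancestor[OF le(1)] tree_path_ancestor[OF le(2)] \<iota>_U[of w] \<iota>_V[of w]
    by (simp_all add: start_path_def end_path_def w level_\<iota> slid_ends_\<iota>)
  show "start_path e 1 = Inl (fst (ends e))" "end_path e 0 = Inl (snd (ends e))"
    by (simp_all add: start_path_def end_path_def tree_path_depth)
  have cont: "continuous_map unit_space (graph_top ends') (start_path e)"
    "continuous_map unit_space (graph_top ends') (end_path e)"
    if ends': "\<And>v. v \<noteq> root \<Longrightarrow> ends' (tree_edge v) = ends (tree_edge v)" for ends'
  proof -
    show "continuous_map unit_space (graph_top ends') (start_path e)"
      unfolding start_path_def Let_def
    proof (rule continuous_map_reparam[OF tree_path_continuous])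
      show "(\<lambda>t. real (level e) + t * (real (depth (fst (ends e))) - real (level e))) ` {0..1}
          \<subseteq> {0..real (depth (fst (ends e)))}"
        using segment_range(1)[OF le'(1)] by (fastforce simp: w level_\<iota>)
    qed (auto intro!: continuous_intros ends')
    show "continuous_map unit_space (graph_top ends') (end_path e)"
      unfolding end_path_def Let_def
    proof (rule continuous_map_reparam[OF tree_path_continuous])
      show "(\<lambda>t. real (depth (snd (ends e))) - t * (real (depth (snd (ends e))) - real (level e))) ` {0..1}
          \<subseteq> {0..real (depth (snd (ends e)))}"
        using segment_range(2)[OF le'(2)] by (fastforce simp: w level_\<iota>)
    qed (auto intro!: continuous_intros ends')
  qed
  show "continuous_map unit_space (graph_top ends) (start_path e)"
    "continuous_map unit_space (graph_top ends) (end_path e)" by (rule cont; rule refl)+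
  show "continuous_map unit_space (graph_top slid_ends) (start_path e)"
    "continuous_map unit_space (graph_top slid_ends) (end_path e)" by (rule cont; erule tree)+
  fix t :: real assume t: "t \<in> {0..1}"
  have "start_path e t \<in> tree_path (fst (ends e)) ` {real ?n..real (depth (fst (ends e)))}"
    unfolding start_path_def Let_def w level_\<iota>
    by (intro imageI segment_range(1)[OF le'(1)[unfolded w] t])
  then obtain y where y: "start_path e t = tree_path (fst (ends e)) y"
    "y \<in> {real ?n..real (depth (fst (ends e)))}" by (rule imageE)
  from tree_path_support[OF y(2)] obtain u
    where "?n \<le> depth u" "start_path e t \<in> closed_edge ends (tree_edge u)"
    unfolding y(1) by blast
  then show "start_path e t \<in> (\<Union>f\<in>tree_edge ` {u. level e \<le> depth u}. closed_edge ends f)"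
    unfolding w level_\<iota> by (intro UN_I[OF imageI]) auto
  have "end_path e t \<in> tree_path (snd (ends e)) ` {real ?n..real (depth (snd (ends e)))}"
    unfolding end_path_def Let_def w level_\<iota>
    by (intro imageI segment_range(2)[OF le'(2)[unfolded w] t])
  then obtain y where y: "end_path e t = tree_path (snd (ends e)) y"
    "y \<in> {real ?n..real (depth (snd (ends e)))}" by (rule imageE)
  from tree_path_support[OF y(2)] obtain u
    where "?n \<le> depth u" "end_path e t \<in> closed_edge ends (tree_edge u)"
    unfolding y(1) by blast
  then show "end_path e t \<in> (\<Union>f\<in>tree_edge ` {u. level e \<le> depth u}. closed_edge ends f)"
    unfolding w level_\<iota> by (intro UN_I[OF imageI]) auto
qed

section \<open>The embedding of the Grigorchuk group\<close>

definition relabel :: "(bool list \<Rightarrow> bool list) \<Rightarrow> 'a \<Rightarrow> 'a" where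
  "relabel g e = (if e \<in> range \<iota> then \<iota> (g (inv_into UNIV \<iota> e)) else e)"

lemma relabel_\<iota>: "relabel g (\<iota> w) = \<iota> (g w)"
  by (simp add: relabel_def)

lemma relabel_compose: "relabel (g \<circ> h) = relabel g \<circ> relabel h"
  by (auto simp: fun_eq_iff relabel_def)

lemma relabel_id: "relabel id = id"
  by (auto simp: fun_eq_iff relabel_def)

lemma relabel_symmetry: "slide.symmetry (relabel (word_act w))"
  unfolding slide.symmetry_def
proof (intro conjI allI)
  have "word_act (rev w) \<circ> word_act w = id" "word_act w \<circ> word_act (rev w) = id"
    by (auto simp: fun_eq_iff word_act_rev)
  then show "bij (relabel (word_act w))"
    by (intro o_bij[of "relabel (word_act (rev w))"]) (simp_all add: relabel_compose[symmetric] relabel_id)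
  show "slid_ends (relabel (word_act w) e) = slid_ends e" for e
    by (cases "e \<in> range \<iota>") (auto simp: relabel_def slid_ends_\<iota> length_word_act)
qed

definition action :: "(bool list \<Rightarrow> bool list) \<Rightarrow> ('b + 'a \<times> real \<Rightarrow> 'b + 'a \<times> real) set" where
  "action g = ph_class (graph_top ends) (slide.twist (relabel g))"

lemma action_hom: "action \<in> hom Grigorchuk_group (PMapGroup (graph_top ends))"
proof (rule homI)
  fix g assume "g \<in> carrier Grigorchuk_group"
  then show "action g \<in> carrier (PMapGroup (graph_top ends))"
    unfolding action_def carrier_Grigorchuk using slide.twist_class_in_PMapGroup relabel_symmetry by blast
next
  fix g h assume gh: "g \<in> carrier Grigorchuk_group" "h \<in> carrier Grigorchuk_group"
  then obtain v w where vw: "g = word_act v" "h = word_act w" by (auto simp: carrier_Grigorchuk)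
  have "action (g \<circ> h) = action g \<otimes>\<^bsub>MapGroup (graph_top ends)\<^esub> action h"
    unfolding action_def relabel_compose vw
    using slide.twist_class_mult[OF relabel_symmetry relabel_symmetry] by metis
  then show "action (g \<otimes>\<^bsub>Grigorchuk_group\<^esub> h) = action g \<otimes>\<^bsub>PMapGroup (graph_top ends)\<^esub> action h"
    using gh by (simp add: Grigorchuk_mult PMapGroup_def)
qed

text \<open>A label on which two elements differ is nonempty, since the empty word is fixed.
  Flipping its first bit gives a second label of equal length, hence the parallel edge that the
  winding number argument requires.\<close>

lemma action_inj: "inj_on action (carrier Grigorchuk_group)"
proof (rule inj_onI, rule ccontr)
  fix g h assume gh: "g \<in> carrier Grigorchuk_group" "h \<in> carrier Grigorchuk_group"
    and eq: "action g = action h" and "g \<noteq> h"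
  obtain x y where xy: "g = word_act x" "h = word_act y" using gh by (auto simp: carrier_Grigorchuk)
  obtain w where w: "g w \<noteq> h w" using \<open>g \<noteq> h\<close> by blast
  then obtain b w' where bw: "w = b # w'" using xy by (cases w) auto
  have "\<iota> (g w) \<noteq> \<iota> (h w)" using w \<iota>_inj by (simp add: inj_eq)
  then have "relabel g (\<iota> w) \<noteq> relabel h (\<iota> w)" by (simp add: relabel_\<iota>)
  moreover have "\<iota> ((\<not> b) # w') \<noteq> \<iota> w" using bw \<iota>_inj by (simp add: inj_eq)
  moreover have "slid_ends (\<iota> ((\<not> b) # w')) = slid_ends (\<iota> w)" by (simp add: slid_ends_\<iota> bw)
  ultimately have "action g \<noteq> action h"
    unfolding action_def xy by (intro slide.twist_class_neq relabel_symmetry)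
  then show False using eq by simp
qed

end

lemma (in rooted_graph) Grigorchuk_embeds:
  assumes "infinite non_tree"
  shows "\<exists>\<phi>. \<phi> \<in> hom Grigorchuk_group (PMapGroup (graph_top ends)) \<and> inj_on \<phi> (carrier Grigorchuk_group)"
proof -
  define M where "M = (\<lambda>n u w. {e \<in> deep n. ancestor n (fst (ends e)) = u \<and> ancestor n (snd (ends e)) = w})"
  have "\<exists>u w. infinite (M n u w)" for n
    unfolding M_def by (rule infinite_parallel[OF assms, of n]) blast
  then obtain U V where UV: "\<And>n. infinite (M n (U n) (V n))" by metis
  \<comment> \<open>Words of equal length draw on the same infinite set of parallel candidates, so
    distinct edges are picked along an enumeration of all words.\<close>
  define A where "A = (\<lambda>k. let n = Suc (length (from_nat k :: bool list)) in M n (U n) (V n))"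
  have "infinite (A k)" for k using UV by (simp add: A_def Let_def)
  then obtain f where f: "inj f" "\<And>k. f k \<in> A k" using injective_choice[of A] by blast
  define \<iota> where "\<iota> = (\<lambda>w :: bool list. f (to_nat w))"
  have \<iota>: "\<iota> w \<in> M (Suc (length w)) (U (Suc (length w))) (V (Suc (length w)))" for w
    using f(2)[of "to_nat w"] by (simp add: \<iota>_def A_def Let_def)
  interpret labelled_edges ends root depth parent tree_edge \<iota> U V
  proof
    show "inj \<iota>" unfolding \<iota>_def using inj_compose[OF f(1) inj_to_nat] by (simp add: o_def)
  qed (use \<iota> in \<open>auto simp: M_def\<close>)
  show ?thesis using action_hom action_inj by blast
qed

theorem mainTheorem16:
  fixes ends :: "'e \<Rightarrow> 'v \<times> 'v"
  assumes "graph_connected ends"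
    and "graph_locally_finite ends"
    and "graph_infinite_rank ends"
  shows "(\<exists>H. subgroup H (PMapGroup (graph_top ends)) \<and>
            Grigorchuk_group \<cong> (PMapGroup (graph_top ends))\<lparr>carrier := H\<rparr>)
       \<and> \<not> tits_alternative (PMapGroup (graph_top ends))
       \<and> \<not> tits_alternative (MapGroup (graph_top ends))"
proof -
  let ?PM = "PMapGroup (graph_top ends)" and ?M = "MapGroup (graph_top ends)"
  obtain root depth parent tree_edge where "rooted_graph ends root depth parent tree_edge"
    using rooted_graph_exists[OF assms(1,2)] by blast
  then interpret rooted_graph ends root depth parent tree_edge .
  have "infinite non_tree"
    using assms(3) finitely_generated_if_finite_non_tree
    unfolding graph_infinite_rank_def topspace_graph_top by auto
  then obtain \<phi> where \<phi>: "\<phi> \<in> hom Grigorchuk_group ?PM" "inj_on \<phi> (carrier Grigorchuk_group)"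
    using Grigorchuk_embeds by blast
  \<comment> \<open>The pure group carries the multiplication of the full group, so the same map
    embeds into both.\<close>
  have "carrier ?PM \<subseteq> carrier ?M" by (rule subgroup.subset[OF graph.subgroup_PMapGroup])
  then have "\<phi> \<in> hom Grigorchuk_group ?M"
    using \<phi>(1) by (auto simp: hom_def PMapGroup_def)
  then show ?thesis
    using embedded_Grigorchuk[OF graph.group_PMapGroup \<phi>]
      embedded_Grigorchuk(3)[OF graph.group_MapGroup _ \<phi>(2)] by blast
qed

end
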